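(* Let $(\tau:X\to\mathsf{HySSub},\ \psi:b\to\Pi(\tau))$ and $(\mu:Y\to\mathsf{HySSub},\ \nu:c\to\Pi(\mu))$ be networks of hybrid open systems, and let $$((\varphi,\Phi),f):(\tau,\psi)\to(\mu,\nu)$$ be a map of networks of hybrid open systems. Then the square with - top horizontal arrow the linear relation $\odot(\varphi,\mathsf{Crl}\circ\mathbb{U}\circ\Phi):\bigoplus_{y\in Y}\mathsf{Crl}(\mathbb{U}(\mu(y)))\to\bigoplus_{x\in X}\mathsf{Crl}(\mathbb{U}(\tau(x)))$, - bottom horizontal arrow the linear relation $\mathsf{Crl}(\mathbb{U}(f)):\mathsf{Crl}(\mathbb{U}(c))\to\mathsf{Crl}(\mathbb{U}(b))$, - left vertical arrow the linear map $(\mathbb{U}(\nu))^*\circ\mathsf{Crl}_{\mathbb{U}\circ\mu}:\bigoplus_{y\in Y}\mathsf{Crl}(\mathbb{U}(\mu(y)))\to\mathsf{Crl}(\mathbb{U}(c))$, - right vertical arrow the linear map $(\mathbb{U}(\psi))^*\circ\mathsf{Crl}_{\mathbb{U}\circ\tau}:\bigoplus_{x\in X}\mathsf{Crl}(\mathbb{U}(\tau(x)))\to\mathsf{Crl}(\mathbb{U}(b))$ is a 2-cell, from the top relation to the bottom relation, in the double category $\mathsf{RelVect}^\Box$ of vector spaces, linear maps and linear relations. That is, $$\big(((\mathbb{U}(\nu))^*\circ\mathsf{Crl}_{\mathbb{U}\circ\mu})\times((\mathbb{U}(\psi))^*\circ\mathsf{Crl}_{\mathbb{U}\circ\tau})\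big)\big(\odot(\varphi,\mathsf{Crl}\circ\mathbb{U}\circ\Phi)\big)\subset\mathsf{Crl}(\mathbb{U}(f)).$$
   Context: **Manifolds.** $\mathsf{Man}$ is the category of (Hausdorff, paracompact) manifolds with corners, locally modelled on sectors $[0,\infty)^k\times\mathbb{R}^{n-k}$; a map is smooth if in charts it extends locally to a smooth map between open subsets of Euclidean spaces. Different components may have different dimensions. $TM$ is the tangent bundle (all of whose fibres are vector spaces, also at boundary points). Manifolds are nonempty unless mentioned otherwise. **Relations.** A relation $R:A\to B$ is a subset $R\subset A\times B$; the composite of $R:A\to B$ and $S:B\to C$ is $S\circ R=\{(x,z)\mid \exists y:\ (x,y)\in R,\ (y,z)\in S\}$. $\mathsf{RelMan}$ is the category of manifolds with corners and arbitrary set-theoretic relations (identities are the diagonals). A linear relation $V\to W$ between real vector spaces is a linear subspace of $V\times W$. In the double category $\mathsf{RelVect}^\Box$ objects are real vector spaces, vertical arrows are linear maps, horizontal arrows are linear relations, and a 2-cell from a relation $R:V\to W$ to a relation $R':V'\to W'$ is a pair of linear maps $(g:V\to V',\ h:W\to W')$ with $(g\times h)(R)\subset R'$. **Hybrid phase spaces.** A hybrid phase space is a functor $a:S_a\to\mathsf{RelMan}$ from a small category $S_a$ (by convention $S_a$ and all the manifolds $a(x)$ are nonempty). A map $a\to b$ of hybrid phase spaces is a pair consisting of a functor $\varphi:S_a\to S_b$ and a family of smooth maps $\{\Phi_x:a(x)\to b(\varphi(x))\}_{x\in (S_a)_0}$ such that $(\Phi_x\times\Phi_y)(a(\gamma))\subset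 b(\varphi(\gamma))$ for every arrow $\gamma:x\to y$ of $S_a$. The composite is $(\psi,\Psi)\circ(\varphi,\Phi)=(\psi\circ\varphi,\{\Psi_{\varphi(x)}\circ\Phi_x\}_x)$. This gives the category $\mathsf{HyPh}$. It has finite products: $a\times b:S_a\times S_b\to\mathsf{RelMan}$ is $(x,y)\mapsto a(x)\times b(y)$, with the product of relations on arrows. The forgetful functor $\mathbb{U}:\mathsf{HyPh}\to\mathsf{Man}$ sends $a$ to $\bigsqcup_{x\in(S_a)_0}a(x)$ and $(\varphi,\Phi)$ to the map induced by the composites $a(x)\xrightarrow{\Phi_x}b(\varphi(x))\hookrightarrow\mathbb{U}(b)$. It preserves finite products (up to canonical diffeomorphism). **Surjective submersions.** $\mathsf{SSub}$ is the category whose objects are surjective submersions $a=(p_a:a_{\mathsf{tot}}\to a_{\mathsf{st}})$ of manifolds with corners and whose morphisms $f:a\to b$ are pairs of smooth maps $f_{\mathsf{tot}}:a_{\mathsf{tot}}\to b_{\mathsf{tot}}$, $f_{\mathsf{st}}:a_{\mathsf{st}}\to b_{\mathsf{st}}$ with $p_b\circ f_{\mathsf{tot}}=f_{\mathsf{st}}\circ p_a$. A morphism $f$ is an interconnection morphism if $f_{\mathsf{st}}$ is a diffeomorphism. $\mathsf{HySSub}$ is the category whose objects (hybrid surjective submersions) are maps $a=(p_a:a_{\mathsf{tot}}\to a_{\mathsf{st}})$ in $\mathsf{HyPh}$ such that $\mathbb{U}(p_a)$ is a surjective submersion; morphisms $f:a\to b$ are pairs $(f_{\mathsf{tot}},f_{\mathsf{st}})$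 of maps in $\mathsf{HyPh}$ with $p_b\circ f_{\mathsf{tot}}=f_{\mathsf{st}}\circ p_a$. A morphism $f$ in $\mathsf{HySSub}$ is an interconnection morphism if $\mathbb{U}(f)$ is an interconnection morphism in $\mathsf{SSub}$ (i.e. $\mathbb{U}(f_{\mathsf{st}})$ is a diffeomorphism). Applying $\mathbb{U}$ componentwise gives a functor $\mathbb{U}:\mathsf{HySSub}\to\mathsf{SSub}$. Finite products in $\mathsf{SSub}$ and $\mathsf{HySSub}$ are taken componentwise and $\mathbb{U}$ preserves them. **Open systems.** For $a\in\mathsf{SSub}$, $\mathsf{Crl}(a)$ is the real vector space of smooth maps $F:a_{\mathsf{tot}}\to Ta_{\mathsf{st}}$ with $F(q)\in T_{p_a(q)}a_{\mathsf{st}}$ for all $q\in a_{\mathsf{tot}}$. For a morphism $f:a\to b$ in $\mathsf{SSub}$, $\mathsf{Crl}(f):\mathsf{Crl}(a)\to\mathsf{Crl}(b)$ is the linear relation $\{(F,G)\mid G\circ f_{\mathsf{tot}}=Tf_{\mathsf{st}}\circ F\}$. For an interconnection morphism $\varphi:a\to b$ the linear map $\varphi^*:\mathsf{Crl}(b)\to\mathsf{Crl}(a)$ is $\varphi^*F=(T\varphi_{\mathsf{st}})^{-1}\circ F\circ\varphi_{\mathsf{tot}}$. For a finite family $\sigma:X\to\mathsf{SSub}$ the linear map $\mathsf{Crl}_\sigma:\bigoplus_{x\in X}\mathsf{Crl}(\sigma(x))\to\mathsf{Crl}(\prod_{x\in X}\sigma(x))$ is $(F_x)_{x\in X}\mapsto\prod_{x\in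 X}F_x$ (using $T\prod_x\sigma(x)_{\mathsf{st}}=\prod_xT\sigma(x)_{\mathsf{st}}$). **Networks.** For a finite set $X$ and a family (list) $\tau:X\to\mathsf{HySSub}$, write $\Pi(\tau)=\prod_{x\in X}\tau(x)$. A network of hybrid open systems is a pair $(\tau:X\to\mathsf{HySSub},\ \psi:b\to\Pi(\tau))$ with $X$ a finite set and $\psi$ an interconnection morphism in $\mathsf{HySSub}$. A map $((\varphi,\Phi),f)$ from the network $(\tau:X\to\mathsf{HySSub},\psi:b\to\Pi(\tau))$ to the network $(\mu:Y\to\mathsf{HySSub},\nu:c\to\Pi(\mu))$ consists of a map of sets $\varphi:X\to Y$, a family of morphisms $\Phi=\{\Phi_x:\mu(\varphi(x))\to\tau(x)\}_{x\in X}$ in $\mathsf{HySSub}$, and a morphism $f:c\to b$ in $\mathsf{HySSub}$ such that $\Pi(\varphi,\Phi)\circ\nu=\psi\circ f$. Here $\Pi(\varphi,\Phi):\Pi(\mu)\to\Pi(\tau)$ is the unique morphism with $\pi_x\circ\Pi(\varphi,\Phi)=\Phi_x\circ\pi_{\varphi(x)}$ for all $x\in X$, where $\pi_x$, $\pi_{\varphi(x)}$ are the canonical projections. **Notation in the claim.** $\mathbb{U}(\Pi(\tau))$ is identified with $\prod_{x\in X}\mathbb{U}(\tau(x))$, and similarly for $\mu$, so that $(\mathbb{U}(\psi))^*$ and $(\mathbb{U}(\nu))^*$ are defined on the targets of $\mathsf{Crl}_{\mathbb{U}\circ\tau}$ and $\mathsf{Crl}_{\mathbb{U}\circ\mu}$.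 The linear relation $\odot(\varphi,\mathsf{Crl}\circ\mathbb{U}\circ\Phi)$ is $$\Big\{\big((u_y)_{y\in Y},(w_x)_{x\in X}\big)\ \Big|\ (u_{\varphi(x)},w_x)\in\mathsf{Crl}(\mathbb{U}(\Phi_x))\text{ for all }x\in X\Big\}\subset\bigoplus_{y\in Y}\mathsf{Crl}(\mathbb{U}(\mu(y)))\times\bigoplus_{x\in X}\mathsf{Crl}(\mathbb{U}(\tau(x))).$$ *)

theory Defs
  imports
    "Jordan_Normal_Form.Missing_VectorSpace"
    "HOL-Analysis.Analysis"
begin

section \<open>Smooth maps between subsets of Euclidean spaces\<close>

text \<open>
  Dimensions vary between the components of a manifold, so they cannot be types.  The Euclidean
  space with coordinates labelled by a finite set \<open>J\<close>, of dimension \<open>card J\<close>, is the set of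
  functions vanishing off \<open>J\<close>, with the topology induced by the product topology on functions.
  Labels from an arbitrary type rather than \<open>{..<n}\<close> make products and tangent bundles free of
  renumbering.
\<close>

definition coords :: "'c set \<Rightarrow> ('c \<Rightarrow> real) set" where
  "coords J = {x. \<forall>j. j \<notin> J \<longrightarrow> x j = 0}"

text \<open>For \<open>K \<subseteq> J\<close> this is \<open>[0,\<infinity>)\<close> to the \<open>K\<close> times \<open>\<real>\<close> to the \<open>J - K\<close>.\<close>

definition sector :: "'c set \<Rightarrow> 'c set \<Rightarrow> ('c \<Rightarrow> real) set" where
  "sector J K = {x \<in> coords J. \<forall>j\<in>K. 0 \<le> x j}"

text \<open>Real functions of class \<open>C\<^sup>k\<close> on an open subset \<open>W\<close> of \<open>coords J\<close>.\<close>

primrec Ck_on :: "nat \<Rightarrow> 'c set \<Rightarrow> ('c \<Rightarrow> real) set \<Rightarrow> (('c \<Rightarrow> real) \<Rightarrow> real) \<Rightarrow> bool" where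
  "Ck_on 0 J W f \<longleftrightarrow> continuous_on W f"
| "Ck_on (Suc k) J W f \<longleftrightarrow> continuous_on W f \<and>
     (\<forall>j\<in>J. \<exists>g. Ck_on k J W g \<and>
        (\<forall>x\<in>W. ((\<lambda>t. f (x(j := t))) has_real_derivative g x) (at (x j))))"

definition smooth_open ::
    "'c set \<Rightarrow> ('c \<Rightarrow> real) set \<Rightarrow> 'd set \<Rightarrow> (('c \<Rightarrow> real) \<Rightarrow> 'd \<Rightarrow> real) \<Rightarrow> bool" where
  "smooth_open J W J' F \<longleftrightarrow>
     openin (top_of_set (coords J)) W \<and> F \<in> W \<rightarrow> coords J' \<and>
     (\<forall>i\<in>J'. \<forall>k. Ck_on k J W (\<lambda>x. F x i))"

definition smooth_ext ::
    "'c set \<Rightarrow> ('c \<Rightarrow> real) set \<Rightarrow> 'd set \<Rightarrow> (('c \<Rightarrow> real) \<Rightarrow> 'd \<Rightarrow> real) \<Rightarrow> bool" where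
  "smooth_ext J S J' f \<longleftrightarrow>
     (\<forall>x\<in>S. \<exists>W F. x \<in> W \<and> smooth_open J W J' F \<and> (\<forall>y\<in>W \<inter> S. F y = f y))"

text \<open>
  Differential of a map defined on a relatively open subset of a sector, given by its Jacobian.
  Partial derivatives are taken from the right: increasing a coordinate never leaves a sector, so
  at every point, corners included, this computes the Jacobian of any smooth local extension.
\<close>

definition right_partial :: "'c \<Rightarrow> (('c \<Rightarrow> real) \<Rightarrow> real) \<Rightarrow> ('c \<Rightarrow> real) \<Rightarrow> real" where
  "right_partial j f x = vector_derivative (\<lambda>t. f (x(j := t))) (at_right (x j))"

definition differential ::
    "'c set \<Rightarrow> (('c \<Rightarrow> real) \<Rightarrow> 'd \<Rightarrow> real) \<Rightarrow> ('c \<Rightarrow> real) \<Rightarrow> ('c \<Rightarrow> real) \<Rightarrow> 'd \<Rightarrow> real" where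
  "differential J f x v = (\<lambda>i. \<Sum>j\<in>J. right_partial j (\<lambda>y. f y i) x * v j)"


section \<open>Manifolds with corners\<close>

text \<open>
  A chart maps the open set \<open>cdom\<close> homeomorphically onto a relatively open subset of
  \<open>sector (cix c) (ccor c)\<close>.  Atlases are not required to be maximal.
\<close>

record ('p, 'c) chart =
  cix :: "'c set"
  ccor :: "'c set"
  cdom :: "'p set"
  cmap :: "'p \<Rightarrow> 'c \<Rightarrow> real"

record ('p, 'c) mfd =
  mtop :: "'p topology"
  atlas :: "('p, 'c) chart set"

abbreviation pts :: "('p, 'c) mfd \<Rightarrow> 'p set" where
  "pts M \<equiv> topspace (mtop M)"

definition cinv :: "('p, 'c) chart \<Rightarrow> ('c \<Rightarrow> real) \<Rightarrow> 'p" where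
  "cinv c = inv_into (cdom c) (cmap c)"

definition is_chart :: "'p topology \<Rightarrow> ('p, 'c) chart \<Rightarrow> bool" where
  "is_chart X c \<longleftrightarrow>
     finite (cix c) \<and> ccor c \<subseteq> cix c \<and> openin X (cdom c) \<and>
     openin (top_of_set (sector (cix c) (ccor c))) (cmap c ` cdom c) \<and>
     homeomorphic_map (subtopology X (cdom c)) (top_of_set (cmap c ` cdom c)) (cmap c)"

definition paracompact_space :: "'a topology \<Rightarrow> bool" where
  "paracompact_space X \<longleftrightarrow>
     (\<forall>\<U>. (\<forall>U\<in>\<U>. openin X U) \<and> \<Union>\<U> = topspace X \<longrightarrow>
        (\<exists>\<V>. (\<forall>V\<in>\<V>. openin X V) \<and> \<Union>\<V> = topspace X \<and>
             (\<forall>V\<in>\<V>. \<exists>U\<in>\<U>. V \<subseteq> U) \<and> locally_finite_in X \<V>))"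

definition manifold :: "('p, 'c) mfd \<Rightarrow> bool" where
  "manifold M \<longleftrightarrow>
     pts M \<noteq> {} \<and> Hausdorff_space (mtop M) \<and> paracompact_space (mtop M) \<and>
     (\<forall>c\<in>atlas M. is_chart (mtop M) c) \<and> (\<Union>c\<in>atlas M. cdom c) = pts M \<and>
     (\<forall>c\<in>atlas M. \<forall>c'\<in>atlas M.
        smooth_ext (cix c) (cmap c ` (cdom c \<inter> cdom c')) (cix c') (cmap c' \<circ> cinv c))"

definition smooth :: "('p, 'c) mfd \<Rightarrow> ('q, 'd) mfd \<Rightarrow> ('p \<Rightarrow> 'q) \<Rightarrow> bool" where
  "smooth M N f \<longleftrightarrow>
     continuous_map (mtop M) (mtop N) f \<and>
     (\<forall>c\<in>atlas M. \<forall>c'\<in>atlas N.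
        smooth_ext (cix c) (cmap c ` {p \<in> cdom c. f p \<in> cdom c'}) (cix c')
          (cmap c' \<circ> f \<circ> cinv c))"

definition diffeo :: "('p, 'c) mfd \<Rightarrow> ('q, 'd) mfd \<Rightarrow> ('p \<Rightarrow> 'q) \<Rightarrow> bool" where
  "diffeo M N f \<longleftrightarrow>
     smooth M N f \<and> bij_betw f (pts M) (pts N) \<and> smooth N M (inv_into (pts M) f)"


section \<open>Tangent bundles\<close>

text \<open>
  A tangent vector at \<open>p\<close> is a family of coordinate vectors, one for each chart around \<open>p\<close>, related
  by the Jacobians of the changes of coordinates; it is stored together with \<open>p\<close>.
\<close>

type_synonym ('p, 'c) tvec = "'p \<times> (('p, 'c) chart \<Rightarrow> 'c \<Rightarrow> real)"

definition charts_at :: "('p, 'c) mfd \<Rightarrow> 'p \<Rightarrow> ('p, 'c) chart set" where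
  "charts_at M p = {c \<in> atlas M. p \<in> cdom c}"

definition tangent_space :: "('p, 'c) mfd \<Rightarrow> 'p \<Rightarrow> ('p, 'c) tvec set" where
  "tangent_space M p = {(p', v). p' = p \<and>
     (\<forall>c. c \<notin> charts_at M p \<longrightarrow> v c = (\<lambda>_. 0)) \<and>
     (\<forall>c\<in>charts_at M p. v c \<in> coords (cix c) \<and>
        (\<forall>c'\<in>charts_at M p. v c' = differential (cix c) (cmap c' \<circ> cinv c) (cmap c p) (v c)))}"

definition tchart :: "('p, 'c) mfd \<Rightarrow> ('p, 'c) chart \<Rightarrow> (('p, 'c) tvec, 'c + 'c) chart" where
  "tchart M c =
     \<lparr>cix = Inl ` cix c \<union> Inr ` cix c,
      ccor = Inl ` ccor c,
      cdom = (\<Union>p\<in>cdom c. tangent_space M p),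
      cmap = (\<lambda>(p, v). case_sum (cmap c p) (v c))\<rparr>"

definition tangent_bundle :: "('p, 'c) mfd \<Rightarrow> (('p, 'c) tvec, 'c + 'c) mfd" where
  "tangent_bundle M =
     \<lparr>mtop = topology_generated_by
        {{w \<in> cdom (tchart M c). cmap (tchart M c) w \<in> W} | c W. c \<in> atlas M \<and> open W},
      atlas = tchart M ` atlas M\<rparr>"

text \<open>
  The tangent map in terms of any chart \<open>c\<close> around the base point; the result does not depend on the
  choice when \<open>f\<close> is smooth and \<open>w\<close> is a tangent vector.
\<close>

definition tangent_map ::
    "('p, 'c) mfd \<Rightarrow> ('q, 'd) mfd \<Rightarrow> ('p \<Rightarrow> 'q) \<Rightarrow> ('p, 'c) tvec \<Rightarrow> ('q, 'd) tvec" where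
  "tangent_map M N f w =
     (let p = fst w; c = (SOME c. c \<in> charts_at M p) in
      (f p, \<lambda>c'. if c' \<in> charts_at N (f p)
                 then differential (cix c) (cmap c' \<circ> f \<circ> cinv c) (cmap c p) (snd w c)
                 else (\<lambda>_. 0)))"

definition tadd :: "('p, 'c) tvec \<Rightarrow> ('p, 'c) tvec \<Rightarrow> ('p, 'c) tvec" where
  "tadd w w' = (fst w, \<lambda>c j. snd w c j + snd w' c j)"

definition tscale :: "real \<Rightarrow> ('p, 'c) tvec \<Rightarrow> ('p, 'c) tvec" where
  "tscale r w = (fst w, \<lambda>c j. r * snd w c j)"

definition tzero :: "'p \<Rightarrow> ('p, 'c) tvec" where
  "tzero p = (p, \<lambda>c j. 0)"

text \<open>For manifolds with corners: surjective with surjective differential at every point.\<close>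

definition surj_submersion :: "('p, 'c) mfd \<Rightarrow> ('q, 'd) mfd \<Rightarrow> ('p \<Rightarrow> 'q) \<Rightarrow> bool" where
  "surj_submersion M N f \<longleftrightarrow>
     smooth M N f \<and> f ` pts M = pts N \<and>
     (\<forall>p\<in>pts M. tangent_map M N f ` tangent_space M p = tangent_space N (f p))"


section \<open>Disjoint unions and finite products of manifolds\<close>

definition disjoint_union :: "'o set \<Rightarrow> ('o \<Rightarrow> ('p, 'c) mfd) \<Rightarrow> ('o \<times> 'p, 'c) mfd" where
  "disjoint_union I M =
     \<lparr>mtop = sum_topology (\<lambda>i. mtop (M i)) I,
      atlas = {\<lparr>cix = cix c, ccor = ccor c, cdom = {i} \<times> cdom c, cmap = cmap c \<circ> snd\<rparr> | i c.
                 i \<in> I \<and> c \<in> atlas (M i)}\<rparr>"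

definition prod_chart :: "'i set \<Rightarrow> ('i \<Rightarrow> ('p, 'c) chart) \<Rightarrow> ('i \<Rightarrow> 'p, 'i \<times> 'c) chart" where
  "prod_chart X c =
     \<lparr>cix = (SIGMA x:X. cix (c x)),
      ccor = (SIGMA x:X. ccor (c x)),
      cdom = (\<Pi>\<^sub>E x\<in>X. cdom (c x)),
      cmap = (\<lambda>p (x, j). if x \<in> X then cmap (c x) (p x) j else 0)\<rparr>"

definition mfd_prod :: "'i set \<Rightarrow> ('i \<Rightarrow> ('p, 'c) mfd) \<Rightarrow> ('i \<Rightarrow> 'p, 'i \<times> 'c) mfd" where
  "mfd_prod X M =
     \<lparr>mtop = product_topology (\<lambda>x. mtop (M x)) X,
      atlas = prod_chart X ` (\<Pi>\<^sub>E x\<in>X. atlas (M x))\<rparr>"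


section \<open>Small categories\<close>

record ('o, 'm) smallcat =
  obj :: "'o set"
  arr :: "'m set"
  src :: "'m \<Rightarrow> 'o"
  tgt :: "'m \<Rightarrow> 'o"
  idn :: "'o \<Rightarrow> 'm"
  cmp :: "'m \<Rightarrow> 'm \<Rightarrow> 'm"  \<comment> \<open>\<open>cmp C \<delta> \<gamma>\<close> is first \<open>\<gamma>\<close>, then \<open>\<delta>\<close>\<close>

definition category :: "('o, 'm) smallcat \<Rightarrow> bool" where
  "category C \<longleftrightarrow>
     src C \<in> arr C \<rightarrow> obj C \<and> tgt C \<in> arr C \<rightarrow> obj C \<and>
     (\<forall>x\<in>obj C. idn C x \<in> arr C \<and> src C (idn C x) = x \<and> tgt C (idn C x) = x) \<and>
     (\<forall>\<gamma>\<in>arr C. \<forall>\<delta>\<in>arr C. tgt C \<gamma> = src C \<delta> \<longrightarrow>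
        cmp C \<delta> \<gamma> \<in> arr C \<and> src C (cmp C \<delta> \<gamma>) = src C \<gamma> \<and> tgt C (cmp C \<delta> \<gamma>) = tgt C \<delta>) \<and>
     (\<forall>\<gamma>\<in>arr C. cmp C \<gamma> (idn C (src C \<gamma>)) = \<gamma> \<and> cmp C (idn C (tgt C \<gamma>)) \<gamma> = \<gamma>) \<and>
     (\<forall>\<gamma>\<in>arr C. \<forall>\<delta>\<in>arr C. \<forall>\<epsilon>\<in>arr C. tgt C \<gamma> = src C \<delta> \<and> tgt C \<delta> = src C \<epsilon> \<longrightarrow>
        cmp C \<epsilon> (cmp C \<delta> \<gamma>) = cmp C (cmp C \<epsilon> \<delta>) \<gamma>)"

definition cat_functor ::
    "('o, 'm) smallcat \<Rightarrow> ('o', 'm') smallcat \<Rightarrow> ('o \<Rightarrow> 'o') \<Rightarrow> ('m \<Rightarrow> 'm') \<Rightarrow> bool" where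
  "cat_functor C D F G \<longleftrightarrow>
     F \<in> obj C \<rightarrow> obj D \<and> G \<in> arr C \<rightarrow> arr D \<and>
     (\<forall>\<gamma>\<in>arr C. src D (G \<gamma>) = F (src C \<gamma>) \<and> tgt D (G \<gamma>) = F (tgt C \<gamma>)) \<and>
     (\<forall>x\<in>obj C. G (idn C x) = idn D (F x)) \<and>
     (\<forall>\<gamma>\<in>arr C. \<forall>\<delta>\<in>arr C. tgt C \<gamma> = src C \<delta> \<longrightarrow> G (cmp C \<delta> \<gamma>) = cmp D (G \<delta>) (G \<gamma>))"

definition cat_prod :: "'i set \<Rightarrow> ('i \<Rightarrow> ('o, 'm) smallcat) \<Rightarrow> ('i \<Rightarrow> 'o, 'i \<Rightarrow> 'm) smallcat" where
  "cat_prod X C =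
     \<lparr>obj = (\<Pi>\<^sub>E x\<in>X. obj (C x)),
      arr = (\<Pi>\<^sub>E x\<in>X. arr (C x)),
      src = (\<lambda>\<gamma>. \<lambda>x\<in>X. src (C x) (\<gamma> x)),
      tgt = (\<lambda>\<gamma>. \<lambda>x\<in>X. tgt (C x) (\<gamma> x)),
      idn = (\<lambda>z. \<lambda>x\<in>X. idn (C x) (z x)),
      cmp = (\<lambda>\<delta> \<gamma>. \<lambda>x\<in>X. cmp (C x) (\<delta> x) (\<gamma> x))\<rparr>"


section \<open>Hybrid phase spaces\<close>

record ('o, 'm, 'p, 'c) hyph =
  hcat :: "('o, 'm) smallcat"
  hmfd :: "'o \<Rightarrow> ('p, 'c) mfd"
  hrel :: "'m \<Rightarrow> ('p \<times> 'p) set"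

text \<open>The last three conditions say that \<open>hmfd\<close> and \<open>hrel\<close> form a functor to relations.\<close>

definition hybrid_phase_space :: "('o, 'm, 'p, 'c) hyph \<Rightarrow> bool" where
  "hybrid_phase_space a \<longleftrightarrow>
     category (hcat a) \<and> obj (hcat a) \<noteq> {} \<and>
     (\<forall>x\<in>obj (hcat a). manifold (hmfd a x)) \<and>
     (\<forall>\<gamma>\<in>arr (hcat a).
        hrel a \<gamma> \<subseteq> pts (hmfd a (src (hcat a) \<gamma>)) \<times> pts (hmfd a (tgt (hcat a) \<gamma>))) \<and>
     (\<forall>x\<in>obj (hcat a). hrel a (idn (hcat a) x) = Id_on (pts (hmfd a x))) \<and>
     (\<forall>\<gamma>\<in>arr (hcat a). \<forall>\<delta>\<in>arr (hcat a). tgt (hcat a) \<gamma> = src (hcat a) \<delta> \<longrightarrow>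
        hrel a (cmp (hcat a) \<delta> \<gamma>) = hrel a \<gamma> O hrel a \<delta>)"

record ('o, 'm, 'p, 'o2, 'm2, 'p2) hymap =
  fobj :: "'o \<Rightarrow> 'o2"
  farr :: "'m \<Rightarrow> 'm2"
  fcomp :: "'o \<Rightarrow> 'p \<Rightarrow> 'p2"

definition hyph_map ::
    "('o, 'm, 'p, 'c) hyph \<Rightarrow> ('o2, 'm2, 'p2, 'c2) hyph \<Rightarrow>
     ('o, 'm, 'p, 'o2, 'm2, 'p2) hymap \<Rightarrow> bool" where
  "hyph_map a b f \<longleftrightarrow>
     cat_functor (hcat a) (hcat b) (fobj f) (farr f) \<and>
     (\<forall>x\<in>obj (hcat a). smooth (hmfd a x) (hmfd b (fobj f x)) (fcomp f x)) \<and>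
     (\<forall>\<gamma>\<in>arr (hcat a).
        map_prod (fcomp f (src (hcat a) \<gamma>)) (fcomp f (tgt (hcat a) \<gamma>)) ` hrel a \<gamma>
          \<subseteq> hrel b (farr f \<gamma>))"

definition hcomp ::
    "('o2, 'm2, 'p2, 'o3, 'm3, 'p3) hymap \<Rightarrow> ('o, 'm, 'p, 'o2, 'm2, 'p2) hymap \<Rightarrow>
     ('o, 'm, 'p, 'o3, 'm3, 'p3) hymap" where
  "hcomp g f =
     \<lparr>fobj = fobj g \<circ> fobj f,
      farr = farr g \<circ> farr f,
      fcomp = (\<lambda>x. fcomp g (fobj f x) \<circ> fcomp f x)\<rparr>"

text \<open>Equality of maps out of \<open>a\<close>; values outside the carriers of \<open>a\<close> are irrelevant.\<close>

definition hyeq ::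
    "('o, 'm, 'p, 'c) hyph \<Rightarrow> ('o, 'm, 'p, 'o2, 'm2, 'p2) hymap \<Rightarrow>
     ('o, 'm, 'p, 'o2, 'm2, 'p2) hymap \<Rightarrow> bool" where
  "hyeq a f g \<longleftrightarrow>
     (\<forall>x\<in>obj (hcat a). fobj f x = fobj g x \<and> (\<forall>p\<in>pts (hmfd a x). fcomp f x p = fcomp g x p)) \<and>
     (\<forall>\<gamma>\<in>arr (hcat a). farr f \<gamma> = farr g \<gamma>)"

definition hyph_prod ::
    "'i set \<Rightarrow> ('i \<Rightarrow> ('o, 'm, 'p, 'c) hyph) \<Rightarrow> ('i \<Rightarrow> 'o, 'i \<Rightarrow> 'm, 'i \<Rightarrow> 'p, 'i \<times> 'c) hyph" where
  "hyph_prod X a =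
     \<lparr>hcat = cat_prod X (\<lambda>x. hcat (a x)),
      hmfd = (\<lambda>z. mfd_prod X (\<lambda>x. hmfd (a x) (z x))),
      hrel = (\<lambda>\<gamma>. {(p, q).
         p \<in> (\<Pi>\<^sub>E x\<in>X. pts (hmfd (a x) (src (hcat (a x)) (\<gamma> x)))) \<and>
         q \<in> (\<Pi>\<^sub>E x\<in>X. pts (hmfd (a x) (tgt (hcat (a x)) (\<gamma> x)))) \<and>
         (\<forall>x\<in>X. (p x, q x) \<in> hrel (a x) (\<gamma> x))})\<rparr>"

definition hyproj :: "'i \<Rightarrow> ('i \<Rightarrow> 'o, 'i \<Rightarrow> 'm, 'i \<Rightarrow> 'p, 'o, 'm, 'p) hymap" where
  "hyproj x = \<lparr>fobj = (\<lambda>z. z x), farr = (\<lambda>\<gamma>. \<gamma> x), fcomp = (\<lambda>z p. p x)\<rparr>"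

text \<open>
  For \<open>\<phi> : X \<rightarrow> Y\<close> and maps \<open>\<Phi> x : b (\<phi> x) \<rightarrow> a x\<close>, the map from the product of \<open>b\<close> over \<open>Y\<close> to the
  product of \<open>a\<close> over \<open>X\<close> induced by the universal property (see the lemmas below).
\<close>

definition hytuple ::
    "'i set \<Rightarrow> ('i \<Rightarrow> 'j) \<Rightarrow> ('i \<Rightarrow> ('o, 'm, 'p, 'o2, 'm2, 'p2) hymap) \<Rightarrow>
     ('j \<Rightarrow> 'o, 'j \<Rightarrow> 'm, 'j \<Rightarrow> 'p, 'i \<Rightarrow> 'o2, 'i \<Rightarrow> 'm2, 'i \<Rightarrow> 'p2) hymap" where
  "hytuple X \<phi> \<Phi> =
     \<lparr>fobj = (\<lambda>z. \<lambda>x\<in>X. fobj (\<Phi> x) (z (\<phi> x))),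
      farr = (\<lambda>\<gamma>. \<lambda>x\<in>X. farr (\<Phi> x) (\<gamma> (\<phi> x))),
      fcomp = (\<lambda>z p. \<lambda>x\<in>X. fcomp (\<Phi> x) (z (\<phi> x)) (p (\<phi> x)))\<rparr>"

lemma hyproj_hytuple:
  assumes "x \<in> X"
  shows "hyeq b (hcomp (hyproj x) (hytuple X \<phi> \<Phi>)) (hcomp (\<Phi> x) (hyproj (\<phi> x)))"
  using assms by (simp add: hyeq_def hcomp_def hyproj_def hytuple_def)

lemma hytuple_unique:
  assumes P: "hyph_map b (hyph_prod X a) P"
    and eq: "\<And>x. x \<in> X \<Longrightarrow> hyeq b (hcomp (hyproj x) P) (hcomp (\<Phi> x) (hyproj (\<phi> x)))"
  shows "hyeq b P (hytuple X \<phi> \<Phi>)"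
proof -
  have "fobj P z = (\<lambda>x\<in>X. fobj (\<Phi> x) (z (\<phi> x)))" if z: "z \<in> obj (hcat b)" for z
  proof -
    have "fobj P z \<in> (\<Pi>\<^sub>E x\<in>X. obj (hcat (a x)))"
      using P z by (auto simp: hyph_map_def cat_functor_def hyph_prod_def cat_prod_def)
    then show ?thesis
      using eq z by (intro extensionalityI[of _ X])
        (auto simp: hyeq_def hcomp_def hyproj_def PiE_def)
  qed
  moreover have "fcomp P z p = (\<lambda>x\<in>X. fcomp (\<Phi> x) (z (\<phi> x)) (p (\<phi> x)))"
    if z: "z \<in> obj (hcat b)" and p: "p \<in> pts (hmfd b z)" for z p
  proof -
    have "smooth (hmfd b z) (mfd_prod X (\<lambda>x. hmfd (a x) (fobj P z x))) (fcomp P z)"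
      using P z by (auto simp: hyph_map_def hyph_prod_def)
    then have "fcomp P z p \<in> (\<Pi>\<^sub>E x\<in>X. pts (hmfd (a x) (fobj P z x)))"
      using p by (auto simp: smooth_def continuous_map_def mfd_prod_def Pi_iff)
    then show ?thesis
      using eq z p by (intro extensionalityI[of _ X])
        (auto simp: hyeq_def hcomp_def hyproj_def PiE_def)
  qed
  moreover have "farr P \<gamma> = (\<lambda>x\<in>X. farr (\<Phi> x) (\<gamma> (\<phi> x)))" if g: "\<gamma> \<in> arr (hcat b)" for \<gamma>
  proof -
    have "farr P \<gamma> \<in> (\<Pi>\<^sub>E x\<in>X. arr (hcat (a x)))"
      using P g by (auto simp: hyph_map_def cat_functor_def hyph_prod_def cat_prod_def)
    then show ?thesis
      using eq g by (intro extensionalityI[of _ X])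
        (auto simp: hyeq_def hcomp_def hyproj_def PiE_def)
  qed
  ultimately show ?thesis
    by (simp add: hyeq_def hytuple_def)
qed

definition U_obj :: "('o, 'm, 'p, 'c) hyph \<Rightarrow> ('o \<times> 'p, 'c) mfd" where
  "U_obj a = disjoint_union (obj (hcat a)) (hmfd a)"

definition U_map :: "('o, 'm, 'p, 'o2, 'm2, 'p2) hymap \<Rightarrow> 'o \<times> 'p \<Rightarrow> 'o2 \<times> 'p2" where
  "U_map f = (\<lambda>(x, p). (fobj f x, fcomp f x p))"


section \<open>(Hybrid) surjective submersions\<close>

text \<open>
  Data of objects \<open>tot \<rightarrow> st\<close> and of morphisms (commuting squares), used both over manifolds and over
  hybrid phase spaces.
\<close>

record ('t, 's, 'f) fib =
  tot :: 't
  st :: 's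
  prj :: 'f

record ('f, 'g) square =
  sq_tot :: 'f
  sq_st :: 'g

type_synonym ('p, 'c, 'q, 'd) ssub =
  "(('p, 'c) mfd, ('q, 'd) mfd, 'p \<Rightarrow> 'q) fib"

type_synonym ('o, 'm, 'p, 'c, 'o2, 'm2, 'p2, 'c2) hyssub =
  "(('o, 'm, 'p, 'c) hyph, ('o2, 'm2, 'p2, 'c2) hyph, ('o, 'm, 'p, 'o2, 'm2, 'p2) hymap) fib"

type_synonym ('o, 'm, 'p, 'o2, 'm2, 'p2, 'r, 'n, 'q, 'r2, 'n2, 'q2) hysquare =
  "(('o, 'm, 'p, 'r, 'n, 'q) hymap, ('o2, 'm2, 'p2, 'r2, 'n2, 'q2) hymap) square"

definition hybrid_ssub :: "('o, 'm, 'p, 'c, 'o2, 'm2, 'p2, 'c2) hyssub \<Rightarrow> bool" where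
  "hybrid_ssub a \<longleftrightarrow>
     hybrid_phase_space (tot a) \<and> hybrid_phase_space (st a) \<and>
     hyph_map (tot a) (st a) (prj a) \<and>
     surj_submersion (U_obj (tot a)) (U_obj (st a)) (U_map (prj a))"

definition hyssub_mor ::
    "('o, 'm, 'p, 'c, 'o2, 'm2, 'p2, 'c2) hyssub \<Rightarrow> ('r, 'n, 'q, 'd, 'r2, 'n2, 'q2, 'd2) hyssub \<Rightarrow>
     ('o, 'm, 'p, 'o2, 'm2, 'p2, 'r, 'n, 'q, 'r2, 'n2, 'q2) hysquare \<Rightarrow> bool" where
  "hyssub_mor a b f \<longleftrightarrow>
     hyph_map (tot a) (tot b) (sq_tot f) \<and> hyph_map (st a) (st b) (sq_st f) \<and>
     hyeq (tot a) (hcomp (prj b) (sq_tot f)) (hcomp (sq_st f) (prj a))"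

definition hyssub_comp ::
    "('r, 'n, 'q, 'r2, 'n2, 'q2, 's, 'k, 't, 's2, 'k2, 't2) hysquare \<Rightarrow>
     ('o, 'm, 'p, 'o2, 'm2, 'p2, 'r, 'n, 'q, 'r2, 'n2, 'q2) hysquare \<Rightarrow>
     ('o, 'm, 'p, 'o2, 'm2, 'p2, 's, 'k, 't, 's2, 'k2, 't2) hysquare" where
  "hyssub_comp g f =
     \<lparr>sq_tot = hcomp (sq_tot g) (sq_tot f), sq_st = hcomp (sq_st g) (sq_st f)\<rparr>"

definition hyssub_eq ::
    "('o, 'm, 'p, 'c, 'o2, 'm2, 'p2, 'c2) hyssub \<Rightarrow>
     ('o, 'm, 'p, 'o2, 'm2, 'p2, 'r, 'n, 'q, 'r2, 'n2, 'q2) hysquare \<Rightarrow> ('o, 'm, 'p, 'o2, 'm2, 'p2, 'r, 'n, 'q, 'r2, 'n2, 'q2) hysquare \<Rightarrow> bool" where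
  "hyssub_eq a f g \<longleftrightarrow>
     hyeq (tot a) (sq_tot f) (sq_tot g) \<and> hyeq (st a) (sq_st f) (sq_st g)"

definition interconnection ::
    "('o, 'm, 'p, 'c, 'o2, 'm2, 'p2, 'c2) hyssub \<Rightarrow> ('r, 'n, 'q, 'd, 'r2, 'n2, 'q2, 'd2) hyssub \<Rightarrow>
     ('o, 'm, 'p, 'o2, 'm2, 'p2, 'r, 'n, 'q, 'r2, 'n2, 'q2) hysquare \<Rightarrow> bool" where
  "interconnection a b f \<longleftrightarrow>
     hyssub_mor a b f \<and> diffeo (U_obj (st a)) (U_obj (st b)) (U_map (sq_st f))"

definition hyssub_prod ::
    "'i set \<Rightarrow> ('i \<Rightarrow> ('o, 'm, 'p, 'c, 'o2, 'm2, 'p2, 'c2) hyssub) \<Rightarrow>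
     ('i \<Rightarrow> 'o, 'i \<Rightarrow> 'm, 'i \<Rightarrow> 'p, 'i \<times> 'c, 'i \<Rightarrow> 'o2, 'i \<Rightarrow> 'm2, 'i \<Rightarrow> 'p2, 'i \<times> 'c2) hyssub" where
  "hyssub_prod X \<tau> =
     \<lparr>tot = hyph_prod X (\<lambda>x. tot (\<tau> x)),
      st = hyph_prod X (\<lambda>x. st (\<tau> x)),
      prj = hytuple X (\<lambda>x. x) (\<lambda>x. prj (\<tau> x))\<rparr>"

definition hyssub_tuple ::
    "'i set \<Rightarrow> ('i \<Rightarrow> 'j) \<Rightarrow> ('i \<Rightarrow> ('o, 'm, 'p, 'o2, 'm2, 'p2, 'r, 'n, 'q, 'r2, 'n2, 'q2) hysquare) \<Rightarrow>
     ('j \<Rightarrow> 'o, 'j \<Rightarrow> 'm, 'j \<Rightarrow> 'p, 'j \<Rightarrow> 'o2, 'j \<Rightarrow> 'm2, 'j \<Rightarrow> 'p2,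
      'i \<Rightarrow> 'r, 'i \<Rightarrow> 'n, 'i \<Rightarrow> 'q, 'i \<Rightarrow> 'r2, 'i \<Rightarrow> 'n2, 'i \<Rightarrow> 'q2) hysquare" where
  "hyssub_tuple X \<phi> \<Phi> =
     \<lparr>sq_tot = hytuple X \<phi> (\<lambda>x. sq_tot (\<Phi> x)), sq_st = hytuple X \<phi> (\<lambda>x. sq_st (\<Phi> x))\<rparr>"

definition ssub_comp ::
    "('b \<Rightarrow> 'c, 'e \<Rightarrow> 'f) square \<Rightarrow> ('a \<Rightarrow> 'b, 'd \<Rightarrow> 'e) square \<Rightarrow> ('a \<Rightarrow> 'c, 'd \<Rightarrow> 'f) square" where
  "ssub_comp g f = \<lparr>sq_tot = sq_tot g \<circ> sq_tot f, sq_st = sq_st g \<circ> sq_st f\<rparr>"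

definition ssub_prod ::
    "'i set \<Rightarrow> ('i \<Rightarrow> ('p, 'c, 'q, 'd) ssub) \<Rightarrow> ('i \<Rightarrow> 'p, 'i \<times> 'c, 'i \<Rightarrow> 'q, 'i \<times> 'd) ssub" where
  "ssub_prod X \<sigma> =
     \<lparr>tot = mfd_prod X (\<lambda>x. tot (\<sigma> x)),
      st = mfd_prod X (\<lambda>x. st (\<sigma> x)),
      prj = (\<lambda>q. \<lambda>x\<in>X. prj (\<sigma> x) (q x))\<rparr>"

definition UU :: "('o, 'm, 'p, 'c, 'o2, 'm2, 'p2, 'c2) hyssub \<Rightarrow>
    ('o \<times> 'p, 'c, 'o2 \<times> 'p2, 'c2) ssub" where
  "UU a = \<lparr>tot = U_obj (tot a), st = U_obj (st a), prj = U_map (prj a)\<rparr>"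

definition UU_map ::
    "('o, 'm, 'p, 'o2, 'm2, 'p2, 'r, 'n, 'q, 'r2, 'n2, 'q2) hysquare \<Rightarrow>
     ('o \<times> 'p \<Rightarrow> 'r \<times> 'q, 'o2 \<times> 'p2 \<Rightarrow> 'r2 \<times> 'q2) square" where
  "UU_map f = \<lparr>sq_tot = U_map (sq_tot f), sq_st = U_map (sq_st f)\<rparr>"

text \<open>
  The canonical isomorphism from \<open>UU (hyssub_prod X \<tau>)\<close> to \<open>ssub_prod X (\<lambda>x. UU (\<tau> x))\<close>: a point of the
  disjoint union of products is turned into a family of points of disjoint unions.
\<close>

definition U_prod :: "'i set \<Rightarrow> ('i \<Rightarrow> 'o) \<times> ('i \<Rightarrow> 'p) \<Rightarrow> 'i \<Rightarrow> 'o \<times> 'p" where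
  "U_prod X = (\<lambda>(z, p). \<lambda>x\<in>X. (z x, p x))"

definition UU_prod ::
    "'i set \<Rightarrow> (('i \<Rightarrow> 'o) \<times> ('i \<Rightarrow> 'p) \<Rightarrow> 'i \<Rightarrow> 'o \<times> 'p,
      ('i \<Rightarrow> 'o2) \<times> ('i \<Rightarrow> 'p2) \<Rightarrow> 'i \<Rightarrow> 'o2 \<times> 'p2) square" where
  "UU_prod X = \<lparr>sq_tot = U_prod X, sq_st = U_prod X\<rparr>"


section \<open>Vector spaces and linear relations\<close>

definition real_field :: "real ring" where
  "real_field = \<lparr>carrier = UNIV, monoid.mult = (*), one = 1, ring.zero = 0, add = (+)\<rparr>"

lemma field_real_field: "Ring.field real_field"
proof -
  have "\<exists>y. x * y = 1" if "x \<noteq> 0" for x :: real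
    using that by (intro exI[of _ "inverse x"]) simp
  moreover have "\<exists>y. x + y = 0" for x :: real
    by (rule exI[of _ "- x"]) simp
  ultimately show ?thesis
    by unfold_locales (auto simp: real_field_def Units_def algebra_simps)
qed

text \<open>
  Vector spaces are \<open>module\<close> records; the record type extends rings, and the ring multiplication and
  unit carry no meaning (they are filled in as in \<open>direct_sum\<close>).
\<close>

definition family_sum ::
    "'i set \<Rightarrow> ('i \<Rightarrow> (real, 'v) module) \<Rightarrow> (real, 'i \<Rightarrow> 'v) module" where
  "family_sum X V =
     \<lparr>carrier = (\<Pi>\<^sub>E x\<in>X. carrier (V x)),
      monoid.mult = (\<lambda>u w. \<lambda>x\<in>X. \<zero>\<^bsub>V x\<^esub>),
      one = (\<lambda>x\<in>X. \<zero>\<^bsub>V x\<^esub>),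
      ring.zero = (\<lambda>x\<in>X. \<zero>\<^bsub>V x\<^esub>),
      add = (\<lambda>u w. \<lambda>x\<in>X. u x \<oplus>\<^bsub>V x\<^esub> w x),
      module.smult = (\<lambda>r u. \<lambda>x\<in>X. r \<odot>\<^bsub>V x\<^esub> u x)\<rparr>"

definition linear_relation ::
    "(real, 'v) module \<Rightarrow> (real, 'w) module \<Rightarrow> ('v \<times> 'w) set \<Rightarrow> bool" where
  "linear_relation V W R \<longleftrightarrow> VectorSpace.subspace real_field R (direct_sum V W)"

text \<open>
  2-cells from \<open>R : V \<rightarrow> W\<close> to \<open>R' : V' \<rightarrow> W'\<close>; \<open>linear_map\<close> includes that source and target are
  vector spaces.
\<close>

definition relvect_cell ::
    "(real, 'v) module \<Rightarrow> (real, 'w) module \<Rightarrow> (real, 'v2) module \<Rightarrow> (real, 'w2) module \<Rightarrow>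
     ('v \<times> 'w) set \<Rightarrow> ('v2 \<times> 'w2) set \<Rightarrow> ('v \<Rightarrow> 'v2) \<Rightarrow> ('w \<Rightarrow> 'w2) \<Rightarrow> bool" where
  "relvect_cell V W V' W' R R' g h \<longleftrightarrow>
     linear_relation V W R \<and> linear_relation V' W' R' \<and>
     linear_map real_field V V' g \<and> linear_map real_field W W' h \<and>
     map_prod g h ` R \<subseteq> R'"


section \<open>Open systems\<close>

definition Crl :: "('p, 'c, 'q, 'd) ssub \<Rightarrow> (real, 'p \<Rightarrow> ('q, 'd) tvec) module" where
  "Crl a =
     \<lparr>carrier = {F \<in> extensional (pts (tot a)).
         smooth (tot a) (tangent_bundle (st a)) F \<and>
         (\<forall>q\<in>pts (tot a). F q \<in> tangent_space (st a) (prj a q))},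
      monoid.mult = (\<lambda>F G. \<lambda>q\<in>pts (tot a). tzero (prj a q)),
      one = (\<lambda>q\<in>pts (tot a). tzero (prj a q)),
      ring.zero = (\<lambda>q\<in>pts (tot a). tzero (prj a q)),
      add = (\<lambda>F G. \<lambda>q\<in>pts (tot a). tadd (F q) (G q)),
      module.smult = (\<lambda>r F. \<lambda>q\<in>pts (tot a). tscale r (F q))\<rparr>"

definition Crl_rel ::
    "('p, 'c, 'q, 'd) ssub \<Rightarrow> ('p2, 'c2, 'q2, 'd2) ssub \<Rightarrow> ('p \<Rightarrow> 'p2, 'q \<Rightarrow> 'q2) square \<Rightarrow>
     (('p \<Rightarrow> ('q, 'd) tvec) \<times> ('p2 \<Rightarrow> ('q2, 'd2) tvec)) set" where
  "Crl_rel a b f =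
     {(F, G). F \<in> carrier (Crl a) \<and> G \<in> carrier (Crl b) \<and>
        (\<forall>q\<in>pts (tot a). G (sq_tot f q) = tangent_map (st a) (st b) (sq_st f) (F q))}"

text \<open>\<open>\<phi>\<^sup>* F\<close> for a morphism \<open>\<phi>\<close> from \<open>a\<close> to \<open>b\<close> that is a diffeomorphism on \<open>st\<close>.\<close>

definition pullback ::
    "('p, 'c, 'q, 'd) ssub \<Rightarrow> ('p2, 'c2, 'q2, 'd2) ssub \<Rightarrow> ('p \<Rightarrow> 'p2, 'q \<Rightarrow> 'q2) square \<Rightarrow>
     ('p2 \<Rightarrow> ('q2, 'd2) tvec) \<Rightarrow> ('p \<Rightarrow> ('q, 'd) tvec)" where
  "pullback a b \<phi> F =
     (\<lambda>q\<in>pts (tot a).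
        inv_into (pts (tangent_bundle (st a))) (tangent_map (st a) (st b) (sq_st \<phi>))
          (F (sq_tot \<phi> q)))"

text \<open>The identification of the tangent bundle of a product with the product of tangent bundles.\<close>

definition tangent_split ::
    "'i set \<Rightarrow> ('i \<Rightarrow> ('p, 'c) mfd) \<Rightarrow> ('i \<Rightarrow> 'p, 'i \<times> 'c) tvec \<Rightarrow> 'i \<Rightarrow> ('p, 'c) tvec" where
  "tangent_split X M w = (\<lambda>x\<in>X. tangent_map (mfd_prod X M) (M x) (\<lambda>p. p x) w)"

definition Crl_prod ::
    "'i set \<Rightarrow> ('i \<Rightarrow> ('p, 'c, 'q, 'd) ssub) \<Rightarrow> ('i \<Rightarrow> 'p \<Rightarrow> ('q, 'd) tvec) \<Rightarrow>
     ('i \<Rightarrow> 'p) \<Rightarrow> ('i \<Rightarrow> 'q, 'i \<times> 'd) tvec" where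
  "Crl_prod X \<sigma> F =
     (\<lambda>q\<in>pts (tot (ssub_prod X \<sigma>)).
        inv_into (pts (tangent_bundle (st (ssub_prod X \<sigma>)))) (tangent_split X (\<lambda>x. st (\<sigma> x)))
          (\<lambda>x\<in>X. F x (q x)))"

definition odot ::
    "'i set \<Rightarrow> 'j set \<Rightarrow> ('i \<Rightarrow> 'j) \<Rightarrow> ('j \<Rightarrow> (real, 'u) module) \<Rightarrow> ('i \<Rightarrow> (real, 'w) module) \<Rightarrow>
     ('i \<Rightarrow> ('u \<times> 'w) set) \<Rightarrow> (('j \<Rightarrow> 'u) \<times> ('i \<Rightarrow> 'w)) set" where
  "odot X Y \<phi> V W R =
     {(u, w). u \<in> carrier (family_sum Y V) \<and> w \<in> carrier (family_sum X W) \<and> (\<forall>x\<in>X. (u (\<phi> x), w x) \<in> R x)}"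


section \<open>Networks\<close>

definition hybrid_network ::
    "'i set \<Rightarrow> ('i \<Rightarrow> ('r, 'n, 'q, 'd, 'r2, 'n2, 'q2, 'd2) hyssub) \<Rightarrow> ('o, 'm, 'p, 'c, 'o2, 'm2, 'p2, 'c2) hyssub \<Rightarrow>
     ('o, 'm, 'p, 'o2, 'm2, 'p2, 'i \<Rightarrow> 'r, 'i \<Rightarrow> 'n, 'i \<Rightarrow> 'q, 'i \<Rightarrow> 'r2, 'i \<Rightarrow> 'n2, 'i \<Rightarrow> 'q2) hysquare \<Rightarrow> bool" where
  "hybrid_network X \<tau> b \<psi> \<longleftrightarrow>
     finite X \<and> (\<forall>x\<in>X. hybrid_ssub (\<tau> x)) \<and> hybrid_ssub b \<and>
     interconnection b (hyssub_prod X \<tau>) \<psi>"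

text \<open>\<open>((\<phi>, \<Phi>), f)\<close> is a map from \<open>(\<tau>, \<psi>)\<close> to \<open>(\<mu>, \<nu>)\<close>.\<close>

definition hybrid_network_map where
  "hybrid_network_map X \<tau> b \<psi> Y \<mu> c \<nu> \<phi> \<Phi> f \<longleftrightarrow>
     \<phi> \<in> X \<rightarrow> Y \<and>
     (\<forall>x\<in>X. hyssub_mor (\<mu> (\<phi> x)) (\<tau> x) (\<Phi> x)) \<and>
     hyssub_mor c b f \<and>
     hyssub_eq c (hyssub_comp (hyssub_tuple X \<phi> \<Phi>) \<nu>) (hyssub_comp \<psi> f)"

text \<open>
  The linear map \<open>(U \<psi>)\<^sup>*\<close> after \<open>Crl\<close> of the family \<open>U \<circ> \<tau>\<close>, with \<open>UU (hyssub_prod X \<tau>)\<close> and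
  \<open>ssub_prod X (\<lambda>x. UU (\<tau> x))\<close> identified via \<open>UU_prod\<close>.
\<close>

definition network_Crl ::
    "'i set \<Rightarrow> ('i \<Rightarrow> ('r, 'n, 'q, 'd, 'r2, 'n2, 'q2, 'd2) hyssub) \<Rightarrow> ('o, 'm, 'p, 'c, 'o2, 'm2, 'p2, 'c2) hyssub \<Rightarrow>
     ('o, 'm, 'p, 'o2, 'm2, 'p2, 'i \<Rightarrow> 'r, 'i \<Rightarrow> 'n, 'i \<Rightarrow> 'q, 'i \<Rightarrow> 'r2, 'i \<Rightarrow> 'n2, 'i \<Rightarrow> 'q2) hysquare \<Rightarrow>
     ('i \<Rightarrow> 'r \<times> 'q \<Rightarrow> ('r2 \<times> 'q2, 'd2) tvec) \<Rightarrow> 'o \<times> 'p \<Rightarrow> ('o2 \<times> 'p2, 'c2) tvec" where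
  "network_Crl X \<tau> b \<psi> =
     pullback (UU b) (ssub_prod X (\<lambda>x. UU (\<tau> x))) (ssub_comp (UU_prod X) (UU_map \<psi>))
     \<circ> Crl_prod X (\<lambda>x. UU (\<tau> x))"

end

theory Submission
  imports Defs
begin

text \<open>
  Let \<open>q\<close> be a point of the total space of \<open>b\<close> and let \<open>w\<close> be a family of open systems on the \<open>\<tau> x\<close>.
  The value at \<open>q\<close> of the interconnected system is the only tangent vector \<open>v\<close> at the base point of
  \<open>q\<close> such that, for every \<open>x\<close>, the tangent map of the component \<open>x\<close> of \<open>\<psi>\<close> on states sends \<open>v\<close> to
  the value of \<open>w x\<close> at the component \<open>x\<close> of \<open>\<psi> q\<close>.  There is exactly one such \<open>v\<close> because a tangent
  vector of a finite product is the same as a family of tangent vectors of the factors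
  (\<open>product_tangent_exists\<close>, \<open>product_tangent_eqI\<close>) and because \<open>\<psi>\<close> is a diffeomorphism on states.
  The two inverse functions in the definition of the vertical arrows are thereby replaced by the
  characterization \<open>ssub_network_Crl_at\<close>, with the uniqueness \<open>interconnected_tangent_eqI\<close>.

  Linearity of the vertical arrows follows from uniqueness.  Smoothness of the interconnected system
  is seen in a chart: its coordinates are sums of partial derivatives of the inverse of \<open>\<psi>\<close> times
  coordinates of the \<open>w x\<close> (\<open>ssub_network_Crl_closed\<close>).

  For the inclusion of relations, let \<open>F\<close> and \<open>G\<close> be the systems obtained from related families \<open>u\<close>
  and \<open>w\<close>.  The vectors \<open>G (f q)\<close> and \<open>T f (F q)\<close> lie in the same tangent space, so it suffices to
  compare their images under the tangent maps of the components of \<open>\<psi>\<close>.  The image of the first in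
  component \<open>x\<close> is the value of \<open>w x\<close> at \<open>\<Phi> x (\<nu> q (\<phi> x))\<close>; since \<open>u (\<phi> x)\<close> and \<open>w x\<close> are related
  along \<open>\<Phi> x\<close>, it is the image under \<open>T (\<Phi> x)\<close> of \<open>u (\<phi> x)\<close> at \<open>\<nu> q (\<phi> x)\<close>, which in turn is the image of
  \<open>F q\<close> under the tangent map of the component \<open>\<phi> x\<close> of \<open>\<nu>\<close>.  By the equation defining maps of
  networks and functoriality of the tangent map, this is the image of \<open>T f (F q)\<close>.

  All four arrows are built from images under \<open>U\<close>.  The argument is therefore carried out for ordinary
  submersions (\<open>ssub_network_cell\<close>) and transported to hybrid ones along the diffeomorphism between
  \<open>U\<close> of a product and the product of the \<open>U\<close> (\<open>interconnected_hybrid_network\<close>).  What it takes from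
  differential geometry is functoriality of tangent maps on manifolds with corners
  (\<open>tangent_map_compose\<close>), which rests on the chain rule for one-sided partial derivatives
  (\<open>right_partial_compose\<close>).
\<close>


section \<open>Calculus in coordinates\<close>

lemma in_coords_iff: "x \<in> coords J \<longleftrightarrow> (\<forall>j. j \<notin> J \<longrightarrow> x j = 0)"
  by (simp add: coords_def)

lemma sector_subset_coords: "sector J K \<subseteq> coords J"
  by (auto simp: sector_def)

lemma coords_upd: "x \<in> coords J \<Longrightarrow> j \<in> J \<Longrightarrow> x(j := t) \<in> coords J"
  by (auto simp: coords_def)

lemma sector_upd_right: "x \<in> sector J K \<Longrightarrow> j \<in> J \<Longrightarrow> x j \<le> t \<Longrightarrow> x(j := t) \<in> sector J K"
  unfolding sector_def using coords_upd[of x J j t] by (auto intro: order_trans)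

text \<open>
  Only finitely many coordinates vary on \<open>coords J\<close>, so its topology, induced by the product
  topology on functions, is given by boxes, and neighbourhoods can be described by finitely many inequalities.
\<close>

lemma openin_coords_contains_box:
  assumes J: "finite J" and W: "openin (top_of_set (coords J)) W" and x: "x \<in> W"
  obtains e :: real where "e > 0"
    "\<And>y. y \<in> coords J \<Longrightarrow> (\<And>j. j \<in> J \<Longrightarrow> \<bar>y j - x j\<bar> < e) \<Longrightarrow> y \<in> W"
proof -
  obtain T where T: "open T" and WT: "W = coords J \<inter> T"
    using W by (auto simp: openin_open)
  have "openin (product_topology (\<lambda>i. euclidean) UNIV) T" "x \<in> T"
    using T x WT by (auto simp: open_fun_def)
  from product_topology_open_contains_basis[OF this]
  obtain B where B: "x \<in> Pi\<^sub>E UNIV B" "\<And>i. open (B i)" "Pi\<^sub>E UNIV B \<subseteq> T"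
    by auto
  have "\<forall>j. \<exists>e>0. \<forall>t. \<bar>t - x j\<bar> < e \<longrightarrow> t \<in> B j"
  proof
    fix j
    have "x j \<in> B j" using B(1) by auto
    then show "\<exists>e>0. \<forall>t. \<bar>t - x j\<bar> < e \<longrightarrow> t \<in> B j"
      using B(2)[of j] unfolding open_dist dist_real_def by blast
  qed
  then obtain e where e: "\<And>j. e j > 0" "\<And>j t. \<bar>t - x j\<bar> < e j \<Longrightarrow> t \<in> B j"
    by metis
  define d where "d = Min (insert 1 (e ` J))"
  have d: "d > 0" "\<And>j. j \<in> J \<Longrightarrow> d \<le> e j"
    unfolding d_def using J e by (auto simp: Min_gr_iff)
  show thesis
  proof (rule that[OF d(1)])
    fix y assume y: "y \<in> coords J" "\<And>j. j \<in> J \<Longrightarrow> \<bar>y j - x j\<bar> < d"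
    have "y j \<in> B j" for j
    proof (cases "j \<in> J")
      case True
      then show ?thesis using e(2)[of "y j" j] y(2)[of j] d(2)[of j] by simp
    next
      case False
      then have "y j = x j" using y(1) x WT by (auto simp: coords_def)
      then show ?thesis using B(1) by auto
    qed
    then have "y \<in> Pi\<^sub>E UNIV B" by auto
    then show "y \<in> W" using B(3) WT y(1) by auto
  qed
qed

lemma eventually_in_openin_coords:
  assumes J: "finite J" and W: "openin (top_of_set (coords J)) W" and x: "x \<in> W"
    and g: "\<And>j. j \<in> J \<Longrightarrow> ((\<lambda>s. g s j) \<longlongrightarrow> x j) F"
    and c: "\<forall>\<^sub>F s in F. g s \<in> coords J"
  shows "\<forall>\<^sub>F s in F. g s \<in> W"
proof -
  obtain e where e: "e > 0"
    "\<And>y. y \<in> coords J \<Longrightarrow> (\<And>j. j \<in> J \<Longrightarrow> \<bar>y j - x j\<bar> < e) \<Longrightarrow> y \<in> W"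
    using openin_coords_contains_box[OF J W x] by metis
  have "\<forall>\<^sub>F s in F. \<bar>g s j - x j\<bar> < e" if "j \<in> J" for j
    using tendstoD[OF g[OF that] e(1)] by (simp add: dist_real_def)
  then have "\<forall>\<^sub>F s in F. \<forall>j\<in>J. \<bar>g s j - x j\<bar> < e"
    using J by (simp add: eventually_ball_finite)
  with c show ?thesis
    by eventually_elim (use e in blast)
qed

lemma mvt_closed_segment:
  fixes h :: "real \<Rightarrow> real"
  assumes "\<And>t. t \<in> closed_segment a b \<Longrightarrow> (h has_real_derivative h' t) (at t)"
  obtains t where "t \<in> closed_segment a b" "h b - h a = h' t * (b - a)"
proof (cases a b rule: linorder_cases)
  case less
  then obtain t where "a < t" "t < b" "h b - h a = (b - a) * h' t"
    using MVT2[of a b h h'] assms by (auto simp: closed_segment_eq_real_ivl)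
  then show ?thesis using that[of t] less by (auto simp: closed_segment_eq_real_ivl mult.commute)
next
  case equal
  then show ?thesis using that[of a] by simp
next
  case greater
  then obtain t where "b < t" "t < a" "h a - h b = (a - b) * h' t"
    using MVT2[of b a h h'] assms by (auto simp: closed_segment_eq_real_ivl)
  then show ?thesis using that[of t] greater
    by (auto simp: closed_segment_eq_real_ivl algebra_simps)
qed

text \<open>
  Change the coordinates in \<open>K\<close> from their values in \<open>x\<close> to those in \<open>y\<close> one at a time and apply the
  mean value theorem to each step.
\<close>

lemma coordinatewise_mvt:
  assumes "finite K" "K \<subseteq> J"
    and x: "x \<in> coords J" and y: "y \<in> coords J"
    and box: "\<And>z. z \<in> coords J \<Longrightarrow> (\<And>i. i \<in> J \<Longrightarrow> \<bar>z i - x i\<bar> \<le> \<bar>y i - x i\<bar>) \<Longrightarrow> z \<in> W"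
    and D: "\<And>j z. j \<in> J \<Longrightarrow> z \<in> W \<Longrightarrow> ((\<lambda>t. f (z(j := t))) has_real_derivative D j z) (at (z j))"
  shows "\<exists>z. (\<forall>j\<in>K. z j \<in> coords J \<and> (\<forall>i\<in>J. \<bar>z j i - x i\<bar> \<le> \<bar>y i - x i\<bar>)) \<and>
    f (\<lambda>i. if i \<in> K then y i else x i) - f x = (\<Sum>j\<in>K. D j (z j) * (y j - x j))"
  using assms(1,2)
proof (induction K)
  case empty
  then show ?case by simp
next
  case (insert k K)
  let ?w = "\<lambda>i. if i \<in> K then y i else x i"
  let ?B = "\<lambda>z. z \<in> coords J \<and> (\<forall>i\<in>J. \<bar>z i - x i\<bar> \<le> \<bar>y i - x i\<bar>)"
  obtain z where z: "\<forall>j\<in>K. ?B (z j)"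
    "f ?w - f x = (\<Sum>j\<in>K. D j (z j) * (y j - x j))"
    using insert by auto
  have k: "k \<in> J" using insert by auto
  have B: "?B (?w(k := t))" if "t \<in> closed_segment (x k) (y k)" for t
    using that x y insert k by (auto simp: coords_def closed_segment_eq_real_ivl split: if_splits)
  have "((\<lambda>t. f (?w(k := t))) has_real_derivative D k (?w(k := t))) (at t)"
    if "t \<in> closed_segment (x k) (y k)" for t
    using D[of k "?w(k := t)"] box[of "?w(k := t)"] B[OF that] k by auto
  then obtain t where t: "t \<in> closed_segment (x k) (y k)"
    and ft: "f (?w(k := y k)) - f (?w(k := x k)) = D k (?w(k := t)) * (y k - x k)"
    by (rule mvt_closed_segment)
  have w: "?w(k := x k) = ?w" "?w(k := y k) = (\<lambda>i. if i \<in> insert k K then y i else x i)"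
    using insert by (auto simp: fun_eq_iff)
  have "(\<Sum>j\<in>K. D j ((z(k := ?w(k := t))) j) * (y j - x j)) = (\<Sum>j\<in>K. D j (z j) * (y j - x j))"
    using insert by (intro sum.cong) auto
  then show ?case
    using z B[OF t] ft insert unfolding w by (intro exI[of _ "z(k := ?w(k := t))"]) (auto simp: algebra_simps)
qed

text \<open>
  The chain rule for a curve through a function with continuous partial derivatives.  The derivative is
  taken within an arbitrary set \<open>A\<close> so that it covers one-sided derivatives at the boundary of a
  sector as well as ordinary ones.
\<close>

lemma has_real_derivative_along_curve:
  assumes J: "finite J" and W: "openin (top_of_set (coords J)) W"
    and D: "\<And>j z. j \<in> J \<Longrightarrow> z \<in> W \<Longrightarrow> ((\<lambda>t. f (z(j := t))) has_real_derivative D j z) (at (z j))"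
    and cont: "\<And>j. j \<in> J \<Longrightarrow> continuous_on W (D j)"
    and xW: "\<gamma> t \<in> W" and ev: "\<forall>\<^sub>F s in at t within A. \<gamma> s \<in> coords J"
    and \<gamma>: "\<And>j. j \<in> J \<Longrightarrow> ((\<lambda>s. \<gamma> s j) has_real_derivative \<gamma>' j) (at t within A)"
  shows "((\<lambda>s. f (\<gamma> s)) has_real_derivative (\<Sum>j\<in>J. D j (\<gamma> t) * \<gamma>' j)) (at t within A)"
proof -
  let ?x = "\<gamma> t"
  let ?P = "\<lambda>s z. (\<forall>j\<in>J. z j \<in> coords J \<and> (\<forall>i\<in>J. \<bar>z j i - ?x i\<bar> \<le> \<bar>\<gamma> s i - ?x i\<bar>)) \<and>
    f (\<gamma> s) - f ?x = (\<Sum>j\<in>J. D j (z j) * (\<gamma> s j - ?x j))"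
  have xc: "?x \<in> coords J" using W xW by (auto simp: openin_open)
  obtain e where e: "e > 0"
    "\<And>y. y \<in> coords J \<Longrightarrow> (\<And>j. j \<in> J \<Longrightarrow> \<bar>y j - ?x j\<bar> < e) \<Longrightarrow> y \<in> W"
    using openin_coords_contains_box[OF J W xW] by metis
  have lim: "((\<lambda>s. \<gamma> s j) \<longlongrightarrow> ?x j) (at t within A)" if "j \<in> J" for j
    using DERIV_continuous[OF \<gamma>[OF that]] by (simp add: continuous_within)
  then have "\<forall>\<^sub>F s in at t within A. \<bar>\<gamma> s j - ?x j\<bar> < e" if "j \<in> J" for j
    using tendstoD[OF lim[OF that] e(1)] by (simp add: dist_real_def)
  then have "\<forall>\<^sub>F s in at t within A. \<forall>j\<in>J. \<bar>\<gamma> s j - ?x j\<bar> < e"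
    using J by (simp add: eventually_ball_finite)
  with ev have evP: "\<forall>\<^sub>F s in at t within A. \<exists>z. ?P s z"
  proof eventually_elim
    case (elim s)
    have "(\<lambda>i. if i \<in> J then \<gamma> s i else ?x i) = \<gamma> s"
      using elim xc by (auto simp: coords_def)
    moreover have "z \<in> W" if "z \<in> coords J" "\<And>i. i \<in> J \<Longrightarrow> \<bar>z i - ?x i\<bar> \<le> \<bar>\<gamma> s i - ?x i\<bar>" for z
      using e(2)[of z] that elim by (meson le_less_trans)
    ultimately show ?case
      using coordinatewise_mvt[OF J order_refl xc elim(1), of W f D, OF _ D] by auto
  qed
  \<comment> \<open>The intermediate points \<open>Z s j\<close> are squeezed towards \<open>?x\<close>, so the partial derivatives there converge.\<close>
  define Z where "Z s = (SOME z. ?P s z)" for s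
  have Z: "\<forall>\<^sub>F s in at t within A. ?P s (Z s)"
    using evP by eventually_elim (unfold Z_def, erule someI_ex)
  have DZ: "((\<lambda>s. D j (Z s j)) \<longlongrightarrow> D j ?x) (at t within A)" if j: "j \<in> J" for j
  proof (rule tendstoI)
    fix \<epsilon> :: real assume "\<epsilon> > 0"
    let ?V = "W \<inter> D j -` ball (D j ?x) \<epsilon>"
    have "openin (top_of_set W) ?V"
      using cont[OF j] by (simp add: continuous_on_open_gen continuous_openin_preimage_gen)
    then have V: "openin (top_of_set (coords J)) ?V"
      using W openin_trans by blast
    have "((\<lambda>s. Z s j i) \<longlongrightarrow> ?x i) (at t within A)" if i: "i \<in> J" for i
    proof (rule Lim_null_comparison[THEN LIM_zero_cancel])
      show "\<forall>\<^sub>F s in at t within A. norm (Z s j i - ?x i) \<le> \<bar>\<gamma> s i - ?x i\<bar>"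
        using Z by eventually_elim (use i j in auto)
      show "((\<lambda>s. \<bar>\<gamma> s i - ?x i\<bar>) \<longlongrightarrow> 0) (at t within A)"
        using lim[OF i] by (simp add: LIM_zero_iff tendsto_rabs_zero_iff)
    qed
    moreover have "\<forall>\<^sub>F s in at t within A. Z s j \<in> coords J"
      using Z by eventually_elim (use j in auto)
    ultimately have "\<forall>\<^sub>F s in at t within A. Z s j \<in> ?V"
      using \<open>\<epsilon> > 0\<close> xW by (intro eventually_in_openin_coords[OF J V, of ?x]) auto
    then show "\<forall>\<^sub>F s in at t within A. dist (D j (Z s j)) (D j ?x) < \<epsilon>"
      by eventually_elim (auto simp: dist_commute)
  qed
  have "((\<lambda>s. \<Sum>j\<in>J. D j (Z s j) * ((\<gamma> s j - ?x j) / (s - t))) \<longlongrightarrow> (\<Sum>j\<in>J. D j ?x * \<gamma>' j))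
      (at t within A)"
    using \<gamma> by (intro tendsto_sum tendsto_mult DZ) (auto simp: has_field_derivative_iff)
  moreover have "\<forall>\<^sub>F s in at t within A.
      (\<Sum>j\<in>J. D j (Z s j) * ((\<gamma> s j - ?x j) / (s - t))) = (f (\<gamma> s) - f ?x) / (s - t)"
    using Z by eventually_elim (auto simp: sum_divide_distrib)
  ultimately show ?thesis
    unfolding has_field_derivative_iff by (rule Lim_transform_eventually)
qed

subsection \<open>Functions of class \<open>C\<^sup>k\<close>\<close>

lemma eventually_upd_in_openin:
  assumes W: "openin (top_of_set S) W" and x: "x \<in> W"
    and ev: "\<forall>\<^sub>F t in F. x(j := t) \<in> S" and F: "F \<le> nhds (x j)"
  shows "\<forall>\<^sub>F t in F. x(j := t) \<in> W"
proof -
  obtain T where T: "open T" "W = S \<inter> T"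
    using W by (auto simp: openin_open)
  have "continuous_on UNIV (\<lambda>t. x(j := t))"
    proof (rule continuous_on_coordinatewise_then_product)
    show "continuous_on UNIV (\<lambda>t. (x(j := t)) i)" for i
      by (cases "i = j") auto
  qed
  then have "open ((\<lambda>t. x(j := t)) -` T)"
    using T by (simp add: continuous_on_open_vimage)
  moreover have "x j \<in> (\<lambda>t. x(j := t)) -` T" using x T by simp
  ultimately have "\<forall>\<^sub>F t in nhds (x j). x(j := t) \<in> T"
    by (metis (mono_tags, lifting) eventually_nhds vimageE)
  then have "\<forall>\<^sub>F t in F. x(j := t) \<in> T"
    using F by (rule filter_leD[rotated])
  with ev show ?thesis by eventually_elim (simp add: T)
qed

lemma eventually_upd_in_openin_coords:
  assumes W: "openin (top_of_set (coords J)) W" and x: "x \<in> W" and j: "j \<in> J"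
  shows "\<forall>\<^sub>F t in nhds (x j). x(j := t) \<in> W"
proof (rule eventually_upd_in_openin[OF W x])
  have "x \<in> coords J" using W x by (auto simp: openin_open)
  then show "\<forall>\<^sub>F t in nhds (x j). x(j := t) \<in> coords J"
    by (simp add: coords_upd j)
qed simp

lemma Ck_on_continuous: "Ck_on k J W f \<Longrightarrow> continuous_on W f"
  by (cases k) auto

lemma Ck_on_subset: "Ck_on k J W f \<Longrightarrow> V \<subseteq> W \<Longrightarrow> Ck_on k J V f"
  by (induction k arbitrary: f) (auto intro: continuous_on_subset, meson subsetD)

lemma Ck_on_SucD: "Ck_on (Suc k) J W f \<Longrightarrow> Ck_on k J W f"
  by (induction k arbitrary: f) (simp, metis Ck_on.simps(2))

lemma Ck_on_cong:
  assumes W: "openin (top_of_set (coords J)) W" and eq: "\<And>x. x \<in> W \<Longrightarrow> f x = g x"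
    and f: "Ck_on k J W f"
  shows "Ck_on k J W g"
proof (cases k)
  case 0
  then show ?thesis using f eq by (simp cong: continuous_on_cong)
next
  case (Suc l)
  have "((\<lambda>t. g (x(j := t))) has_real_derivative D) (at (x j))"
    if "((\<lambda>t. f (x(j := t))) has_real_derivative D) (at (x j))" "x \<in> W" "j \<in> J" for x j D
  proof -
    have "\<forall>\<^sub>F t in nhds (x j). f (x(j := t)) = g (x(j := t))"
      using eventually_upd_in_openin_coords[OF W that(2,3)] by eventually_elim (rule eq)
    then show ?thesis using that(1) DERIV_cong_ev[OF refl _ refl] by metis
  qed
  moreover have "continuous_on W g"
    using f Suc eq by (simp cong: continuous_on_cong)
  ultimately show ?thesis using f Suc by simp meson
qed

lemma Ck_on_const: "Ck_on k J W (\<lambda>x. c)"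
  by (induction k arbitrary: c) (auto intro!: exI[of _ "\<lambda>x. 0"])

lemma continuous_on_fun_coordinate: "continuous_on W (\<lambda>x. x i)"
  by (rule continuous_on_product_then_coordinatewise) (rule continuous_on_id)

lemma Ck_on_coordinate: "Ck_on k J W (\<lambda>x. x i)"
proof (cases k)
  case (Suc l)
  have "((\<lambda>t. (x(j := t)) i) has_real_derivative (if i = j then 1 else 0)) (at (x j))" for x j
    by (cases "i = j") (auto intro: DERIV_ident)
  then show ?thesis
    unfolding Suc by (auto intro!: exI[of _ "\<lambda>x. if i = j then 1 else 0" for j] Ck_on_const continuous_on_fun_coordinate)
qed (simp add: continuous_on_fun_coordinate)

lemma Ck_on_partials:
  assumes "Ck_on (Suc k) J W f"
  shows "\<exists>D. (\<forall>j\<in>J. Ck_on k J W (D j)) \<and>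
    (\<forall>j\<in>J. \<forall>x\<in>W. ((\<lambda>t. f (x(j := t))) has_real_derivative D j x) (at (x j)))"
proof -
  have "\<forall>j\<in>J. \<exists>g. Ck_on k J W g \<and> (\<forall>x\<in>W. ((\<lambda>t. f (x(j := t))) has_real_derivative g x) (at (x j)))"
    using assms by simp
  from bchoice[OF this] show ?thesis by blast
qed

lemma Ck_on_add:
  assumes "Ck_on k J W f" "Ck_on k J W g"
  shows "Ck_on k J W (\<lambda>x. f x + g x)"
  using assms
proof (induction k arbitrary: f g)
  case (Suc k)
  obtain f' where f': "\<And>j. j \<in> J \<Longrightarrow> Ck_on k J W (f' j)"
    "\<And>j x. j \<in> J \<Longrightarrow> x \<in> W \<Longrightarrow> ((\<lambda>t. f (x(j := t))) has_real_derivative f' j x) (at (x j))"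
    using Ck_on_partials[OF Suc.prems(1)] by blast
  obtain g' where g': "\<And>j. j \<in> J \<Longrightarrow> Ck_on k J W (g' j)"
    "\<And>j x. j \<in> J \<Longrightarrow> x \<in> W \<Longrightarrow> ((\<lambda>t. g (x(j := t))) has_real_derivative g' j x) (at (x j))"
    using Ck_on_partials[OF Suc.prems(2)] by blast
  have "\<exists>h. Ck_on k J W h \<and>
      (\<forall>x\<in>W. ((\<lambda>t. f (x(j := t)) + g (x(j := t))) has_real_derivative h x) (at (x j)))" if j: "j \<in> J" for j
  proof -
    show ?thesis
      using f' g' j by (intro exI[of _ "\<lambda>x. f' j x + g' j x"] conjI ballI Suc.IH DERIV_add)
  qed
  then show ?case using Suc.prems by (auto intro: continuous_on_add)
qed (simp add: continuous_on_add)

lemma Ck_on_mult: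
  assumes "Ck_on k J W f" "Ck_on k J W g"
  shows "Ck_on k J W (\<lambda>x. f x * g x)"
  using assms
proof (induction k arbitrary: f g)
  case (Suc k)
  obtain f' where f': "\<And>j. j \<in> J \<Longrightarrow> Ck_on k J W (f' j)"
    "\<And>j x. j \<in> J \<Longrightarrow> x \<in> W \<Longrightarrow> ((\<lambda>t. f (x(j := t))) has_real_derivative f' j x) (at (x j))"
    using Ck_on_partials[OF Suc.prems(1)] by blast
  obtain g' where g': "\<And>j. j \<in> J \<Longrightarrow> Ck_on k J W (g' j)"
    "\<And>j x. j \<in> J \<Longrightarrow> x \<in> W \<Longrightarrow> ((\<lambda>t. g (x(j := t))) has_real_derivative g' j x) (at (x j))"
    using Ck_on_partials[OF Suc.prems(2)] by blast
  have "\<exists>h. Ck_on k J W h \<and>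
      (\<forall>x\<in>W. ((\<lambda>t. f (x(j := t)) * g (x(j := t))) has_real_derivative h x) (at (x j)))" if j: "j \<in> J" for j
  proof -
    have "Ck_on k J W (\<lambda>x. f' j x * g x + g' j x * f x)"
      using f'(1)[OF j] g'(1)[OF j] Suc.prems[THEN Ck_on_SucD] by (intro Ck_on_add Suc.IH)
    moreover have "((\<lambda>t. f (x(j := t)) * g (x(j := t))) has_real_derivative f' j x * g x + g' j x * f x) (at (x j))"
      if "x \<in> W" for x
      using DERIV_mult[OF f'(2)[OF j that] g'(2)[OF j that]] by simp
    ultimately show ?thesis by blast
  qed
  then show ?case using Suc.prems by (auto intro: continuous_on_mult)
qed (simp add: continuous_on_mult)

lemma Ck_on_sum: "(\<And>i. i \<in> I \<Longrightarrow> Ck_on k J W (f i)) \<Longrightarrow> Ck_on k J W (\<lambda>x. \<Sum>i\<in>I. f i x)"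
  by (induction I rule: infinite_finite_induct) (auto intro: Ck_on_add Ck_on_const)

text \<open>
  Induction on \<open>k\<close>: by the chain rule the partial derivatives of the composite are sums of products of
  functions of class \<open>C\<^sup>k\<close>, to which the induction hypothesis applies.
\<close>

lemma Ck_on_compose:
  assumes J': "finite J'" and W: "openin (top_of_set (coords J)) W" and V: "openin (top_of_set (coords J')) V"
    and g: "g \<in> W \<rightarrow> V" and f: "Ck_on k J' V f" and gk: "\<And>i. i \<in> J' \<Longrightarrow> Ck_on k J W (\<lambda>x. g x i)"
  shows "Ck_on k J W (\<lambda>x. f (g x))"
proof -
  have VJ: "V \<subseteq> coords J'" using V by (auto simp: openin_open)
  have cont: "continuous_on W g" if "\<And>i. i \<in> J' \<Longrightarrow> continuous_on W (\<lambda>x. g x i)"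
  proof (rule continuous_on_coordinatewise_then_product)
    fix i show "continuous_on W (\<lambda>x. g x i)"
    proof (cases "i \<in> J'")
      case False
      then have "g x i = 0" if "x \<in> W" for x using g VJ that by (auto simp: coords_def)
      then show ?thesis by (simp cong: continuous_on_cong)
    qed (simp add: that)
  qed
  have cf: "continuous_on W (\<lambda>x. f (g x))"
    using continuous_on_compose2[OF Ck_on_continuous[OF f] cont] g gk by (auto dest: Ck_on_continuous)
  from f gk cf show ?thesis
  proof (induction k arbitrary: f)
    case 0
    then show ?case by simp
  next
    case (Suc k)
    obtain D where D: "\<And>i. i \<in> J' \<Longrightarrow> Ck_on k J' V (D i)"
      "\<And>i x. i \<in> J' \<Longrightarrow> x \<in> V \<Longrightarrow> ((\<lambda>t. f (x(i := t))) has_real_derivative D i x) (at (x i))"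
      using Ck_on_partials[OF Suc.prems(1)] by blast
    have "\<exists>h. Ck_on k J W h \<and>
        (\<forall>x\<in>W. ((\<lambda>t. f (g (x(j := t)))) has_real_derivative h x) (at (x j)))" if j: "j \<in> J" for j
    proof -
      have "\<forall>i\<in>J'. \<exists>h. Ck_on k J W h \<and> (\<forall>x\<in>W. ((\<lambda>t. g (x(j := t)) i) has_real_derivative h x) (at (x j)))"
        using Suc.prems(2) j by simp
      from bchoice[OF this] obtain G where G: "\<And>i. i \<in> J' \<Longrightarrow> Ck_on k J W (G i)"
        "\<And>i x. i \<in> J' \<Longrightarrow> x \<in> W \<Longrightarrow> ((\<lambda>t. g (x(j := t)) i) has_real_derivative G i x) (at (x j))"
        by blast
      have "continuous_on W (\<lambda>x. D i (g x))" if "i \<in> J'" for i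
        using continuous_on_compose2[OF Ck_on_continuous[OF D(1)[OF that]] cont] g Suc.prems(2)
        by (auto dest: Ck_on_continuous)
      then have "Ck_on k J W (\<lambda>x. D i (g x))" if "i \<in> J'" for i
        using Suc.IH[OF D(1)[OF that] Ck_on_SucD[OF Suc.prems(2)]] that by blast
      then have "Ck_on k J W (\<lambda>x. \<Sum>i\<in>J'. D i (g x) * G i x)"
        using G(1) by (intro Ck_on_sum Ck_on_mult)
      moreover have "((\<lambda>t. f (g (x(j := t)))) has_real_derivative (\<Sum>i\<in>J'. D i (g x) * G i x)) (at (x j))"
        if x: "x \<in> W" for x
      proof -
        have "\<forall>\<^sub>F t in at (x j). x(j := t) \<in> W"
          using eventually_upd_in_openin_coords[OF W x j] by (simp add: eventually_at_filter eventually_mono)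
        then have ev: "\<forall>\<^sub>F t in at (x j). g (x(j := t)) \<in> coords J'"
          by eventually_elim (use g VJ in auto)
        have "((\<lambda>t. f (g (x(j := t)))) has_real_derivative (\<Sum>i\<in>J'. D i (g (x(j := x j))) * G i x)) (at (x j))"
          using D G x g by (intro has_real_derivative_along_curve[OF J' V D(2) _ _ ev]) (auto dest: Ck_on_continuous)
        then show ?thesis by simp
      qed
      ultimately show ?thesis by blast
    qed
    then show ?case using Suc.prems(3) by simp
  qed
qed


subsection \<open>Functions with a local smooth extension\<close>

text \<open>
  A pointwise, real-valued form of \<open>smooth_ext\<close>.  Being local and coordinatewise, it is easier to
  propagate through charts, products and tangent vectors.
\<close>

definition smooth_real_at :: "'c set \<Rightarrow> ('c \<Rightarrow> real) set \<Rightarrow> (('c \<Rightarrow> real) \<Rightarrow> real) \<Rightarrow> ('c \<Rightarrow> real) \<Rightarrow> bool" where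
  "smooth_real_at J S f x \<longleftrightarrow>
     (\<exists>W F. openin (top_of_set (coords J)) W \<and> x \<in> W \<and> (\<forall>k. Ck_on k J W F) \<and> (\<forall>y\<in>W \<inter> S. F y = f y))"

lemma smooth_real_atI:
  "openin (top_of_set (coords J)) W \<Longrightarrow> x \<in> W \<Longrightarrow> (\<And>k. Ck_on k J W F) \<Longrightarrow>
   (\<And>y. y \<in> W \<Longrightarrow> y \<in> S \<Longrightarrow> F y = f y) \<Longrightarrow> smooth_real_at J S f x"
  unfolding smooth_real_at_def by blast

lemma smooth_real_atE:
  assumes "smooth_real_at J S f x"
  obtains W F where "openin (top_of_set (coords J)) W" "x \<in> W" "\<And>k. Ck_on k J W F"
    "\<And>y. y \<in> W \<Longrightarrow> y \<in> S \<Longrightarrow> F y = f y"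
  using assms unfolding smooth_real_at_def by blast

lemma smooth_real_at_const: "x \<in> coords J \<Longrightarrow> smooth_real_at J S (\<lambda>x. c) x"
  by (rule smooth_real_atI[of _ "coords J"]) (auto intro: Ck_on_const)

lemma smooth_real_at_coordinate: "x \<in> coords J \<Longrightarrow> smooth_real_at J S (\<lambda>x. x i) x"
  by (rule smooth_real_atI[of _ "coords J"]) (auto intro: Ck_on_coordinate)

lemma smooth_real_at_combine:
  assumes f: "smooth_real_at J S f x" and g: "smooth_real_at J S g x"
    and op: "\<And>k W F G. Ck_on k J W F \<Longrightarrow> Ck_on k J W G \<Longrightarrow> Ck_on k J W (\<lambda>x. op (F x) (G x))"
  shows "smooth_real_at J S (\<lambda>x. op (f x) (g x)) x"
proof -
  obtain W F where F: "openin (top_of_set (coords J)) W" "x \<in> W" "\<And>k. Ck_on k J W F"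
    "\<And>y. y \<in> W \<Longrightarrow> y \<in> S \<Longrightarrow> F y = f y"
    using f by (rule smooth_real_atE) blast
  obtain V G where G: "openin (top_of_set (coords J)) V" "x \<in> V" "\<And>k. Ck_on k J V G"
    "\<And>y. y \<in> V \<Longrightarrow> y \<in> S \<Longrightarrow> G y = g y"
    using g by (rule smooth_real_atE) blast
  show ?thesis
    using F(1,2,4) G(1,2,4) Ck_on_subset[OF F(3), of "W \<inter> V"] Ck_on_subset[OF G(3), of "W \<inter> V"]
    by (intro smooth_real_atI[of _ "W \<inter> V" _ "\<lambda>x. op (F x) (G x)"] op) auto
qed

lemma smooth_real_at_add:
  "smooth_real_at J S f x \<Longrightarrow> smooth_real_at J S g x \<Longrightarrow> smooth_real_at J S (\<lambda>x. f x + g x) x"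
  by (rule smooth_real_at_combine[where op = "(+)"]) (auto intro: Ck_on_add)

lemma smooth_real_at_mult:
  "smooth_real_at J S f x \<Longrightarrow> smooth_real_at J S g x \<Longrightarrow> smooth_real_at J S (\<lambda>x. f x * g x) x"
  by (rule smooth_real_at_combine[where op = "(*)"]) (auto intro: Ck_on_mult)

lemma smooth_real_at_local:
  assumes T: "openin (top_of_set S) T" and x: "x \<in> T" and f: "smooth_real_at J T f x"
    and eq: "\<And>y. y \<in> T \<Longrightarrow> g y = f y"
  shows "smooth_real_at J S g x"
proof -
  obtain W F where F: "openin (top_of_set (coords J)) W" "x \<in> W" "\<And>k. Ck_on k J W F"
    "\<And>y. y \<in> W \<Longrightarrow> y \<in> T \<Longrightarrow> F y = f y"
    using f by (rule smooth_real_atE) blast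
  obtain B where B: "open B" "T = S \<inter> B"
    using T by (auto simp: openin_open)
  show ?thesis
    using F B x eq Ck_on_subset[OF F(3), of "W \<inter> B"]
    by (intro smooth_real_atI[of _ "W \<inter> B" _ F]) (auto intro: openin_Int_open)
qed

lemma smooth_real_at_subset: "smooth_real_at J S f x \<Longrightarrow> T \<subseteq> S \<Longrightarrow> smooth_real_at J T f x"
  unfolding smooth_real_at_def by (meson IntD1 IntD2 IntI subsetD)

lemma continuous_on_if_smooth_real_at:
  assumes S: "S \<subseteq> coords J" and f: "\<And>x. x \<in> S \<Longrightarrow> smooth_real_at J S f x"
  shows "continuous_on S f"
  unfolding continuous_on_def
proof
  fix x assume x: "x \<in> S"
  obtain W F where F: "openin (top_of_set (coords J)) W" "x \<in> W" "\<And>k. Ck_on k J W F"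
    "\<And>y. y \<in> W \<Longrightarrow> y \<in> S \<Longrightarrow> F y = f y"
    using f[OF x] by (rule smooth_real_atE) blast
  obtain B where B: "open B" "W = coords J \<inter> B"
    using F(1) by (auto simp: openin_open)
  have "continuous_on (S \<inter> B) F"
    by (rule continuous_on_subset[OF Ck_on_continuous[OF F(3)]]) (use S B in auto)
  then have "continuous_on (S \<inter> B) f"
    using F(4) S B by (subst continuous_on_cong[OF refl, of _ _ F]) auto
  then have "(f \<longlongrightarrow> f x) (at x within S \<inter> B)"
    using x F(2) B by (simp add: continuous_on_def)
  moreover have "at x within S \<inter> B = at x within S"
    using F(2) B by (intro at_within_nhd[of x B]) auto
  ultimately show "(f \<longlongrightarrow> f x) (at x within S)" by simp
qed

lemma smooth_real_at_smooth_ext: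
  "smooth_ext J S J' f \<Longrightarrow> x \<in> S \<Longrightarrow> i \<in> J' \<Longrightarrow> smooth_real_at J S (\<lambda>y. f y i) x"
  unfolding smooth_ext_def smooth_open_def smooth_real_at_def by metis

text \<open>
  Intersecting the domains of the extensions of the finitely many coordinates gives one extension of
  the whole map.
\<close>

lemma smooth_real_at_common_extension:
  assumes J': "finite J'" and x: "x \<in> coords J" and fS: "f \<in> S \<rightarrow> coords J'"
    and f: "\<And>i. i \<in> J' \<Longrightarrow> smooth_real_at J S (\<lambda>y. f y i) x"
  obtains W F where "openin (top_of_set (coords J)) W" "x \<in> W" "F \<in> W \<rightarrow> coords J'"
    "\<And>k i. i \<in> J' \<Longrightarrow> Ck_on k J W (\<lambda>y. F y i)" "\<And>y. y \<in> W \<Longrightarrow> y \<in> S \<Longrightarrow> F y = f y"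
proof -
  have "\<forall>i\<in>J'. \<exists>W. \<exists>F. openin (top_of_set (coords J)) W \<and> x \<in> W \<and> (\<forall>k. Ck_on k J W F) \<and> (\<forall>y\<in>W \<inter> S. F y = f y i)"
    using f unfolding smooth_real_at_def by blast
  from bchoice[OF this] obtain W where
    W: "\<forall>i\<in>J'. \<exists>F. openin (top_of_set (coords J)) (W i) \<and> x \<in> W i \<and> (\<forall>k. Ck_on k J (W i) F) \<and> (\<forall>y\<in>W i \<inter> S. F y = f y i)"
    by blast
  from bchoice[OF this] obtain F where
    F: "\<And>i. i \<in> J' \<Longrightarrow> openin (top_of_set (coords J)) (W i) \<and> x \<in> W i \<and> (\<forall>k. Ck_on k J (W i) (F i)) \<and> (\<forall>y\<in>W i \<inter> S. F i y = f y i)"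
    by blast
  let ?W = "coords J \<inter> (\<Inter>i\<in>J'. W i)"
  have W: "openin (top_of_set (coords J)) ?W"
  proof (cases "J' = {}")
    case False
    then have "openin (top_of_set (coords J)) (\<Inter>i\<in>J'. W i)"
      using J' F by (intro openin_INT2) auto
    then show ?thesis by (intro openin_Int) auto
  qed simp
  have Fk: "Ck_on k J ?W (\<lambda>y. if i \<in> J' then F i y else 0)" if "i \<in> J'" for k i
    using that F[OF that] by (auto intro: Ck_on_subset[of k J "W i"])
  have "(\<lambda>i. if i \<in> J' then F i y else 0) = f y" if "y \<in> ?W" "y \<in> S" for y
  proof
    have "f y \<in> coords J'" using fS that by auto
    then show "(if i \<in> J' then F i y else 0) = f y i" for i
      using that F by (auto simp: in_coords_iff)
  qed
  then show thesis
    by (intro that[of ?W "\<lambda>y i. if i \<in> J' then F i y else 0"]) (use W x F Fk in \<open>auto simp: coords_def\<close>)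
qed

lemma smooth_ext_if_smooth_real_at:
  assumes J': "finite J'" and S: "S \<subseteq> coords J" and fS: "f \<in> S \<rightarrow> coords J'"
    and f: "\<And>x i. x \<in> S \<Longrightarrow> i \<in> J' \<Longrightarrow> smooth_real_at J S (\<lambda>y. f y i) x"
  shows "smooth_ext J S J' f"
  unfolding smooth_ext_def
proof
  fix x assume x: "x \<in> S"
  then have "x \<in> coords J" using S by auto
  then obtain W F where W: "openin (top_of_set (coords J)) W" "x \<in> W" "F \<in> W \<rightarrow> coords J'"
    "\<And>k i. i \<in> J' \<Longrightarrow> Ck_on k J W (\<lambda>y. F y i)" "\<And>y. y \<in> W \<Longrightarrow> y \<in> S \<Longrightarrow> F y = f y"
    by (rule smooth_real_at_common_extension[OF J' _ fS f[OF x]]) blast+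
  then show "\<exists>W F. x \<in> W \<and> smooth_open J W J' F \<and> (\<forall>y\<in>W \<inter> S. F y = f y)"
    by (intro exI[of _ W] exI[of _ F]) (auto simp: smooth_open_def)
qed

lemma smooth_real_at_compose:
  assumes J': "finite J'" and S: "S \<subseteq> coords J" and S': "S' \<subseteq> coords J'" and x: "x \<in> S"
    and gS: "g \<in> S \<rightarrow> S'" and g: "\<And>i. i \<in> J' \<Longrightarrow> smooth_real_at J S (\<lambda>y. g y i) x"
    and f: "smooth_real_at J' S' f (g x)"
  shows "smooth_real_at J S (\<lambda>y. f (g y)) x"
proof -
  have xc: "x \<in> coords J" using x S by auto
  have gc: "g \<in> S \<rightarrow> coords J'" using gS S' by auto
  obtain W G where W: "openin (top_of_set (coords J)) W" "x \<in> W" "G \<in> W \<rightarrow> coords J'"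
    "\<And>k i. i \<in> J' \<Longrightarrow> Ck_on k J W (\<lambda>y. G y i)" and Gg: "\<And>y. y \<in> W \<Longrightarrow> y \<in> S \<Longrightarrow> G y = g y"
    by (rule smooth_real_at_common_extension[OF J' xc gc g]) blast+
  obtain V F where F: "openin (top_of_set (coords J')) V" "g x \<in> V" "\<And>k. Ck_on k J' V F"
    "\<And>y. y \<in> V \<Longrightarrow> y \<in> S' \<Longrightarrow> F y = f y"
    using f by (rule smooth_real_atE) blast
  have contG: "continuous_on W G"
  proof (rule continuous_on_coordinatewise_then_product)
    fix i show "continuous_on W (\<lambda>x. G x i)"
    proof (cases "i \<in> J'")
      case True
      then show ?thesis using W(4)[OF True, of 0] by simp
    next
      case False
      then have "G x i = 0" if "x \<in> W" for x using W(3) that by (auto simp: coords_def)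
      then show ?thesis by (simp cong: continuous_on_cong)
    qed
  qed
  have "openin (top_of_set W) (W \<inter> G -` V)"
    using contG W(3) F(1) by (intro continuous_openin_preimage) auto
  then have WV: "openin (top_of_set (coords J)) (W \<inter> G -` V)"
    using W(1) openin_trans by blast
  show ?thesis
  proof (rule smooth_real_atI[OF WV, of _ "\<lambda>y. F (G y)"])
    show "x \<in> W \<inter> G -` V" using W(2) F(2) Gg[OF W(2) x] by simp
    show "Ck_on k J (W \<inter> G -` V) (\<lambda>y. F (G y))" for k
      by (rule Ck_on_compose[OF J' WV F(1) _ F(3)]) (auto intro: Ck_on_subset[OF W(4)])
    show "F (G y) = f (g y)" if "y \<in> W \<inter> G -` V" "y \<in> S" for y
      using that Gg[of y] F(4) gS by auto
  qed
qed

subsection \<open>Right partial derivatives\<close>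

lemma right_partial_eqI:
  assumes "((\<lambda>t. f (x(j := t))) has_real_derivative D) (at_right (x j))"
  shows "right_partial j f x = D"
  unfolding right_partial_def
  using assms by (intro vector_derivative_within) (auto simp: has_real_derivative_iff_has_vector_derivative)

lemma eventually_upd_right_in_sector:
  assumes S: "openin (top_of_set (sector J K)) S" and x: "x \<in> S" and j: "j \<in> J"
  shows "\<forall>\<^sub>F t in at_right (x j). x(j := t) \<in> S"
proof (rule eventually_upd_in_openin[OF S x])
  have "x \<in> sector J K" using S x by (auto simp: openin_open)
  moreover have "\<forall>\<^sub>F t in at_right (x j). x j \<le> t"
    by (auto simp: eventually_at_filter)
  ultimately show "\<forall>\<^sub>F t in at_right (x j). x(j := t) \<in> sector J K"
    by (auto elim!: eventually_mono intro: sector_upd_right j)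
qed (simp add: at_within_def)

lemma right_partial_cong:
  assumes S: "openin (top_of_set (sector J K)) S" and x: "x \<in> S" and j: "j \<in> J"
    and eq: "\<And>y. y \<in> S \<Longrightarrow> f y = g y"
  shows "right_partial j f x = right_partial j g x"
proof -
  have ev: "\<forall>\<^sub>F t in at_right (x j). f (x(j := t)) = g (x(j := t))"
    using eventually_upd_right_in_sector[OF S x j] by eventually_elim (rule eq)
  have "((\<lambda>t. f (x(j := t))) has_vector_derivative D) (at_right (x j)) \<longleftrightarrow>
      ((\<lambda>t. g (x(j := t))) has_vector_derivative D) (at_right (x j))" for D
    unfolding has_real_derivative_iff_has_vector_derivative[symmetric] has_field_derivative_iff
    using eq[OF x] by (intro filterlim_cong refl eventually_mono[OF ev]) simp
  then show ?thesis unfolding right_partial_def vector_derivative_def by simp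
qed

text \<open>
  Increasing a coordinate stays inside a sector, so the one-sided partial derivative sees the function
  itself and agrees with the partial derivative of any smooth extension.
\<close>

lemma right_partial_extension:
  assumes S: "openin (top_of_set (sector J K)) S" and x: "x \<in> S" and j: "j \<in> J"
    and W: "openin (top_of_set (coords J)) W" "x \<in> W" and eq: "\<forall>y\<in>W \<inter> S. F y = f y"
    and D: "((\<lambda>t. F (x(j := t))) has_real_derivative D) (at (x j))"
  shows "((\<lambda>t. f (x(j := t))) has_real_derivative D) (at_right (x j))" "right_partial j f x = D"
proof -
  have "\<forall>\<^sub>F t in at_right (x j). x(j := t) \<in> W"
    using eventually_upd_in_openin_coords[OF W j] by (rule filter_leD[rotated]) (simp add: at_within_def)
  with eventually_upd_right_in_sector[OF S x j]
  have ev: "\<forall>\<^sub>F t in at_right (x j). F (x(j := t)) = f (x(j := t))"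
    by eventually_elim (simp add: eq)
  have "((\<lambda>t. (F (x(j := t)) - F x) / (t - x j)) \<longlongrightarrow> D) (at_right (x j))"
    using has_field_derivative_at_within[OF D, of "{x j<..}"] by (simp add: has_field_derivative_iff)
  then show "((\<lambda>t. f (x(j := t))) has_real_derivative D) (at_right (x j))"
    unfolding has_field_derivative_iff
    by (rule Lim_transform_eventually) (use ev eq W(2) x in \<open>auto elim!: eventually_mono\<close>)
  then show "right_partial j f x = D" by (rule right_partial_eqI)
qed

lemma smooth_real_at_right_deriv:
  assumes S: "openin (top_of_set (sector J K)) S" and x: "x \<in> S" and j: "j \<in> J"
    and f: "smooth_real_at J S f x"
  shows "((\<lambda>t. f (x(j := t))) has_real_derivative right_partial j f x) (at_right (x j))"
proof -
  obtain W F where F: "openin (top_of_set (coords J)) W" "x \<in> W" "\<And>k. Ck_on k J W F"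
    "\<And>y. y \<in> W \<Longrightarrow> y \<in> S \<Longrightarrow> F y = f y"
    using f by (rule smooth_real_atE) blast
  have eq: "\<forall>y\<in>W \<inter> S. F y = f y" using F(4) by blast
  obtain D where "((\<lambda>t. F (x(j := t))) has_real_derivative D) (at (x j))"
    using F(3)[of 1] F(2) j by fastforce
  from right_partial_extension[OF S x j F(1,2) eq this] show ?thesis by simp
qed

lemma smooth_real_at_right_partial:
  assumes S: "openin (top_of_set (sector J K)) S" and x: "x \<in> S" and j: "j \<in> J"
    and f: "smooth_real_at J S f x"
  shows "smooth_real_at J S (right_partial j f) x"
proof -
  obtain W F where F: "openin (top_of_set (coords J)) W" "x \<in> W" "\<And>k. Ck_on k J W F"
    "\<And>y. y \<in> W \<Longrightarrow> y \<in> S \<Longrightarrow> F y = f y"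
    using f by (rule smooth_real_atE) blast
  have ex: "\<exists>D. Ck_on k J W D \<and> (\<forall>x\<in>W. ((\<lambda>t. F (x(j := t))) has_real_derivative D x) (at (x j)))" for k
    using F(3)[of "Suc k"] j by simp
  obtain D where D: "\<And>x. x \<in> W \<Longrightarrow> ((\<lambda>t. F (x(j := t))) has_real_derivative D x) (at (x j))"
    using ex[of 0] by blast
  \<comment> \<open>The witnesses in the definition of class \<open>C\<^sup>k\<close> may depend on \<open>k\<close>; by uniqueness of derivatives they do not.\<close>
  have "Ck_on k J W D" for k
  proof -
    obtain E where E: "Ck_on k J W E" "\<And>x. x \<in> W \<Longrightarrow> ((\<lambda>t. F (x(j := t))) has_real_derivative E x) (at (x j))"
      using ex[of k] by blast
    show ?thesis
      by (rule Ck_on_cong[OF F(1) _ E(1)]) (use D E(2) DERIV_unique in blast)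
  qed
  moreover have "D y = right_partial j f y" if "y \<in> W" "y \<in> S" for y
    using right_partial_extension(2)[OF S that(2) j F(1) that(1) _ D[OF that(1)]] F(4) by simp
  ultimately show ?thesis
    by (rule smooth_real_atI[OF F(1,2)])
qed

text \<open>
  The chain rule at points of a sector, corners included: along \<open>t \<mapsto> g (x(j := t))\<close> for \<open>t\<close> right of
  \<open>x j\<close>, the function \<open>f\<close> can be replaced by a smooth extension, whose ordinary partial derivatives
  are the one-sided ones of \<open>f\<close>.
\<close>

lemma right_partial_compose:
  assumes J': "finite J'" and S: "openin (top_of_set (sector J K)) S" and x: "x \<in> S" and j: "j \<in> J"
    and S': "openin (top_of_set (sector J' K')) S'" and gS: "g \<in> S \<rightarrow> S'"
    and g: "\<And>i. i \<in> J' \<Longrightarrow> smooth_real_at J S (\<lambda>y. g y i) x"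
    and f: "smooth_real_at J' S' f (g x)"
  shows "right_partial j (\<lambda>y. f (g y)) x =
    (\<Sum>i\<in>J'. right_partial i f (g x) * right_partial j (\<lambda>y. g y i) x)"
proof -
  obtain W F where F: "openin (top_of_set (coords J')) W" "g x \<in> W" "\<And>k. Ck_on k J' W F"
    "\<And>y. y \<in> W \<Longrightarrow> y \<in> S' \<Longrightarrow> F y = f y"
    using f by (rule smooth_real_atE) blast
  obtain D where D: "\<And>i. i \<in> J' \<Longrightarrow> continuous_on W (D i)"
    "\<And>i x. i \<in> J' \<Longrightarrow> x \<in> W \<Longrightarrow> ((\<lambda>t. F (x(i := t))) has_real_derivative D i x) (at (x i))"
    using Ck_on_partials[OF F(3)[of "Suc 0"]] by auto
  let ?\<gamma> = "\<lambda>t. g (x(j := t))"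
  have \<gamma>x: "?\<gamma> (x j) = g x" by simp
  have gx: "g x \<in> S'" using gS x by auto
  have ev: "\<forall>\<^sub>F t in at_right (x j). ?\<gamma> t \<in> S'"
    using eventually_upd_right_in_sector[OF S x j] by eventually_elim (use gS in auto)
  have S'c: "S' \<subseteq> coords J'"
    using S' sector_subset_coords[of J' K'] by (auto simp: openin_open)
  have evc: "\<forall>\<^sub>F t in at_right (x j). ?\<gamma> t \<in> coords J'"
    using ev by eventually_elim (use S'c in auto)
  have \<gamma>': "((\<lambda>t. ?\<gamma> t i) has_real_derivative right_partial j (\<lambda>y. g y i) x) (at_right (x j))"
    if "i \<in> J'" for i
    using smooth_real_at_right_deriv[OF S x j g[OF that]] .
  have "((\<lambda>t. ?\<gamma> t i) \<longlongrightarrow> g x i) (at_right (x j))" if "i \<in> J'" for i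
    using DERIV_continuous[OF \<gamma>'[OF that]] by (simp add: continuous_within)
  then have "\<forall>\<^sub>F t in at_right (x j). ?\<gamma> t \<in> W"
    by (intro eventually_in_openin_coords[OF J' F(1,2) _ evc])
  with ev have evF: "\<forall>\<^sub>F t in at_right (x j). F (?\<gamma> t) = f (?\<gamma> t)"
    by eventually_elim (rule F(4))
  have "((\<lambda>t. F (?\<gamma> t)) has_real_derivative
      (\<Sum>i\<in>J'. D i (?\<gamma> (x j)) * right_partial j (\<lambda>y. g y i) x)) (at_right (x j))"
    using F(2) by (intro has_real_derivative_along_curve[OF J' F(1) D(2) D(1) _ evc \<gamma>']) auto
  moreover have "right_partial i f (g x) = D i (g x)" if "i \<in> J'" for i
    using right_partial_extension(2)[OF S' gx that F(1,2) _ D(2)[OF that F(2)]] F(4) by simp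
  ultimately have "((\<lambda>t. F (?\<gamma> t)) has_real_derivative
      (\<Sum>i\<in>J'. right_partial i f (g x) * right_partial j (\<lambda>y. g y i) x)) (at_right (x j))"
    by simp
  then have "((\<lambda>t. f (?\<gamma> t)) has_real_derivative
      (\<Sum>i\<in>J'. right_partial i f (g x) * right_partial j (\<lambda>y. g y i) x)) (at_right (x j))"
    unfolding has_field_derivative_iff
    by (rule Lim_transform_eventually) (use evF F(4)[OF F(2) gx] in \<open>auto elim!: eventually_mono\<close>)
  then show ?thesis by (rule right_partial_eqI)
qed

lemma right_partial_const: "right_partial j (\<lambda>y. c) x = 0"
  by (rule right_partial_eqI) auto


section \<open>Smooth functions and maps on manifolds\<close>

subsection \<open>Charts\<close>

abbreviation cimg :: "('p, 'c) chart \<Rightarrow> ('c \<Rightarrow> real) set" where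
  "cimg c \<equiv> cmap c ` cdom c"

text \<open>
  The differential-geometric part of \<open>manifold\<close>.  It passes to finite products and disjoint unions by
  direct verification in charts.
\<close>

definition smooth_atlas :: "('p, 'c) mfd \<Rightarrow> bool" where
  "smooth_atlas M \<longleftrightarrow>
     (\<forall>c\<in>atlas M. is_chart (mtop M) c) \<and> (\<Union>c\<in>atlas M. cdom c) = pts M \<and>
     (\<forall>c\<in>atlas M. \<forall>c'\<in>atlas M.
        smooth_ext (cix c) (cmap c ` (cdom c \<inter> cdom c')) (cix c') (cmap c' \<circ> cinv c))"

lemma manifold_smooth_atlas: "manifold M \<Longrightarrow> smooth_atlas M"
  by (simp add: manifold_def smooth_atlas_def)

text \<open>
  What is needed of the charts of the target to describe smooth maps by coordinate functions; it is
  immediate for tangent bundles.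
\<close>

definition chart_like :: "'p topology \<Rightarrow> ('p, 'c) chart \<Rightarrow> bool" where
  "chart_like X c \<longleftrightarrow> finite (cix c) \<and> openin X (cdom c) \<and> cmap c \<in> cdom c \<rightarrow> coords (cix c)"

lemma charts_at_iff [simp]: "c \<in> charts_at M p \<longleftrightarrow> c \<in> atlas M \<and> p \<in> cdom c"
  by (simp add: charts_at_def)

context
  fixes X :: "'p topology" and c :: "('p, 'c) chart"
  assumes c: "is_chart X c"
begin

lemma is_chart_cimg_open: "openin (top_of_set (sector (cix c) (ccor c))) (cimg c)"
  using c by (simp add: is_chart_def)

lemma is_chart_finite: "finite (cix c)"
  using c by (simp add: is_chart_def)

lemma is_chart_cdom_open: "openin X (cdom c)"
  using c by (simp add: is_chart_def)

lemma is_chart_cimg_subset: "cimg c \<subseteq> coords (cix c)"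
  using is_chart_cimg_open sector_subset_coords[of "cix c" "ccor c"] by (auto simp: openin_open)

lemma is_chart_cmap_coords: "p \<in> cdom c \<Longrightarrow> cmap c p \<in> coords (cix c)"
  using is_chart_cimg_subset by auto

lemma is_chart_chart_like: "chart_like X c"
  using is_chart_finite is_chart_cdom_open is_chart_cmap_coords by (auto simp: chart_like_def)

lemma is_chart_inj: "inj_on (cmap c) (cdom c)"
proof -
  have "cdom c \<subseteq> topspace X" using is_chart_cdom_open by (rule openin_subset)
  then show ?thesis
    using c by (auto simp: is_chart_def homeomorphic_eq_everything_map topspace_subtopology Int_absorb1)
qed

lemma cinv_cmap: "p \<in> cdom c \<Longrightarrow> cinv c (cmap c p) = p"
  by (simp add: cinv_def is_chart_inj)

lemma is_chart_open_image:
  assumes "openin X U"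
  shows "openin (top_of_set (cimg c)) (cmap c ` (U \<inter> cdom c))"
proof -
  have "open_map (subtopology X (cdom c)) (top_of_set (cimg c)) (cmap c)"
    using c by (simp add: is_chart_def homeomorphic_eq_everything_map)
  moreover have "openin (subtopology X (cdom c)) (U \<inter> cdom c)"
    using assms by (auto simp: openin_subtopology)
  ultimately show ?thesis by (auto simp: open_map_def)
qed

lemma is_chart_open_image_sector:
  "openin X U \<Longrightarrow> openin (top_of_set (sector (cix c) (ccor c))) (cmap c ` (U \<inter> cdom c))"
  using is_chart_open_image is_chart_cimg_open openin_trans by blast

lemma is_chart_open_preimage:
  assumes "openin (top_of_set (cimg c)) V"
  shows "openin X {p \<in> cdom c. cmap c p \<in> V}"
proof -
  have sub: "cdom c \<subseteq> topspace X" using is_chart_cdom_open by (rule openin_subset)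
  have "continuous_map (subtopology X (cdom c)) (top_of_set (cimg c)) (cmap c)"
    using c by (simp add: is_chart_def homeomorphic_eq_everything_map)
  from openin_continuous_map_preimage[OF this assms]
  have "openin (subtopology X (cdom c)) {p \<in> cdom c. cmap c p \<in> V}"
    using sub by (simp add: topspace_subtopology Int_absorb1)
  then show ?thesis using is_chart_cdom_open openin_trans_full by blast
qed

end

lemma cmap_cinv: "x \<in> cimg c \<Longrightarrow> cmap c (cinv c x) = x"
  by (auto simp: cinv_def f_inv_into_f)

lemma cinv_in_cdom: "x \<in> cimg c \<Longrightarrow> cinv c x \<in> cdom c"
  unfolding cinv_def by (rule inv_into_into)

lemma smooth_atlas_is_chart: "smooth_atlas M \<Longrightarrow> c \<in> atlas M \<Longrightarrow> is_chart (mtop M) c"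
  by (simp add: smooth_atlas_def)

lemma smooth_atlas_cdom_subset: "smooth_atlas M \<Longrightarrow> c \<in> atlas M \<Longrightarrow> cdom c \<subseteq> pts M"
  by (auto simp: smooth_atlas_def)

lemma smooth_atlas_chart_exists:
  assumes "smooth_atlas M" "q \<in> pts M"
  obtains c where "c \<in> atlas M" "q \<in> cdom c"
  using assms unfolding smooth_atlas_def by blast

lemma is_chart_cinv_continuous:
  assumes c: "is_chart X c"
  shows "continuous_map (top_of_set (cimg c)) (subtopology X (cdom c)) (cinv c)"
proof -
  have sub: "cdom c \<subseteq> topspace X" using is_chart_cdom_open[OF c] by (rule openin_subset)
  have "openin (top_of_set (cimg c)) {x \<in> cimg c. cinv c x \<in> V}" if "openin X V" for V
  proof -
    have "{x \<in> cimg c. cinv c x \<in> V} = cmap c ` (V \<inter> cdom c)"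
      by (auto simp: cinv_cmap[OF c])
    then show ?thesis using is_chart_open_image[OF c that] by simp
  qed
  then have "continuous_map (top_of_set (cimg c)) X (cinv c)"
    using sub cinv_in_cdom by (fastforce simp: continuous_map)
  then show ?thesis
    using cinv_in_cdom by (fastforce simp: continuous_map_in_subtopology)
qed

lemma is_chart_cmap_continuous:
  assumes c: "is_chart X c"
  shows "continuous_map (subtopology X (cdom c)) euclidean (cmap c)"
proof -
  have "continuous_map (subtopology X (cdom c)) (top_of_set (cimg c)) (cmap c)"
    using c by (simp add: is_chart_def homeomorphic_eq_everything_map)
  then show ?thesis by (simp add: continuous_map_in_subtopology)
qed

lemma is_chartI:
  assumes "finite (cix c)" "ccor c \<subseteq> cix c" "openin X (cdom c)"
    and "openin (top_of_set (sector (cix c) (ccor c))) (cimg c)"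
    and f: "continuous_map (subtopology X (cdom c)) euclidean (cmap c)"
    and g: "continuous_map (top_of_set (cimg c)) (subtopology X (cdom c)) g"
    and gf: "\<And>p. p \<in> cdom c \<Longrightarrow> g (cmap c p) = p"
  shows "is_chart X c"
proof -
  have sub: "cdom c \<subseteq> topspace X" using assms(3) by (rule openin_subset)
  have "continuous_map (subtopology X (cdom c)) (top_of_set (cimg c)) (cmap c)"
    using f by (auto simp: continuous_map_in_subtopology)
  then have "homeomorphic_maps (subtopology X (cdom c)) (top_of_set (cimg c)) (cmap c) g"
    using g gf unfolding homeomorphic_maps_def by auto
  then show ?thesis
    using assms(1-4) homeomorphic_maps_imp_map unfolding is_chart_def by blast
qed

lemma cinv_unique: "is_chart X c \<Longrightarrow> p \<in> cdom c \<Longrightarrow> cmap c p = x \<Longrightarrow> cinv c x = p"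
  by (auto simp: cinv_cmap)

subsection \<open>Smooth functions\<close>

definition smooth_fun_at :: "('p, 'c) mfd \<Rightarrow> ('p \<Rightarrow> real) \<Rightarrow> 'p \<Rightarrow> bool" where
  "smooth_fun_at M g q \<longleftrightarrow>
     (\<forall>c\<in>charts_at M q. smooth_real_at (cix c) (cimg c) (\<lambda>x. g (cinv c x)) (cmap c q))"

lemma smooth_fun_atD:
  "smooth_fun_at M g q \<Longrightarrow> c \<in> atlas M \<Longrightarrow> q \<in> cdom c \<Longrightarrow>
   smooth_real_at (cix c) (cimg c) (\<lambda>x. g (cinv c x)) (cmap c q)"
  by (simp add: smooth_fun_at_def)

context
  fixes M :: "('p, 'c) mfd"
  assumes M: "smooth_atlas M"
begin

lemma smooth_fun_at_const: "smooth_fun_at M (\<lambda>m. r) q"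
  using is_chart_cmap_coords[OF smooth_atlas_is_chart[OF M]]
  by (auto simp: smooth_fun_at_def intro: smooth_real_at_const)

lemma smooth_fun_at_add:
  "smooth_fun_at M g q \<Longrightarrow> smooth_fun_at M h q \<Longrightarrow> smooth_fun_at M (\<lambda>m. g m + h m) q"
  by (auto simp: smooth_fun_at_def intro: smooth_real_at_add)

lemma smooth_fun_at_mult:
  "smooth_fun_at M g q \<Longrightarrow> smooth_fun_at M h q \<Longrightarrow> smooth_fun_at M (\<lambda>m. g m * h m) q"
  by (auto simp: smooth_fun_at_def intro: smooth_real_at_mult)

lemma smooth_fun_at_sum:
  "(\<And>i. i \<in> I \<Longrightarrow> smooth_fun_at M (g i) q) \<Longrightarrow> smooth_fun_at M (\<lambda>m. \<Sum>i\<in>I. g i m) q"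
  by (induction I rule: infinite_finite_induct) (auto intro: smooth_fun_at_add smooth_fun_at_const)

lemma smooth_fun_at_local:
  assumes U: "openin (mtop M) U" and q: "q \<in> U" and g: "smooth_fun_at M g q"
    and eq: "\<And>m. m \<in> U \<Longrightarrow> h m = g m"
  shows "smooth_fun_at M h q"
  unfolding smooth_fun_at_def
proof
  fix c assume "c \<in> charts_at M q"
  then have c: "c \<in> atlas M" "q \<in> cdom c" by auto
  note ch = smooth_atlas_is_chart[OF M c(1)]
  show "smooth_real_at (cix c) (cimg c) (\<lambda>x. h (cinv c x)) (cmap c q)"
  proof (rule smooth_real_at_local[OF is_chart_open_image[OF ch U]])
    show "smooth_real_at (cix c) (cmap c ` (U \<inter> cdom c)) (\<lambda>x. g (cinv c x)) (cmap c q)"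
      by (rule smooth_real_at_subset[OF smooth_fun_atD[OF g c]]) auto
  qed (use q c eq cinv_cmap[OF ch] in auto)
qed

lemma smooth_fun_at_compose_coords:
  assumes J: "finite J" and U: "openin (mtop M) U" and q: "q \<in> U"
    and S: "S \<subseteq> coords J" and gU: "g \<in> U \<rightarrow> S"
    and g: "\<And>i. i \<in> J \<Longrightarrow> smooth_fun_at M (\<lambda>m. g m i) q"
    and h: "smooth_real_at J S h (g q)"
  shows "smooth_fun_at M (\<lambda>m. h (g m)) q"
  unfolding smooth_fun_at_def
proof
  fix c assume "c \<in> charts_at M q"
  then have c: "c \<in> atlas M" "q \<in> cdom c" by auto
  note ch = smooth_atlas_is_chart[OF M c(1)]
  let ?T = "cmap c ` (U \<inter> cdom c)"
  show "smooth_real_at (cix c) (cimg c) (\<lambda>x. h (g (cinv c x))) (cmap c q)"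
  proof (rule smooth_real_at_local[OF is_chart_open_image[OF ch U]])
    show "smooth_real_at (cix c) ?T (\<lambda>x. h (g (cinv c x))) (cmap c q)"
    proof (rule smooth_real_at_compose[OF J _ S, where f = h and g = "\<lambda>x. g (cinv c x)"])
      show "?T \<subseteq> coords (cix c)" using is_chart_cimg_subset[OF ch] by auto
      show "(\<lambda>x. g (cinv c x)) \<in> ?T \<rightarrow> S" using gU by (auto simp: cinv_cmap[OF ch])
      show "smooth_real_at (cix c) ?T (\<lambda>x. g (cinv c x) i) (cmap c q)" if "i \<in> J" for i
        by (rule smooth_real_at_subset[OF smooth_fun_atD[OF g[OF that] c]]) auto
    qed (use q c h cinv_cmap[OF ch] in auto)
  qed (use q c in auto)
qed

text \<open>
  One chart suffices, by smoothness of the changes of coordinates.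
\<close>

lemma smooth_fun_atI_chart:
  assumes c: "c \<in> atlas M" "q \<in> cdom c"
    and g: "smooth_real_at (cix c) (cimg c) (\<lambda>x. g (cinv c x)) (cmap c q)"
  shows "smooth_fun_at M g q"
  unfolding smooth_fun_at_def
proof
  fix c' assume "c' \<in> charts_at M q"
  then have c': "c' \<in> atlas M" "q \<in> cdom c'" by auto
  note ch = smooth_atlas_is_chart[OF M c(1)] and ch' = smooth_atlas_is_chart[OF M c'(1)]
  let ?T = "cmap c' ` (cdom c \<inter> cdom c')"
  have tr: "smooth_ext (cix c') ?T (cix c) (cmap c \<circ> cinv c')"
    using M c(1) c'(1) unfolding smooth_atlas_def by (metis Int_commute)
  have "smooth_real_at (cix c') ?T (\<lambda>x. g (cinv c (cmap c (cinv c' x)))) (cmap c' q)"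
  proof (rule smooth_real_at_compose[OF is_chart_finite[OF ch],
        where f = "\<lambda>x. g (cinv c x)" and g = "\<lambda>x. cmap c (cinv c' x)"])
    show "?T \<subseteq> coords (cix c')" using is_chart_cimg_subset[OF ch'] by auto
    show "cimg c \<subseteq> coords (cix c)" by (rule is_chart_cimg_subset[OF ch])
    show "(\<lambda>x. cmap c (cinv c' x)) \<in> ?T \<rightarrow> cimg c" by (auto simp: cinv_cmap[OF ch'])
    show "smooth_real_at (cix c') ?T (\<lambda>x. cmap c (cinv c' x) i) (cmap c' q)" if "i \<in> cix c" for i
      using smooth_real_at_smooth_ext[OF tr _ that, of "cmap c' q"] c c' by simp
    show "cmap c' q \<in> ?T" using c c' by auto
    show "smooth_real_at (cix c) (cimg c) (\<lambda>x. g (cinv c x)) (cmap c (cinv c' (cmap c' q)))"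
      using g c' by (simp add: cinv_cmap[OF ch'])
  qed
  then show "smooth_real_at (cix c') (cimg c') (\<lambda>x. g (cinv c' x)) (cmap c' q)"
    by (rule smooth_real_at_local[OF is_chart_open_image[OF ch' is_chart_cdom_open[OF ch]], rotated])
      (use c c' in \<open>auto simp: cinv_cmap[OF ch] cinv_cmap[OF ch']\<close>)
qed

lemma smooth_fun_at_chart_fun:
  assumes c: "c \<in> atlas M" "q \<in> cdom c" and h: "smooth_real_at (cix c) (cimg c) h (cmap c q)"
  shows "smooth_fun_at M (\<lambda>m. h (cmap c m)) q"
proof (rule smooth_fun_atI_chart[OF c])
  show "smooth_real_at (cix c) (cimg c) (\<lambda>x. h (cmap c (cinv c x))) (cmap c q)"
    using c by (intro smooth_real_at_local[OF _ _ h]) (auto simp: cmap_cinv)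
qed

lemma smooth_fun_at_coordinate:
  "c \<in> atlas M \<Longrightarrow> q \<in> cdom c \<Longrightarrow> smooth_fun_at M (\<lambda>m. cmap c m i) q"
  using is_chart_cmap_coords[OF smooth_atlas_is_chart[OF M]]
  by (intro smooth_fun_at_chart_fun smooth_real_at_coordinate)

lemma smooth_fun_at_right_partial:
  assumes c: "c \<in> atlas M" "q \<in> cdom c" and g: "smooth_fun_at M g q" and j: "j \<in> cix c"
  shows "smooth_fun_at M (\<lambda>m. right_partial j (\<lambda>x. g (cinv c x)) (cmap c m)) q"
proof (rule smooth_fun_at_chart_fun[OF c])
  show "smooth_real_at (cix c) (cimg c) (right_partial j (\<lambda>x. g (cinv c x))) (cmap c q)"
    using is_chart_cimg_open[OF smooth_atlas_is_chart[OF M c(1)]] c j smooth_fun_atD[OF g c]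
    by (intro smooth_real_at_right_partial) auto
qed

lemma continuous_map_if_smooth_fun_at:
  assumes U: "openin (mtop M) U" and g: "\<And>q. q \<in> U \<Longrightarrow> smooth_fun_at M g q"
  shows "continuous_map (subtopology (mtop M) U) euclideanreal g"
proof -
  have UM: "U \<subseteq> pts M" using U by (rule openin_subset)
  have "openin (mtop M) {q \<in> U. g q \<in> V}" if V: "open V" for V
  proof (subst openin_subopen, intro ballI)
    fix q assume q: "q \<in> {q \<in> U. g q \<in> V}"
    then obtain c where c: "c \<in> atlas M" "q \<in> cdom c"
      using UM smooth_atlas_chart_exists[OF M] by blast
    note ch = smooth_atlas_is_chart[OF M c(1)]
    let ?T = "cmap c ` (U \<inter> cdom c)"
    let ?S = "?T \<inter> (\<lambda>x. g (cinv c x)) -` V"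
    have "continuous_on ?T (\<lambda>x. g (cinv c x))"
    proof (rule continuous_on_if_smooth_real_at)
      show "?T \<subseteq> coords (cix c)" using is_chart_cimg_subset[OF ch] by auto
      fix x assume "x \<in> ?T"
      then obtain m where m: "m \<in> U" "m \<in> cdom c" "x = cmap c m" by auto
      show "smooth_real_at (cix c) ?T (\<lambda>x. g (cinv c x)) x"
        unfolding m(3)
        by (rule smooth_real_at_subset[OF smooth_fun_atD[OF g[OF m(1)] c(1) m(2)]]) auto
    qed
    then have "openin (top_of_set ?T) ?S"
      using V by (simp add: continuous_openin_preimage_gen)
    then have S: "openin (top_of_set (cimg c)) ?S"
      using is_chart_open_image[OF ch U] openin_trans by blast
    have "{p \<in> cdom c. cmap c p \<in> ?S} \<subseteq> {q \<in> U. g q \<in> V}"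
      using is_chart_inj[OF ch] by (auto simp: cinv_cmap[OF ch] inj_on_def)
    moreover have "q \<in> {p \<in> cdom c. cmap c p \<in> ?S}"
      using q c by (auto simp: cinv_cmap[OF ch])
    ultimately show "\<exists>T. openin (mtop M) T \<and> q \<in> T \<and> T \<subseteq> {q \<in> U. g q \<in> V}"
      using is_chart_open_preimage[OF ch S] by blast
  qed
  then show ?thesis
    using UM U by (auto simp: continuous_map topspace_subtopology Int_absorb1 openin_open_subtopology)
qed

end

subsection \<open>Smooth maps\<close>

lemma smooth_maps_to: "smooth M N f \<Longrightarrow> q \<in> pts M \<Longrightarrow> f q \<in> pts N"
  by (auto simp: smooth_def continuous_map_def)

lemma smooth_preimage_open:
  "smooth M N f \<Longrightarrow> openin (mtop N) V \<Longrightarrow> openin (mtop M) {q \<in> pts M. f q \<in> V}"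
  using openin_continuous_map_preimage unfolding smooth_def by blast

lemma smoothI:
  assumes M: "smooth_atlas M" and N: "\<And>c. c \<in> atlas N \<Longrightarrow> chart_like (mtop N) c"
    and cont: "continuous_map (mtop M) (mtop N) f"
    and f: "\<And>q c' i. q \<in> pts M \<Longrightarrow> c' \<in> atlas N \<Longrightarrow> f q \<in> cdom c' \<Longrightarrow> i \<in> cix c' \<Longrightarrow>
      smooth_fun_at M (\<lambda>m. cmap c' (f m) i) q"
  shows "smooth M N f"
  unfolding smooth_def
proof (intro conjI ballI cont)
  fix c c' assume c: "c \<in> atlas M" and c': "c' \<in> atlas N"
  note ch = smooth_atlas_is_chart[OF M c] and ch' = N[OF c']
  let ?T = "cmap c ` {p \<in> cdom c. f p \<in> cdom c'}"
  show "smooth_ext (cix c) ?T (cix c') (cmap c' \<circ> f \<circ> cinv c)"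
  proof (rule smooth_ext_if_smooth_real_at)
    show "finite (cix c')" using ch' by (simp add: chart_like_def)
    show "?T \<subseteq> coords (cix c)" using is_chart_cimg_subset[OF ch] by auto
    show "cmap c' \<circ> f \<circ> cinv c \<in> ?T \<rightarrow> coords (cix c')"
      using ch' by (auto simp: cinv_cmap[OF ch] chart_like_def)
    fix x i assume "x \<in> ?T" and i: "i \<in> cix c'"
    then obtain q where q: "q \<in> cdom c" "f q \<in> cdom c'" "x = cmap c q" by auto
    have "smooth_fun_at M (\<lambda>m. cmap c' (f m) i) q"
      using f[OF _ c' q(2) i] q(1) smooth_atlas_cdom_subset[OF M c] by blast
    from smooth_real_at_subset[OF smooth_fun_atD[OF this c q(1)], of ?T]
    show "smooth_real_at (cix c) ?T (\<lambda>y. (cmap c' \<circ> f \<circ> cinv c) y i) x"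
      using q(3) by auto
  qed
qed

lemma smooth_fun_at_chart_of_map:
  assumes M: "smooth_atlas M" and ch': "chart_like (mtop N) c'" and f: "smooth M N f"
    and q: "q \<in> pts M" and c': "c' \<in> atlas N" "f q \<in> cdom c'"
  shows "smooth_fun_at M (\<lambda>m. cmap c' (f m) i) q"
proof -
  let ?U = "{m \<in> pts M. f m \<in> cdom c'}"
  have U: "openin (mtop M) ?U"
    using smooth_preimage_open[OF f] ch' by (auto simp: chart_like_def)
  show ?thesis
  proof (cases "i \<in> cix c'")
    case True
    show ?thesis
      unfolding smooth_fun_at_def
    proof
      fix c assume "c \<in> charts_at M q"
      then have c: "c \<in> atlas M" "q \<in> cdom c" by auto
      have eq: "{p \<in> cdom c. f p \<in> cdom c'} = ?U \<inter> cdom c"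
        using smooth_atlas_cdom_subset[OF M c(1)] by auto
      have "smooth_ext (cix c) (cmap c ` (?U \<inter> cdom c)) (cix c') (cmap c' \<circ> f \<circ> cinv c)"
        using f c(1) c'(1) unfolding smooth_def eq[symmetric] by blast
      from smooth_real_at_smooth_ext[OF this _ True, of "cmap c q"]
      show "smooth_real_at (cix c) (cimg c) (\<lambda>x. cmap c' (f (cinv c x)) i) (cmap c q)"
        using q c c' by (intro smooth_real_at_local[OF is_chart_open_image[OF smooth_atlas_is_chart[OF M c(1)] U]]) auto
    qed
  next
    case False
    show ?thesis
      using q c' ch' False
      by (intro smooth_fun_at_local[OF M U _ smooth_fun_at_const[OF M, of 0]])
        (auto simp: chart_like_def coords_def Pi_iff)
  qed
qed

lemma smooth_atlas_chart_like: "smooth_atlas M \<Longrightarrow> c \<in> atlas M \<Longrightarrow> chart_like (mtop M) c"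
  by (rule is_chart_chart_like[OF smooth_atlas_is_chart])

lemma smooth_fun_at_compose:
  assumes M: "smooth_atlas M" and N: "smooth_atlas N" and f: "smooth M N f"
    and q: "q \<in> pts M" and g: "smooth_fun_at N g (f q)"
  shows "smooth_fun_at M (\<lambda>m. g (f m)) q"
proof -
  obtain c' where c': "c' \<in> atlas N" "f q \<in> cdom c'"
    using smooth_atlas_chart_exists[OF N smooth_maps_to[OF f q]] .
  note ch' = smooth_atlas_is_chart[OF N c'(1)]
  let ?U = "{m \<in> pts M. f m \<in> cdom c'}"
  have U: "openin (mtop M) ?U"
    using smooth_preimage_open[OF f is_chart_cdom_open[OF ch']] .
  have "smooth_fun_at M (\<lambda>m. g (cinv c' (cmap c' (f m)))) q"
  proof (rule smooth_fun_at_compose_coords[OF M is_chart_finite[OF ch'] U _ is_chart_cimg_subset[OF ch'],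
        where g = "\<lambda>m. cmap c' (f m)"])
    show "smooth_fun_at M (\<lambda>m. cmap c' (f m) i) q" for i
      by (rule smooth_fun_at_chart_of_map[OF M is_chart_chart_like[OF ch'] f q c'])
    show "smooth_real_at (cix c') (cimg c') (\<lambda>x. g (cinv c' x)) (cmap c' (f q))"
      by (rule smooth_fun_atD[OF g c'])
  qed (use q c' in auto)
  then show ?thesis
    by (rule smooth_fun_at_local[OF M U, rotated]) (use q c' in \<open>auto simp: cinv_cmap[OF ch']\<close>)
qed

lemma smooth_compose:
  assumes M: "smooth_atlas M" and N: "smooth_atlas N" and L: "\<And>c. c \<in> atlas L \<Longrightarrow> chart_like (mtop L) c"
    and f: "smooth M N f" and g: "smooth N L g"
  shows "smooth M L (\<lambda>m. g (f m))"
proof (rule smoothI[OF M L])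
  show "continuous_map (mtop M) (mtop L) (\<lambda>m. g (f m))"
    using f g continuous_map_compose[of "mtop M" "mtop N" f "mtop L" g] by (simp add: smooth_def o_def)
  show "smooth_fun_at M (\<lambda>m. cmap c' (g (f m)) i) q"
    if "q \<in> pts M" "c' \<in> atlas L" "g (f q) \<in> cdom c'" for q c' i
    using that smooth_maps_to[OF f]
    by (intro smooth_fun_at_compose[OF M N f, where g = "\<lambda>n. cmap c' (g n) i"] smooth_fun_at_chart_of_map[OF N L g])
qed

text \<open>
  Smoothness of a map can be tested with one chart of the target around each point; continuity comes
  for free, since the map is locally the inverse of a chart after continuous coordinate functions.
\<close>

lemma smooth_localI:
  assumes M: "smooth_atlas M" and N: "smooth_atlas N"
    and ex: "\<And>q. q \<in> pts M \<Longrightarrow> \<exists>U. \<exists>c'\<in>atlas N. openin (mtop M) U \<and> q \<in> U \<and> f ` U \<subseteq> cdom c' \<and>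
      (\<forall>m\<in>U. \<forall>i\<in>cix c'. smooth_fun_at M (\<lambda>m. cmap c' (f m) i) m)"
  shows "smooth M N f"
proof (rule smoothI[OF M smooth_atlas_chart_like[OF N]])
  have "openin (mtop M) {q \<in> pts M. f q \<in> V}" if V: "openin (mtop N) V" for V
  proof (subst openin_subopen, intro ballI)
    fix q assume q: "q \<in> {q \<in> pts M. f q \<in> V}"
    then obtain U c' where U: "openin (mtop M) U" "q \<in> U" and c': "c' \<in> atlas N" "f ` U \<subseteq> cdom c'"
      and sm: "\<And>m i. m \<in> U \<Longrightarrow> i \<in> cix c' \<Longrightarrow> smooth_fun_at M (\<lambda>m. cmap c' (f m) i) m"
      using ex[of q] by auto
    note ch' = smooth_atlas_is_chart[OF N c'(1)]
    have UM: "U \<subseteq> pts M" using U(1) by (rule openin_subset)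
    have "continuous_map (subtopology (mtop M) U) euclideanreal (\<lambda>m. cmap c' (f m) i)" for i
    proof (cases "i \<in> cix c'")
      case False
      then have "cmap c' (f m) i = 0" if "m \<in> U" for m
        using is_chart_cmap_coords[OF ch'] c'(2) that by (auto simp: coords_def)
      then show ?thesis
        by (intro continuous_map_eq[OF continuous_map_const[THEN iffD2, of _ 0]]) (auto simp: topspace_subtopology)
    qed (use continuous_map_if_smooth_fun_at[OF M U(1)] sm in blast)
    then have "continuous_map (subtopology (mtop M) U) euclidean (\<lambda>m. cmap c' (f m))"
      by (simp add: euclidean_product_topology[symmetric] continuous_map_componentwise_UNIV)
    then have "continuous_map (subtopology (mtop M) U) (top_of_set (cimg c')) (\<lambda>m. cmap c' (f m))"
      using c'(2) UM by (auto simp: continuous_map_in_subtopology topspace_subtopology)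
    from openin_continuous_map_preimage[OF this is_chart_open_image[OF ch' V]]
    have "openin (subtopology (mtop M) U) {m \<in> U. cmap c' (f m) \<in> cmap c' ` (V \<inter> cdom c')}"
      using UM by (simp add: topspace_subtopology Int_absorb1)
    also have "{m \<in> U. cmap c' (f m) \<in> cmap c' ` (V \<inter> cdom c')} = {m \<in> U. f m \<in> V}"
      using c'(2) is_chart_inj[OF ch'] by (auto simp: inj_on_def)
    finally have "openin (mtop M) {m \<in> U. f m \<in> V}"
      using U(1) openin_trans_full by blast
    then show "\<exists>T. openin (mtop M) T \<and> q \<in> T \<and> T \<subseteq> {q \<in> pts M. f q \<in> V}"
      using q U UM by (intro exI[of _ "{m \<in> U. f m \<in> V}"]) auto
  qed
  moreover have "f q \<in> pts N" if "q \<in> pts M" for q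
    using ex[OF that] smooth_atlas_cdom_subset[OF N] by blast
  ultimately show "continuous_map (mtop M) (mtop N) f"
    by (auto simp: continuous_map)
  fix q c i assume q: "q \<in> pts M" and c: "c \<in> atlas N" "f q \<in> cdom c"
  obtain U c' where U: "openin (mtop M) U" "q \<in> U" and c': "c' \<in> atlas N" "f ` U \<subseteq> cdom c'"
    and sm: "\<And>m i. m \<in> U \<Longrightarrow> i \<in> cix c' \<Longrightarrow> smooth_fun_at M (\<lambda>m. cmap c' (f m) i) m"
    using ex[OF q] by auto
  note ch' = smooth_atlas_is_chart[OF N c'(1)]
  have "smooth_real_at (cix c') (cimg c') (\<lambda>x. cmap c (cinv c' x) i) (cmap c' (f q))"
    using smooth_fun_atD[OF smooth_fun_at_coordinate[OF N c] c'(1)] c'(2) U(2) by auto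
  then have "smooth_fun_at M (\<lambda>m. cmap c (cinv c' (cmap c' (f m))) i) q"
    by (rule smooth_fun_at_compose_coords[OF M is_chart_finite[OF ch'] U is_chart_cimg_subset[OF ch'],
        where g = "\<lambda>m. cmap c' (f m)", rotated 2]) (use c' sm[OF U(2)] in auto)
  then show "smooth_fun_at M (\<lambda>m. cmap c (f m) i) q"
    by (rule smooth_fun_at_local[OF M U]) (use c'(2) in \<open>auto simp: cinv_cmap[OF ch']\<close>)
qed

lemma smooth_id: "smooth_atlas M \<Longrightarrow> smooth M M (\<lambda>m. m)"
  by (rule smoothI) (auto intro: smooth_atlas_chart_like smooth_fun_at_coordinate)



section \<open>Tangent vectors and tangent maps\<close>

text \<open>
  The derivative of \<open>g\<close> along the tangent vector \<open>w\<close>, computed in the chart \<open>c\<close>.  Viewing tangent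
  vectors as derivations turns statements about Jacobians into the chain rule.
\<close>

definition chart_deriv :: "('p, 'c) chart \<Rightarrow> ('p \<Rightarrow> real) \<Rightarrow> ('p, 'c) tvec \<Rightarrow> real" where
  "chart_deriv c g w =
     (\<Sum>j\<in>cix c. right_partial j (\<lambda>x. g (cinv c x)) (cmap c (fst w)) * snd w c j)"

text \<open>
  The chart is chosen as in \<open>tangent_map\<close>, so that the coordinates of a tangent map are derivatives
  of coordinate functions by definition (\<open>tangent_map_snd\<close>).
\<close>

definition tangent_deriv :: "('p, 'c) mfd \<Rightarrow> ('p \<Rightarrow> real) \<Rightarrow> ('p, 'c) tvec \<Rightarrow> real" where
  "tangent_deriv M g w = chart_deriv (SOME c. c \<in> charts_at M (fst w)) g w"

lemma tangent_space_iff: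
  "w \<in> tangent_space M p \<longleftrightarrow> fst w = p \<and> (\<forall>c. c \<notin> charts_at M p \<longrightarrow> snd w c = (\<lambda>_. 0)) \<and>
     (\<forall>c\<in>charts_at M p. snd w c \<in> coords (cix c) \<and> (\<forall>c'\<in>charts_at M p.
       snd w c' = differential (cix c) (cmap c' \<circ> cinv c) (cmap c p) (snd w c)))"
  unfolding tangent_space_def mem_Collect_eq by (cases w) (simp only: prod.case fst_conv snd_conv)

lemma tangent_space_fst: "w \<in> tangent_space M p \<Longrightarrow> fst w = p"
  unfolding tangent_space_iff by blast

lemma tangent_space_charts:
  assumes w: "w \<in> tangent_space M p" and c: "c \<in> atlas M" "p \<in> cdom c"
  shows "snd w c \<in> coords (cix c) \<and> (\<forall>c'\<in>charts_at M p.
    snd w c' = differential (cix c) (cmap c' \<circ> cinv c) (cmap c p) (snd w c))"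
proof -
  have "c \<in> charts_at M p" using c by simp
  then show ?thesis by (rule w[unfolded tangent_space_iff, THEN conjunct2, THEN conjunct2, THEN bspec])
qed

lemma tangent_space_coords:
  "w \<in> tangent_space M p \<Longrightarrow> c \<in> atlas M \<Longrightarrow> p \<in> cdom c \<Longrightarrow> snd w c \<in> coords (cix c)"
  by (rule tangent_space_charts[THEN conjunct1])

lemma tangent_space_off:
  "w \<in> tangent_space M p \<Longrightarrow> \<not> (c \<in> atlas M \<and> p \<in> cdom c) \<Longrightarrow> snd w c = (\<lambda>_. 0)"
  unfolding tangent_space_iff charts_at_iff[symmetric] by blast

lemma chart_deriv_coordinate:
  "fst w = p \<Longrightarrow> differential (cix c) (cmap c' \<circ> cinv c) (cmap c p) (snd w c) =
    (\<lambda>i. chart_deriv c (\<lambda>m. cmap c' m i) w)"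
  by (simp add: chart_deriv_def differential_def)

lemma tangent_space_change:
  assumes w: "w \<in> tangent_space M p"
    and c: "c \<in> atlas M" "p \<in> cdom c" and c': "c' \<in> atlas M" "p \<in> cdom c'"
  shows "chart_deriv c (\<lambda>m. cmap c' m i) w = snd w c' i"
proof -
  have "c' \<in> charts_at M p" using c' by simp
  from tangent_space_charts[OF w c, THEN conjunct2, THEN bspec, OF this]
  show ?thesis
    unfolding chart_deriv_coordinate[OF tangent_space_fst[OF w]] by (rule fun_cong[THEN sym])
qed

lemma tangent_spaceI:
  assumes "fst w = p"
    and "\<And>c. \<not> (c \<in> atlas M \<and> p \<in> cdom c) \<Longrightarrow> snd w c = (\<lambda>_. 0)"
    and "\<And>c. c \<in> atlas M \<Longrightarrow> p \<in> cdom c \<Longrightarrow> snd w c \<in> coords (cix c)"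
    and "\<And>c c' i. c \<in> atlas M \<Longrightarrow> p \<in> cdom c \<Longrightarrow> c' \<in> atlas M \<Longrightarrow> p \<in> cdom c' \<Longrightarrow>
      snd w c' i = chart_deriv c (\<lambda>m. cmap c' m i) w"
  shows "w \<in> tangent_space M p"
  unfolding tangent_space_iff chart_deriv_coordinate[OF assms(1)] charts_at_iff
  by (intro conjI ballI allI impI ext assms(1,2)) (auto intro: assms(3) assms(4))

lemma tangent_vector_eqI:
  assumes "w \<in> tangent_space M p" "w' \<in> tangent_space M p"
    and "\<And>c i. c \<in> atlas M \<Longrightarrow> p \<in> cdom c \<Longrightarrow> snd w c i = snd w' c i"
  shows "w = w'"
proof (rule prod_eqI)
  show "snd w = snd w'"
  proof (intro ext)
    show "snd w c i = snd w' c i" for c i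
      using assms tangent_space_off[of w M p c] tangent_space_off[of w' M p c]
      by (cases "c \<in> atlas M \<and> p \<in> cdom c") auto
  qed
qed (use assms tangent_space_fst in metis)

lemma tangent_map_fst [simp]: "fst (tangent_map M N f w) = f (fst w)"
  by (simp add: tangent_map_def Let_def)

lemma tangent_map_snd:
  "c' \<in> atlas N \<Longrightarrow> f (fst w) \<in> cdom c' \<Longrightarrow>
   snd (tangent_map M N f w) c' i = tangent_deriv M (\<lambda>m. cmap c' (f m) i) w"
  by (simp add: tangent_map_def tangent_deriv_def chart_deriv_def differential_def Let_def)

lemma tangent_map_off:
  "\<not> (c' \<in> atlas N \<and> f (fst w) \<in> cdom c') \<Longrightarrow> snd (tangent_map M N f w) c' = (\<lambda>_. 0)"
  by (auto simp: tangent_map_def Let_def)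

lemma chart_deriv_local:
  assumes M: "smooth_atlas M" and c: "c \<in> atlas M" "fst w \<in> cdom c"
    and U: "openin (mtop M) U" "fst w \<in> U" and eq: "\<And>m. m \<in> U \<Longrightarrow> g m = h m"
  shows "chart_deriv c g w = chart_deriv c h w"
proof -
  note ch = smooth_atlas_is_chart[OF M c(1)]
  have "right_partial j (\<lambda>x. g (cinv c x)) (cmap c (fst w)) = right_partial j (\<lambda>x. h (cinv c x)) (cmap c (fst w))"
    if "j \<in> cix c" for j
    by (rule right_partial_cong[OF is_chart_open_image_sector[OF ch U(1)] _ that])
      (use c U(2) eq in \<open>auto simp: cinv_cmap[OF ch]\<close>)
  then show ?thesis unfolding chart_deriv_def by simp
qed

lemma chart_deriv_const: "chart_deriv c (\<lambda>m. r) w = 0"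
  by (simp add: chart_deriv_def right_partial_const)

text \<open>
  The Euclidean chain rule in a chart of the source and a chart of the target.
\<close>

lemma chart_deriv_compose:
  assumes M: "smooth_atlas M" and N: "smooth_atlas N" and f: "smooth M N f"
    and c: "c \<in> atlas M" "fst w \<in> cdom c" and c': "c' \<in> atlas N" "f (fst w) \<in> cdom c'"
    and g: "smooth_fun_at N g (f (fst w))"
  shows "chart_deriv c (\<lambda>m. g (f m)) w =
    (\<Sum>i\<in>cix c'. right_partial i (\<lambda>x. g (cinv c' x)) (cmap c' (f (fst w))) *
      chart_deriv c (\<lambda>m. cmap c' (f m) i) w)"
proof -
  let ?p = "fst w"
  note ch = smooth_atlas_is_chart[OF M c(1)] and ch' = smooth_atlas_is_chart[OF N c'(1)]
  have p: "?p \<in> pts M" using smooth_atlas_cdom_subset[OF M c(1)] c(2) by auto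
  let ?U = "{m \<in> pts M. f m \<in> cdom c'}"
  have U: "openin (mtop M) ?U"
    using smooth_preimage_open[OF f is_chart_cdom_open[OF ch']] .
  let ?S = "cmap c ` (?U \<inter> cdom c)"
  have S: "openin (top_of_set (sector (cix c) (ccor c))) ?S"
    by (rule is_chart_open_image_sector[OF ch U])
  have xS: "cmap c ?p \<in> ?S" using c c' p by auto
  have "right_partial j (\<lambda>x. g (f (cinv c x))) (cmap c ?p) =
      (\<Sum>i\<in>cix c'. right_partial i (\<lambda>x. g (cinv c' x)) (cmap c' (f ?p)) *
        right_partial j (\<lambda>x. cmap c' (f (cinv c x)) i) (cmap c ?p))" if j: "j \<in> cix c" for j
  proof -
    let ?G = "\<lambda>x. cmap c' (f (cinv c x))"
    have "right_partial j (\<lambda>x. g (f (cinv c x))) (cmap c ?p) =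
        right_partial j (\<lambda>x. g (cinv c' (?G x))) (cmap c ?p)"
      by (rule right_partial_cong[OF S xS j]) (auto simp: cinv_cmap[OF ch] cinv_cmap[OF ch'])
    also have "\<dots> = (\<Sum>i\<in>cix c'. right_partial i (\<lambda>x. g (cinv c' x)) (?G (cmap c ?p)) *
        right_partial j (\<lambda>x. ?G x i) (cmap c ?p))"
    proof (rule right_partial_compose[OF is_chart_finite[OF ch'] S xS j is_chart_cimg_open[OF ch'],
          where f = "\<lambda>x. g (cinv c' x)" and g = ?G])
      show "?G \<in> ?S \<rightarrow> cimg c'" by (auto simp: cinv_cmap[OF ch])
      show "smooth_real_at (cix c) ?S (\<lambda>x. ?G x i) (cmap c ?p)" for i
        by (rule smooth_real_at_subset[OF smooth_fun_atD[OF smooth_fun_at_chart_of_map[OF M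
            is_chart_chart_like[OF ch'] f p c'] c]]) auto
      show "smooth_real_at (cix c') (cimg c') (\<lambda>x. g (cinv c' x)) (?G (cmap c ?p))"
        using smooth_fun_atD[OF g c'] by (simp add: cinv_cmap[OF ch c(2)])
    qed
    finally show ?thesis by (simp add: cinv_cmap[OF ch c(2)])
  qed
  then have "chart_deriv c (\<lambda>m. g (f m)) w = (\<Sum>j\<in>cix c. \<Sum>i\<in>cix c'.
      right_partial i (\<lambda>x. g (cinv c' x)) (cmap c' (f ?p)) *
      (right_partial j (\<lambda>x. cmap c' (f (cinv c x)) i) (cmap c ?p) * snd w c j))"
    by (simp add: chart_deriv_def sum_distrib_right mult.assoc)
  also have "\<dots> = (\<Sum>i\<in>cix c'. right_partial i (\<lambda>x. g (cinv c' x)) (cmap c' (f ?p)) *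
      chart_deriv c (\<lambda>m. cmap c' (f m) i) w)"
    unfolding chart_deriv_def sum_distrib_left by (rule sum.swap)
  finally show ?thesis .
qed

text \<open>
  Independence of the chart is the chain rule for the identity map, because the compatibility condition
  on a tangent vector says that its coordinates in \<open>c\<close> are the derivatives of the coordinate functions
  of \<open>c\<close> along it.
\<close>

lemma tangent_deriv_chart:
  assumes M: "smooth_atlas M" and w: "w \<in> tangent_space M p" and c: "c \<in> atlas M" "p \<in> cdom c"
    and g: "smooth_fun_at M g p"
  shows "tangent_deriv M g w = chart_deriv c g w"
proof -
  note wp = tangent_space_fst[OF w]
  define d where "d = (SOME c. c \<in> charts_at M p)"
  have "d \<in> charts_at M p" unfolding d_def by (rule someI[of _ c]) (use c in simp)
  then have d: "d \<in> atlas M" "p \<in> cdom d" by auto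
  have "chart_deriv d g w = (\<Sum>i\<in>cix c. right_partial i (\<lambda>x. g (cinv c x)) (cmap c p) *
      chart_deriv d (\<lambda>m. cmap c m i) w)"
    using chart_deriv_compose[OF M M smooth_id[OF M], of d w c g] c d g wp by simp
  also have "\<dots> = chart_deriv c g w"
    unfolding tangent_space_change[OF w d c] by (simp add: chart_deriv_def wp)
  finally show ?thesis by (simp add: tangent_deriv_def wp d_def)
qed

lemma tangent_deriv_coordinate:
  assumes M: "smooth_atlas M" and w: "w \<in> tangent_space M p" and c: "c \<in> atlas M" "p \<in> cdom c"
  shows "tangent_deriv M (\<lambda>m. cmap c m i) w = snd w c i"
  using tangent_deriv_chart[OF M w c smooth_fun_at_coordinate[OF M c]] tangent_space_change[OF w c c]
  by simp

context
  fixes M :: "('p, 'c) mfd" and w :: "('p, 'c) tvec" and p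
  assumes M: "smooth_atlas M" and p: "p \<in> pts M" and wp: "fst w = p"
begin

lemma some_chart_at: "(SOME c. c \<in> charts_at M p) \<in> atlas M" "p \<in> cdom (SOME c. c \<in> charts_at M p)"
proof -
  have "\<exists>c. c \<in> charts_at M p" using smooth_atlas_chart_exists[OF M p] by auto
  then have "(SOME c. c \<in> charts_at M p) \<in> charts_at M p" by (rule someI_ex)
  then show "(SOME c. c \<in> charts_at M p) \<in> atlas M" "p \<in> cdom (SOME c. c \<in> charts_at M p)" by auto
qed

lemma tangent_deriv_local:
  assumes "openin (mtop M) U" "p \<in> U" "\<And>m. m \<in> U \<Longrightarrow> g m = h m"
  shows "tangent_deriv M g w = tangent_deriv M h w"
  unfolding tangent_deriv_def wp
  using assms some_chart_at wp by (intro chart_deriv_local[OF M]) auto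

lemma tangent_map_cong:
  assumes eq: "\<And>m. m \<in> pts M \<Longrightarrow> f m = g m"
  shows "tangent_map M N f w = tangent_map M N g w"
proof (rule prod_eqI)
  show "snd (tangent_map M N f w) = snd (tangent_map M N g w)"
  proof (intro ext)
    show "snd (tangent_map M N f w) c i = snd (tangent_map M N g w) c i" for c i
    proof (cases "c \<in> atlas N \<and> f p \<in> cdom c")
      case True
      then show ?thesis
        using eq p wp by (auto simp: tangent_map_snd intro!: tangent_deriv_local[OF openin_topspace])
    next
      case False
      then show ?thesis
        using eq[OF p] wp tangent_map_off[of c N f w M] tangent_map_off[of c N g w M] by simp
    qed
  qed
qed (simp add: wp eq p)

end

lemma tangent_deriv_const: "tangent_deriv M (\<lambda>m. r) w = 0"
  by (simp add: tangent_deriv_def chart_deriv_const)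

text \<open>
  The coordinates of the image in two charts are derivatives of two sets of coordinate functions; the
  chain rule relates them by the Jacobian of the change of coordinates.
\<close>

lemma tangent_map_in_tangent_space:
  assumes M: "smooth_atlas M" and N: "smooth_atlas N" and f: "smooth M N f"
    and p: "p \<in> pts M" and w: "w \<in> tangent_space M p"
  shows "tangent_map M N f w \<in> tangent_space N (f p)"
proof (rule tangent_spaceI)
  note wp = tangent_space_fst[OF w]
  show "fst (tangent_map M N f w) = f p" by (simp add: wp)
  show "snd (tangent_map M N f w) c = (\<lambda>_. 0)" if "\<not> (c \<in> atlas N \<and> f p \<in> cdom c)" for c
    using tangent_map_off that wp by metis
  fix c assume c: "c \<in> atlas N" "f p \<in> cdom c"
  note ch = smooth_atlas_is_chart[OF N c(1)]
  show "snd (tangent_map M N f w) c \<in> coords (cix c)"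
    unfolding in_coords_iff
  proof (intro allI impI)
    fix i assume i: "i \<notin> cix c"
    have "tangent_deriv M (\<lambda>m. cmap c (f m) i) w = tangent_deriv M (\<lambda>m. 0) w"
      using is_chart_cmap_coords[OF ch] i p c
      by (intro tangent_deriv_local[OF M p wp smooth_preimage_open[OF f is_chart_cdom_open[OF ch]]])
        (auto simp: in_coords_iff)
    then show "snd (tangent_map M N f w) c i = 0"
      using c wp by (simp add: tangent_map_snd tangent_deriv_const)
  qed
  fix c' i assume c': "c' \<in> atlas N" "f p \<in> cdom c'"
  define d where "d = (SOME c. c \<in> charts_at M p)"
  have d: "d \<in> atlas M" "fst w \<in> cdom d"
    using some_chart_at[OF M p] unfolding d_def wp by auto
  show "snd (tangent_map M N f w) c' i = chart_deriv c (\<lambda>m. cmap c' m i) (tangent_map M N f w)"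
    using chart_deriv_compose[OF M N f d, of c "\<lambda>m. cmap c' m i"] c c' wp
    by (simp add: tangent_map_snd tangent_deriv_def d_def[symmetric] smooth_fun_at_coordinate[OF N]
        chart_deriv_def[of c] del: charts_at_iff)
qed

lemma tangent_deriv_compose:
  assumes M: "smooth_atlas M" and N: "smooth_atlas N" and f: "smooth M N f"
    and p: "p \<in> pts M" and w: "w \<in> tangent_space M p" and g: "smooth_fun_at N g (f p)"
  shows "tangent_deriv M (\<lambda>m. g (f m)) w = tangent_deriv N g (tangent_map M N f w)"
proof -
  note wp = tangent_space_fst[OF w]
  obtain c where c: "c \<in> atlas N" "f p \<in> cdom c"
    using smooth_atlas_chart_exists[OF N smooth_maps_to[OF f p]] .
  define d where "d = (SOME c. c \<in> charts_at M p)"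
  have d: "d \<in> atlas M" "fst w \<in> cdom d"
    using some_chart_at[OF M p] unfolding d_def wp by auto
  have "tangent_deriv N g (tangent_map M N f w) = chart_deriv c g (tangent_map M N f w)"
    by (rule tangent_deriv_chart[OF N tangent_map_in_tangent_space[OF M N f p w] c g])
  also have "\<dots> = tangent_deriv M (\<lambda>m. g (f m)) w"
    using chart_deriv_compose[OF M N f d, of c g] c g wp
    by (simp add: tangent_map_snd tangent_deriv_def d_def[symmetric] chart_deriv_def[of c] del: charts_at_iff)
  finally show ?thesis by simp
qed

lemma tangent_map_compose:
  assumes M: "smooth_atlas M" and N: "smooth_atlas N" and L: "smooth_atlas L"
    and f: "smooth M N f" and g: "smooth N L g"
    and p: "p \<in> pts M" and w: "w \<in> tangent_space M p"
  shows "tangent_map M L (\<lambda>m. g (f m)) w = tangent_map N L g (tangent_map M N f w)"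
proof (rule tangent_vector_eqI)
  note wp = tangent_space_fst[OF w]
  show "tangent_map M L (\<lambda>m. g (f m)) w \<in> tangent_space L (g (f p))"
    by (intro tangent_map_in_tangent_space[OF M L _ p w] smooth_compose[OF M N _ f g]
        smooth_atlas_chart_like[OF L])
  show "tangent_map N L g (tangent_map M N f w) \<in> tangent_space L (g (f p))"
    by (intro tangent_map_in_tangent_space[OF N L g] tangent_map_in_tangent_space[OF M N f p w]
        smooth_maps_to[OF f p])
  fix c i assume c: "c \<in> atlas L" "g (f p) \<in> cdom c"
  have "smooth_fun_at N (\<lambda>n. cmap c (g n) i) (f p)"
    by (rule smooth_fun_at_chart_of_map[OF N smooth_atlas_chart_like[OF L c(1)] g smooth_maps_to[OF f p] c])
  from tangent_deriv_compose[OF M N f p w this]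
  show "snd (tangent_map M L (\<lambda>m. g (f m)) w) c i = snd (tangent_map N L g (tangent_map M N f w)) c i"
    using c wp by (simp add: tangent_map_snd)
qed

lemma tangent_map_id:
  assumes M: "smooth_atlas M" and p: "p \<in> pts M" and w: "w \<in> tangent_space M p"
  shows "tangent_map M M (\<lambda>m. m) w = w"
proof (rule tangent_vector_eqI[OF tangent_map_in_tangent_space[OF M M smooth_id[OF M] p w] w])
  fix c i assume c: "c \<in> atlas M" "p \<in> cdom c"
  show "snd (tangent_map M M (\<lambda>m. m) w) c i = snd w c i"
    using c tangent_space_fst[OF w] tangent_deriv_coordinate[OF M w c] by (simp add: tangent_map_snd)
qed

subsection \<open>Linear structure\<close>

lemma chart_deriv_tadd:
  "fst w = fst w' \<Longrightarrow> chart_deriv c g (tadd w w') = chart_deriv c g w + chart_deriv c g w'"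
  by (simp add: chart_deriv_def tadd_def algebra_simps sum.distrib)

lemma chart_deriv_tscale: "chart_deriv c g (tscale r w) = r * chart_deriv c g w"
  by (simp add: chart_deriv_def tscale_def sum_distrib_left mult.left_commute)

lemma chart_deriv_tzero: "chart_deriv c g (tzero p) = 0"
  by (simp add: chart_deriv_def tzero_def)

lemma tadd_simps [simp]: "fst (tadd w w') = fst w" "snd (tadd w w') c j = snd w c j + snd w' c j"
  by (simp_all add: tadd_def)

lemma tscale_simps [simp]: "fst (tscale r w) = fst w" "snd (tscale r w) c j = r * snd w c j"
  by (simp_all add: tscale_def)

lemma tzero_simps [simp]: "fst (tzero p) = p" "snd (tzero p) c j = 0"
  by (simp_all add: tzero_def)

lemma tangent_space_tadd:
  assumes w: "w \<in> tangent_space M p" and w': "w' \<in> tangent_space M p"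
  shows "tadd w w' \<in> tangent_space M p"
proof (rule tangent_spaceI)
  note f = tangent_space_fst[OF w] tangent_space_fst[OF w']
  show "fst (tadd w w') = p" by (simp add: f)
  show "snd (tadd w w') c = (\<lambda>_. 0)" if "\<not> (c \<in> atlas M \<and> p \<in> cdom c)" for c
    using tangent_space_off[OF w that] tangent_space_off[OF w' that] by (simp add: fun_eq_iff)
  show "snd (tadd w w') c \<in> coords (cix c)" if "c \<in> atlas M" "p \<in> cdom c" for c
    using tangent_space_coords[OF w that] tangent_space_coords[OF w' that] by (simp add: in_coords_iff)
  show "snd (tadd w w') c' i = chart_deriv c (\<lambda>m. cmap c' m i) (tadd w w')"
    if "c \<in> atlas M" "p \<in> cdom c" "c' \<in> atlas M" "p \<in> cdom c'" for c c' i
    using tangent_space_change[OF w that] tangent_space_change[OF w' that] f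
    by (simp add: chart_deriv_tadd)
qed

lemma tangent_space_tscale:
  assumes w: "w \<in> tangent_space M p"
  shows "tscale r w \<in> tangent_space M p"
proof (rule tangent_spaceI)
  show "fst (tscale r w) = p" by (simp add: tangent_space_fst[OF w])
  show "snd (tscale r w) c = (\<lambda>_. 0)" if "\<not> (c \<in> atlas M \<and> p \<in> cdom c)" for c
    using tangent_space_off[OF w that] by (simp add: fun_eq_iff)
  show "snd (tscale r w) c \<in> coords (cix c)" if "c \<in> atlas M" "p \<in> cdom c" for c
    using tangent_space_coords[OF w that] by (simp add: in_coords_iff)
  show "snd (tscale r w) c' i = chart_deriv c (\<lambda>m. cmap c' m i) (tscale r w)"
    if "c \<in> atlas M" "p \<in> cdom c" "c' \<in> atlas M" "p \<in> cdom c'" for c c' i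
    using tangent_space_change[OF w that] by (simp add: chart_deriv_tscale)
qed

lemma tangent_space_tzero: "tzero p \<in> tangent_space M p"
  by (rule tangent_spaceI) (auto simp: chart_deriv_tzero in_coords_iff)

lemma tangent_map_tadd:
  "fst w = fst w' \<Longrightarrow> tangent_map M N f (tadd w w') = tadd (tangent_map M N f w) (tangent_map M N f w')"
  by (auto simp: tangent_map_def differential_def Let_def tadd_def algebra_simps sum.distrib)

lemma tangent_map_tscale: "tangent_map M N f (tscale r w) = tscale r (tangent_map M N f w)"
  by (auto simp: tangent_map_def differential_def Let_def tscale_def sum_distrib_left mult.left_commute)

lemma tangent_map_tzero: "tangent_map M N f (tzero p) = tzero (f p)"
  by (auto simp: tangent_map_def differential_def Let_def tzero_def)

subsection \<open>Smooth maps into tangent bundles\<close>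

lemma tchart_cdom_iff: "w \<in> cdom (tchart M c) \<longleftrightarrow> fst w \<in> cdom c \<and> w \<in> tangent_space M (fst w)"
  using tangent_space_fst by (fastforce simp: tchart_def)

lemma pts_tangent_bundle_iff:
  assumes M: "smooth_atlas M"
  shows "w \<in> pts (tangent_bundle M) \<longleftrightarrow> fst w \<in> pts M \<and> w \<in> tangent_space M (fst w)"
proof -
  have "w \<in> pts (tangent_bundle M) \<longleftrightarrow> (\<exists>c\<in>atlas M. w \<in> cdom (tchart M c))"
    by (auto simp: tangent_bundle_def)
  also have "\<dots> \<longleftrightarrow> fst w \<in> pts M \<and> w \<in> tangent_space M (fst w)"
    using M by (auto simp: tchart_cdom_iff smooth_atlas_def)
  finally show ?thesis .
qed

lemma in_pts_tangent_bundle: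
  "smooth_atlas M \<Longrightarrow> p \<in> pts M \<Longrightarrow> w \<in> tangent_space M p \<Longrightarrow> w \<in> pts (tangent_bundle M)"
  using tangent_space_fst[of w M p] by (simp add: pts_tangent_bundle_iff)

lemma chart_like_tangent_bundle:
  assumes M: "smooth_atlas M" and c: "c \<in> atlas (tangent_bundle M)"
  shows "chart_like (mtop (tangent_bundle M)) c"
proof -
  obtain d where d: "d \<in> atlas M" "c = tchart M d"
    using c by (auto simp: tangent_bundle_def)
  note ch = smooth_atlas_is_chart[OF M d(1)]
  have "openin (mtop (tangent_bundle M)) (cdom (tchart M d))"
    unfolding tangent_bundle_def mfd.simps
    by (rule topology_generated_by_Basis) (use d in \<open>auto intro!: exI[of _ d] exI[of _ UNIV]\<close>)
  moreover have "cmap (tchart M d) w \<in> coords (cix (tchart M d))" if "w \<in> cdom (tchart M d)" for w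
    using that is_chart_cmap_coords[OF ch, of "fst w"] tangent_space_coords[of w M "fst w" d] d(1)
    unfolding tchart_cdom_iff
    by (auto simp: tchart_def in_coords_iff split: sum.splits prod.splits)
  ultimately show ?thesis
    using is_chart_finite[OF ch] d(2) by (auto simp: chart_like_def tchart_def)
qed

lemma smooth_into_tangent_bundleD:
  assumes M: "smooth_atlas M" and N: "smooth_atlas N" and F: "smooth M (tangent_bundle N) F"
    and q: "q \<in> pts M" and Fq: "F q \<in> tangent_space N p" and c: "c \<in> atlas N" "p \<in> cdom c"
  shows "smooth_fun_at M (\<lambda>m. snd (F m) c i) q"
proof -
  have tc: "tchart N c \<in> atlas (tangent_bundle N)"
    using c by (simp add: tangent_bundle_def)
  have "smooth_fun_at M (\<lambda>m. cmap (tchart N c) (F m) (Inr i)) q"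
    using Fq tangent_space_fst[OF Fq] c
    by (intro smooth_fun_at_chart_of_map[OF M chart_like_tangent_bundle[OF N tc] F q tc])
      (simp add: tchart_cdom_iff)
  then show ?thesis by (simp add: tchart_def split_beta)
qed

text \<open>
  Over a smooth base map only the fibre coordinates have to be checked; continuity holds because the
  topology of the tangent bundle is generated by its charts.
\<close>

lemma smooth_into_tangent_bundleI:
  assumes M: "smooth_atlas M" and N: "smooth_atlas N" and \<pi>: "smooth M N \<pi>"
    and FT: "\<And>q. q \<in> pts M \<Longrightarrow> F q \<in> tangent_space N (\<pi> q)"
    and F: "\<And>q c i. q \<in> pts M \<Longrightarrow> c \<in> atlas N \<Longrightarrow> \<pi> q \<in> cdom c \<Longrightarrow> i \<in> cix c \<Longrightarrow>
      smooth_fun_at M (\<lambda>m. snd (F m) c i) q"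
  shows "smooth M (tangent_bundle N) F"
proof -
  let ?B = "\<lambda>c. {q \<in> pts M. \<pi> q \<in> cdom c}"
  have B: "openin (mtop M) (?B c)" if "c \<in> atlas N" for c
    using smooth_preimage_open[OF \<pi> is_chart_cdom_open[OF smooth_atlas_is_chart[OF N that]]] .
  have Ffst: "fst (F q) = \<pi> q" if "q \<in> pts M" for q
    using tangent_space_fst[OF FT[OF that]] .
  have Fdom: "F q \<in> cdom (tchart N c) \<longleftrightarrow> \<pi> q \<in> cdom c" if "q \<in> pts M" for q c
    using FT[OF that] Ffst[OF that] by (simp add: tchart_cdom_iff)
  have Fmap: "cmap (tchart N c) (F q) = case_sum (cmap c (\<pi> q)) (snd (F q) c)" if "q \<in> pts M" for q c
    using Ffst[OF that] by (simp add: tchart_def split_beta)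
  have coord: "smooth_fun_at M (\<lambda>m. case_sum (cmap c (\<pi> m)) (snd (F m) c) k) q"
    if q: "q \<in> pts M" and c: "c \<in> atlas N" "\<pi> q \<in> cdom c" for q c k
  proof (cases k)
    case (Inl i)
    then show ?thesis
      using smooth_fun_at_chart_of_map[OF M smooth_atlas_chart_like[OF N c(1)] \<pi> q c] by simp
  next
    case (Inr i)
    show ?thesis
    proof (cases "i \<in> cix c")
      case True
      then show ?thesis using F[OF q c] Inr by simp
    next
      case False
      have "snd (F m) c i = 0" if "m \<in> ?B c" for m
        using that tangent_space_coords[OF FT c(1), of m] False by (auto simp: in_coords_iff)
      then show ?thesis
        using q c Inr by (intro smooth_fun_at_local[OF M B[OF c(1)] _ smooth_fun_at_const[OF M, of 0]]) auto
    qed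
  qed
  show ?thesis
  proof (rule smoothI[OF M chart_like_tangent_bundle[OF N]])
    show "continuous_map (mtop M) (mtop (tangent_bundle N)) F"
      unfolding tangent_bundle_def mfd.simps continuous_on_generated_topo_iff
    proof (intro conjI allI impI)
      fix U assume "U \<in> {{w \<in> cdom (tchart N c). cmap (tchart N c) w \<in> W} | c W. c \<in> atlas N \<and> open W}"
      then obtain c W where c: "c \<in> atlas N" and W: "open W"
        and U: "U = {w \<in> cdom (tchart N c). cmap (tchart N c) w \<in> W}" by auto
      have Bsub: "?B c \<subseteq> pts M" by auto
      have "continuous_map (subtopology (mtop M) (?B c)) euclideanreal
          (\<lambda>m. case_sum (cmap c (\<pi> m)) (snd (F m) c) k)" for k
        using coord[OF _ c] by (intro continuous_map_if_smooth_fun_at[OF M B[OF c]]) auto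
      then have "continuous_map (subtopology (mtop M) (?B c)) euclidean
          (\<lambda>m. case_sum (cmap c (\<pi> m)) (snd (F m) c))"
        by (simp add: euclidean_product_topology[symmetric] continuous_map_componentwise_UNIV)
      from openin_continuous_map_preimage[OF this, of W] W
      have "openin (subtopology (mtop M) (?B c))
          {m \<in> ?B c. case_sum (cmap c (\<pi> m)) (snd (F m) c) \<in> W}"
        using Bsub by (simp add: topspace_subtopology Int_absorb1)
      then have "openin (mtop M) {m \<in> ?B c. case_sum (cmap c (\<pi> m)) (snd (F m) c) \<in> W}"
        using B[OF c] openin_trans_full by blast
      also have "{m \<in> ?B c. case_sum (cmap c (\<pi> m)) (snd (F m) c) \<in> W} = F -` U \<inter> pts M"
        using Fdom Fmap by (auto simp: U)
      finally show "openin (mtop M) (F -` U \<inter> pts M)" .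
    next
      have "F ` pts M \<subseteq> pts (tangent_bundle N)"
        using in_pts_tangent_bundle[OF N smooth_maps_to[OF \<pi>] FT] by auto
      then show "F ` pts M \<subseteq> \<Union> {{w \<in> cdom (tchart N c). cmap (tchart N c) w \<in> W} | c W. c \<in> atlas N \<and> open W}"
        by (simp add: tangent_bundle_def)
    qed
    fix q c' i assume q: "q \<in> pts M" and c': "c' \<in> atlas (tangent_bundle N)" "F q \<in> cdom c'"
    obtain c where c: "c \<in> atlas N" "c' = tchart N c" using c' by (auto simp: tangent_bundle_def)
    have "\<pi> q \<in> cdom c" using c' Fdom[OF q] c by simp
    from coord[OF q c(1) this]
    show "smooth_fun_at M (\<lambda>m. cmap c' (F m) i) q"
      by (rule smooth_fun_at_local[OF M openin_topspace q]) (simp add: c Fmap)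
  qed
qed


section \<open>Finite products\<close>

lemma prod_chart_simps [simp]:
  "cix (prod_chart X c) = (SIGMA x:X. cix (c x))"
  "ccor (prod_chart X c) = (SIGMA x:X. ccor (c x))"
  "cdom (prod_chart X c) = (\<Pi>\<^sub>E x\<in>X. cdom (c x))"
  "cmap (prod_chart X c) p (x, j) = (if x \<in> X then cmap (c x) (p x) j else 0)"
  by (simp_all add: prod_chart_def)

context
  fixes X :: "'i set" and T :: "'i \<Rightarrow> 'p topology" and c :: "'i \<Rightarrow> ('p, 'c) chart"
  assumes X: "finite X" and c: "\<And>x. x \<in> X \<Longrightarrow> is_chart (T x) (c x)"
begin

lemma cimg_prod_chart:
  "cimg (prod_chart X c) = {z \<in> coords (SIGMA x:X. cix (c x)). \<forall>x\<in>X. (\<lambda>j. z (x, j)) \<in> cimg (c x)}"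
proof (intro equalityI subsetI)
  fix z assume "z \<in> cimg (prod_chart X c)"
  then obtain p where p: "p \<in> (\<Pi>\<^sub>E x\<in>X. cdom (c x))" "z = cmap (prod_chart X c) p" by auto
  have "cmap (c x) (p x) \<in> coords (cix (c x))" if "x \<in> X" for x
    using is_chart_cmap_coords[OF c[OF that]] p that by auto
  then have "z \<in> coords (SIGMA x:X. cix (c x))"
    by (auto simp: in_coords_iff p(2))
  then show "z \<in> {z \<in> coords (SIGMA x:X. cix (c x)). \<forall>x\<in>X. (\<lambda>j. z (x, j)) \<in> cimg (c x)}"
    using p by auto
next
  fix z assume z: "z \<in> {z \<in> coords (SIGMA x:X. cix (c x)). \<forall>x\<in>X. (\<lambda>j. z (x, j)) \<in> cimg (c x)}"
  have *: "cmap (prod_chart X c) (\<lambda>x\<in>X. cinv (c x) (\<lambda>j. z (x, j))) = z"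
  proof
    fix k show "cmap (prod_chart X c) (\<lambda>x\<in>X. cinv (c x) (\<lambda>j. z (x, j))) k = z k"
      using z by (cases k) (auto simp: cmap_cinv in_coords_iff)
  qed
  have "(\<lambda>x\<in>X. cinv (c x) (\<lambda>j. z (x, j))) \<in> cdom (prod_chart X c)"
    using z by (auto intro!: cinv_in_cdom)
  from imageI[OF this, of "cmap (prod_chart X c)"]
  show "z \<in> cimg (prod_chart X c)" unfolding * .
qed

lemma continuous_on_slice: "continuous_on A (\<lambda>z. (\<lambda>j. z (x, j)))"
  by (rule continuous_on_coordinatewise_then_product) (rule continuous_on_fun_coordinate)

lemma cimg_prod_chart_open:
  "openin (top_of_set (sector (SIGMA x:X. cix (c x)) (SIGMA x:X. ccor (c x)))) (cimg (prod_chart X c))"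
proof -
  let ?S = "sector (SIGMA x:X. cix (c x)) (SIGMA x:X. ccor (c x))"
  have "\<forall>x\<in>X. \<exists>B. open B \<and> cimg (c x) = sector (cix (c x)) (ccor (c x)) \<inter> B"
    using is_chart_cimg_open[OF c] by (auto simp: openin_open)
  from bchoice[OF this] obtain B where
    B: "\<And>x. x \<in> X \<Longrightarrow> open (B x)" "\<And>x. x \<in> X \<Longrightarrow> cimg (c x) = sector (cix (c x)) (ccor (c x)) \<inter> B x"
    by blast
  have "open ((\<lambda>z. (\<lambda>j. z (x, j))) -` B x)" if "x \<in> X" for x
    by (intro open_vimage B(1)[OF that] continuous_on_slice)
  then have "open (\<Inter>x\<in>X. (\<lambda>z. (\<lambda>j. z (x, j))) -` B x)"
    using X by (intro open_INT) auto
  moreover have "cimg (prod_chart X c) = ?S \<inter> (\<Inter>x\<in>X. (\<lambda>z. (\<lambda>j. z (x, j))) -` B x)"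
    unfolding cimg_prod_chart using B(2) by (fastforce simp: sector_def in_coords_iff)
  ultimately show ?thesis by (auto simp: openin_open)
qed

text \<open>
  The inverse of a product chart applies the inverses of the factors to the slices \<open>\<lambda>j. z (x, j)\<close>.
\<close>

lemma is_chart_prod_chart: "is_chart (product_topology T X) (prod_chart X c)"
proof (rule is_chartI)
  have sub: "ccor (c x) \<subseteq> cix (c x)" if "x \<in> X" for x
    using c[OF that] by (simp add: is_chart_def)
  show "finite (cix (prod_chart X c))" using X is_chart_finite[OF c] by simp
  show "ccor (prod_chart X c) \<subseteq> cix (prod_chart X c)" using sub by auto
  show "openin (product_topology T X) (cdom (prod_chart X c))"
    using is_chart_cdom_open[OF c] X by (simp add: openin_PiE)
  show "openin (top_of_set (sector (cix (prod_chart X c)) (ccor (prod_chart X c)))) (cimg (prod_chart X c))"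
    using cimg_prod_chart_open by simp
  have "continuous_map (product_topology (\<lambda>x. subtopology (T x) (cdom (c x))) X) euclideanreal
      (\<lambda>p. cmap (prod_chart X c) p k)" for k
  proof (cases k)
    case (Pair x j)
    show ?thesis
    proof (cases "x \<in> X")
      case True
      have "continuous_map (subtopology (T x) (cdom (c x))) euclideanreal (\<lambda>m. cmap (c x) m j)"
        using is_chart_cmap_continuous[OF c[OF True]]
        by (simp add: euclidean_product_topology[symmetric] continuous_map_componentwise_UNIV)
      from continuous_map_compose[OF continuous_map_product_projection[OF True, of "\<lambda>x. subtopology (T x) (cdom (c x))"] this]
      show ?thesis using True Pair by (simp add: o_def)
    qed (simp add: Pair)
  qed
  then show "continuous_map (subtopology (product_topology T X) (cdom (prod_chart X c))) euclidean (cmap (prod_chart X c))"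
    by (simp add: euclidean_product_topology[symmetric] continuous_map_componentwise_UNIV subtopology_product_topology)
  show "continuous_map (top_of_set (cimg (prod_chart X c))) (subtopology (product_topology T X) (cdom (prod_chart X c)))
      (\<lambda>z. \<lambda>x\<in>X. cinv (c x) (\<lambda>j. z (x, j)))"
  proof -
    have "continuous_map (top_of_set (cimg (prod_chart X c))) (subtopology (T x) (cdom (c x)))
        (\<lambda>z. cinv (c x) (\<lambda>j. z (x, j)))" if "x \<in> X" for x
    proof -
      have "continuous_map (top_of_set (cimg (prod_chart X c))) (top_of_set (cimg (c x))) (\<lambda>z. (\<lambda>j. z (x, j)))"
        using continuous_on_slice cimg_prod_chart that
        by (auto simp: continuous_map_in_subtopology)
      from continuous_map_compose[OF this is_chart_cinv_continuous[OF c[OF that]]]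
      show ?thesis by (simp add: o_def)
    qed
    then show ?thesis
      by (auto simp: subtopology_product_topology continuous_map_componentwise)
  qed
  show "(\<lambda>x\<in>X. cinv (c x) (\<lambda>j. cmap (prod_chart X c) p (x, j))) = p" if "p \<in> cdom (prod_chart X c)" for p
    using that by (intro extensionalityI[of _ X]) (auto simp: PiE_iff cinv_cmap[OF c])
qed

lemma cinv_prod_chart:
  assumes z: "z \<in> cimg (prod_chart X c)"
  shows "cinv (prod_chart X c) z = (\<lambda>x\<in>X. cinv (c x) (\<lambda>j. z (x, j)))"
proof -
  obtain p where p: "p \<in> (\<Pi>\<^sub>E x\<in>X. cdom (c x))" "z = cmap (prod_chart X c) p" using z by auto
  have "cinv (prod_chart X c) z = p"
    using p by (intro cinv_unique[OF is_chart_prod_chart]) auto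
  also have "p = (\<lambda>x\<in>X. cinv (c x) (\<lambda>j. z (x, j)))"
    using p by (intro extensionalityI[of _ X]) (auto simp: PiE_iff cinv_cmap[OF c])
  finally show ?thesis .
qed

end

lemma mfd_prod_simps [simp]:
  "pts (mfd_prod X M) = (\<Pi>\<^sub>E x\<in>X. pts (M x))"
  "mtop (mfd_prod X M) = product_topology (\<lambda>x. mtop (M x)) X"
  "atlas (mfd_prod X M) = prod_chart X ` (\<Pi>\<^sub>E x\<in>X. atlas (M x))"
  by (simp_all add: mfd_prod_def)

context
  fixes X :: "'i set" and M :: "'i \<Rightarrow> ('p, 'c) mfd"
  assumes X: "finite X" and M: "\<And>x. x \<in> X \<Longrightarrow> smooth_atlas (M x)"
begin

lemma prod_chart_is_chart:
  "c \<in> (\<Pi>\<^sub>E x\<in>X. atlas (M x)) \<Longrightarrow> x \<in> X \<Longrightarrow> is_chart (mtop (M x)) (c x)"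
  using smooth_atlas_is_chart[OF M] by auto

lemma prod_chart_exists:
  assumes p: "p \<in> (\<Pi>\<^sub>E x\<in>X. pts (M x))"
  obtains c where "c \<in> (\<Pi>\<^sub>E x\<in>X. atlas (M x))" "p \<in> (\<Pi>\<^sub>E x\<in>X. cdom (c x))"
proof -
  have "\<forall>x\<in>X. \<exists>c. c \<in> atlas (M x) \<and> p x \<in> cdom c"
    using p smooth_atlas_chart_exists[OF M] by blast
  from bchoice[OF this] obtain c where c: "\<forall>x\<in>X. c x \<in> atlas (M x) \<and> p x \<in> cdom (c x)" by blast
  show thesis
    by (rule that[of "restrict c X"]) (use c p in auto)
qed

lemma prod_chart_exists_extending:
  assumes p: "p \<in> (\<Pi>\<^sub>E x\<in>X. pts (M x))" and x: "x \<in> X" and c': "c' \<in> atlas (M x)" "p x \<in> cdom c'"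
  obtains c where "c \<in> (\<Pi>\<^sub>E x\<in>X. atlas (M x))" "p \<in> (\<Pi>\<^sub>E x\<in>X. cdom (c x))" "c x = c'"
proof -
  obtain d where d: "d \<in> (\<Pi>\<^sub>E x\<in>X. atlas (M x))" "p \<in> (\<Pi>\<^sub>E x\<in>X. cdom (d x))"
    using prod_chart_exists[OF p] .
  show thesis
    by (rule that[of "d(x := c')"]) (use d p x c' in \<open>auto simp: PiE_iff extensional_def\<close>)
qed

lemma smooth_atlas_mfd_prod: "smooth_atlas (mfd_prod X M)"
  unfolding smooth_atlas_def
proof (intro conjI ballI)
  fix C assume "C \<in> atlas (mfd_prod X M)"
  then obtain c where c: "c \<in> (\<Pi>\<^sub>E x\<in>X. atlas (M x))" and C: "C = prod_chart X c" by auto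
  show "is_chart (mtop (mfd_prod X M)) C"
    unfolding C using is_chart_prod_chart[OF X prod_chart_is_chart[OF c]] by simp
  fix C' assume "C' \<in> atlas (mfd_prod X M)"
  then obtain c' where c': "c' \<in> (\<Pi>\<^sub>E x\<in>X. atlas (M x))" and C': "C' = prod_chart X c'" by auto
  note ch = prod_chart_is_chart[OF c] and ch' = prod_chart_is_chart[OF c']
  have CH: "is_chart (product_topology (\<lambda>x. mtop (M x)) X) (prod_chart X c)"
    and CH': "is_chart (product_topology (\<lambda>x. mtop (M x)) X) (prod_chart X c')"
    by (auto intro!: is_chart_prod_chart[OF X] ch ch')
  let ?S = "cmap C ` (cdom C \<inter> cdom C')"
  have Sc: "?S \<subseteq> coords (cix C)" using is_chart_cimg_subset[OF CH] C by auto
  show "smooth_ext (cix C) ?S (cix C') (cmap C' \<circ> cinv C)"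
  proof (rule smooth_ext_if_smooth_real_at[OF _ Sc])
    show "finite (cix C')" using is_chart_finite[OF CH'] C' by simp
    show "cmap C' \<circ> cinv C \<in> ?S \<rightarrow> coords (cix C')"
      using is_chart_cmap_coords[OF CH'] C C' cinv_cmap[OF CH] by auto
    fix z k assume z: "z \<in> ?S" and k: "k \<in> cix C'"
    then obtain x j where xj: "k = (x, j)" "x \<in> X" "j \<in> cix (c' x)" by (auto simp: C')
    let ?A = "cmap (c x) ` (cdom (c x) \<inter> cdom (c' x))"
    have sl: "(\<lambda>j. y (x, j)) \<in> ?A" if "y \<in> ?S" for y
      using that xj(2) by (auto simp: C C' intro!: imageI)
    have tr: "smooth_ext (cix (c x)) ?A (cix (c' x)) (cmap (c' x) \<circ> cinv (c x))"
      using M[OF xj(2)] PiE_mem[OF c xj(2)] PiE_mem[OF c' xj(2)] unfolding smooth_atlas_def by blast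
    have *: "smooth_real_at (cix C) ?S (\<lambda>z. cmap (c' x) (cinv (c x) (\<lambda>j. z (x, j))) j) z"
    proof (rule smooth_real_at_compose[where J' = "cix (c x)" and S' = ?A and f = "\<lambda>y. cmap (c' x) (cinv (c x) y) j"
          and g = "\<lambda>z. (\<lambda>j. z (x, j))"])
      show "finite (cix (c x))" using is_chart_finite[OF ch[OF xj(2)]] .
      show "?A \<subseteq> coords (cix (c x))" using is_chart_cimg_subset[OF ch[OF xj(2)]] by auto
      show "smooth_real_at (cix C) ?S (\<lambda>z. z (x, i)) z" for i
        by (rule smooth_real_at_coordinate) (use z Sc in blast)
      show "smooth_real_at (cix (c x)) ?A (\<lambda>y. cmap (c' x) (cinv (c x) y) j) (\<lambda>j. z (x, j))"
        using smooth_real_at_smooth_ext[OF tr sl[OF z] xj(3)] by simp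
    qed (use Sc z sl in auto)
    have "(cmap C' \<circ> cinv C) y k = cmap (c' x) (cinv (c x) (\<lambda>j. y (x, j))) j" if "y \<in> ?S" for y
      using that cinv_prod_chart[OF X ch] xj by (auto simp: C C')
    then show "smooth_real_at (cix C) ?S (\<lambda>y. (cmap C' \<circ> cinv C) y k) z"
      by (rule smooth_real_at_local[OF openin_subtopology_self z *])
  qed
next
  show "(\<Union>C\<in>atlas (mfd_prod X M). cdom C) = pts (mfd_prod X M)"
  proof (intro equalityI subsetI)
    fix p assume "p \<in> (\<Union>C\<in>atlas (mfd_prod X M). cdom C)"
    then show "p \<in> pts (mfd_prod X M)"
      using smooth_atlas_cdom_subset[OF M] unfolding mfd_prod_simps PiE_iff prod_chart_simps by (auto simp: PiE_iff) blast
  next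
    fix p assume "p \<in> pts (mfd_prod X M)"
    then have "p \<in> (\<Pi>\<^sub>E x\<in>X. pts (M x))" by simp
    then obtain c where "c \<in> (\<Pi>\<^sub>E x\<in>X. atlas (M x))" "p \<in> (\<Pi>\<^sub>E x\<in>X. cdom (c x))"
      by (rule prod_chart_exists)
    then show "p \<in> (\<Union>C\<in>atlas (mfd_prod X M). cdom C)"
      by (intro UN_I[of "prod_chart X c"]) auto
  qed
qed

lemma smooth_projection:
  assumes x: "x \<in> X"
  shows "smooth (mfd_prod X M) (M x) (\<lambda>p. p x)"
proof (rule smoothI[OF smooth_atlas_mfd_prod smooth_atlas_chart_like[OF M[OF x]]])
  show "continuous_map (mtop (mfd_prod X M)) (mtop (M x)) (\<lambda>p. p x)"
    using continuous_map_product_projection[OF x, of "\<lambda>x. mtop (M x)"] by simp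
  fix p c' i assume p: "p \<in> pts (mfd_prod X M)" and c': "c' \<in> atlas (M x)" "p x \<in> cdom c'"
  then obtain c where c: "c \<in> (\<Pi>\<^sub>E x\<in>X. atlas (M x))" "p \<in> (\<Pi>\<^sub>E x\<in>X. cdom (c x))" "c x = c'"
    using prod_chart_exists_extending[where p = p, OF _ x c'] by (metis mfd_prod_simps(1))
  have "smooth_fun_at (mfd_prod X M) (\<lambda>p. cmap (prod_chart X c) p (x, i)) p"
    using c by (intro smooth_fun_at_coordinate[OF smooth_atlas_mfd_prod]) auto
  then show "smooth_fun_at (mfd_prod X M) (\<lambda>p. cmap c' (p x) i) p"
    using x c by simp
qed

lemma smooth_tuple:
  assumes L: "smooth_atlas L" and ext: "\<And>q. q \<in> pts L \<Longrightarrow> f q \<in> extensional X"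
    and f: "\<And>x. x \<in> X \<Longrightarrow> smooth L (M x) (\<lambda>q. f q x)"
  shows "smooth L (mfd_prod X M) f"
proof (rule smoothI[OF L smooth_atlas_chart_like[OF smooth_atlas_mfd_prod]])
  show "continuous_map (mtop L) (mtop (mfd_prod X M)) f"
    using f ext by (auto simp: continuous_map_componentwise smooth_def)
  fix q C k assume q: "q \<in> pts L" and "C \<in> atlas (mfd_prod X M)" and fq: "f q \<in> cdom C" and "k \<in> cix C"
  then obtain c x i where c: "c \<in> (\<Pi>\<^sub>E x\<in>X. atlas (M x))" "C = prod_chart X c" and k: "k = (x, i)" "x \<in> X"
    by auto
  have cx: "c x \<in> atlas (M x)" "f q x \<in> cdom (c x)" using c k fq by auto
  have "smooth_fun_at L (\<lambda>m. cmap (c x) (f m x) i) q"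
    by (rule smooth_fun_at_chart_of_map[OF L smooth_atlas_chart_like[OF M[OF k(2)] cx(1)] f[OF k(2)] q cx])
  then show "smooth_fun_at L (\<lambda>m. cmap C (f m) k) q"
    using c k by simp
qed

subsection \<open>Tangent vectors of products\<close>

text \<open>
  The coordinates of a product chart are coordinates of the factors after a projection.
\<close>

lemma product_tangent_coordinate:
  assumes v: "v \<in> tangent_space (mfd_prod X M) p" and c: "c \<in> (\<Pi>\<^sub>E x\<in>X. atlas (M x))"
    and p: "p \<in> (\<Pi>\<^sub>E x\<in>X. cdom (c x))" and x: "x \<in> X"
  shows "snd (tangent_map (mfd_prod X M) (M x) (\<lambda>p. p x) v) (c x) i = snd v (prod_chart X c) (x, i)"
proof -
  have "snd (tangent_map (mfd_prod X M) (M x) (\<lambda>p. p x) v) (c x) i =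
      tangent_deriv (mfd_prod X M) (\<lambda>p. cmap (prod_chart X c) p (x, i)) v"
    using c p x tangent_space_fst[OF v] by (subst tangent_map_snd) auto
  also have "\<dots> = snd v (prod_chart X c) (x, i)"
    using c p by (intro tangent_deriv_coordinate[OF smooth_atlas_mfd_prod v]) auto
  finally show ?thesis .
qed

lemma product_tangent_eqI:
  assumes v: "v \<in> tangent_space (mfd_prod X M) p" and v': "v' \<in> tangent_space (mfd_prod X M) p"
    and eq: "\<And>x. x \<in> X \<Longrightarrow> tangent_map (mfd_prod X M) (M x) (\<lambda>p. p x) v =
      tangent_map (mfd_prod X M) (M x) (\<lambda>p. p x) v'"
  shows "v = v'"
proof (rule tangent_vector_eqI[OF v v'])
  fix C and k :: "'i \<times> 'c" assume C: "C \<in> atlas (mfd_prod X M)" "p \<in> cdom C"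
  then obtain c where c: "c \<in> (\<Pi>\<^sub>E x\<in>X. atlas (M x))" "C = prod_chart X c" by auto
  obtain x i where k: "k = (x, i)" by force
  show "snd v C k = snd v' C k"
  proof (cases "x \<in> X")
    case True
    then show ?thesis
      using product_tangent_coordinate[OF v c(1) _ True, of i] product_tangent_coordinate[OF v' c(1) _ True, of i]
        C c eq[OF True] k by simp
  next
    case False
    then show ?thesis
      using tangent_space_coords[OF v C] tangent_space_coords[OF v' C] c k by (simp add: in_coords_iff)
  qed
qed

text \<open>
  The Jacobian of a change of product charts is block diagonal.
\<close>

lemma right_partial_prod_chart:
  assumes c: "c \<in> (\<Pi>\<^sub>E x\<in>X. atlas (M x))" and c': "c' \<in> (\<Pi>\<^sub>E x\<in>X. atlas (M x))"
    and p: "p \<in> (\<Pi>\<^sub>E x\<in>X. cdom (c x))" and x: "x \<in> X" and y: "y \<in> X" and i: "i \<in> cix (c y)"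
  shows "right_partial (y, i) (\<lambda>z. cmap (prod_chart X c') (cinv (prod_chart X c) z) (x, j)) (cmap (prod_chart X c) p) =
    (if y = x then right_partial i (\<lambda>z. cmap (c' x) (cinv (c x) z) j) (cmap (c x) (p x)) else 0)"
proof -
  note ch = prod_chart_is_chart[OF c]
  let ?C = "prod_chart X c"
  let ?h = "\<lambda>y. cmap (c' x) (cinv (c x) y) j"
  have "right_partial (y, i) (\<lambda>z. cmap (prod_chart X c') (cinv ?C z) (x, j)) (cmap ?C p) =
      right_partial (y, i) (\<lambda>z. ?h (\<lambda>j. z (x, j))) (cmap ?C p)"
    using x y i p cinv_prod_chart[OF X ch]
    by (intro right_partial_cong[OF cimg_prod_chart_open[OF X ch]]) auto
  also have "\<dots> = (if y = x then right_partial i ?h (cmap (c x) (p x)) else 0)"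
  proof (cases "y = x")
    case True
    have "(\<lambda>j. ((cmap ?C p)((x, i) := t)) (x, j)) = (cmap (c x) (p x))(i := t)" for t
      using x by (auto simp: fun_eq_iff)
    then show ?thesis using True x by (simp add: right_partial_def)
  next
    case False
    then have "(\<lambda>j. ((cmap ?C p)((y, i) := t)) (x, j)) = (\<lambda>j. cmap ?C p (x, j))" for t
      by (auto simp: fun_eq_iff)
    then show ?thesis
      using False right_partial_const[of "(y, i)" "?h (\<lambda>j. cmap ?C p (x, j))" "cmap ?C p"]
      by (simp add: right_partial_def)
  qed
  finally show ?thesis .
qed

text \<open>
  Surjectivity of \<open>tangent_split\<close>.
\<close>

lemma product_tangent_exists:
  assumes p: "p \<in> (\<Pi>\<^sub>E x\<in>X. pts (M x))" and w: "\<And>x. x \<in> X \<Longrightarrow> w x \<in> tangent_space (M x) (p x)"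
  obtains v where "v \<in> tangent_space (mfd_prod X M) p"
    "\<And>x. x \<in> X \<Longrightarrow> tangent_map (mfd_prod X M) (M x) (\<lambda>p. p x) v = w x"
proof -
  \<comment> \<open>\<open>v\<close> is the sum over \<open>x\<close> of the images of \<open>w x\<close> under the inclusions \<open>m \<mapsto> p(x := m)\<close>.  Writing the
    coordinates through \<open>C\<close> avoids recovering the factors of \<open>C\<close>.\<close>
  define v where "v = (p, \<lambda>C. if C \<in> atlas (mfd_prod X M) \<and> p \<in> cdom C
    then \<lambda>(x, j). if x \<in> X then tangent_deriv (M x) (\<lambda>m. cmap C (p(x := m)) (x, j)) (w x) else 0
    else (\<lambda>_. 0))"
  have v_snd: "snd v (prod_chart X c) (x, j) = (if x \<in> X then snd (w x) (c x) j else 0)"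
    if c: "c \<in> (\<Pi>\<^sub>E x\<in>X. atlas (M x))" and pc: "p \<in> (\<Pi>\<^sub>E x\<in>X. cdom (c x))" for c x j
  proof (cases "x \<in> X")
    case True
    have "snd v (prod_chart X c) (x, j) = tangent_deriv (M x) (\<lambda>m. cmap (c x) m j) (w x)"
      using c pc True by (auto simp: v_def)
    also have "\<dots> = snd (w x) (c x) j"
      using c pc True by (intro tangent_deriv_coordinate[OF M[OF True] w[OF True]]) auto
    finally show ?thesis using True by simp
  qed (use c pc in \<open>simp add: v_def\<close>)
  have v: "v \<in> tangent_space (mfd_prod X M) p"
  proof (rule tangent_spaceI)
    show v_fst: "fst v = p" by (simp add: v_def)
    show "snd v C = (\<lambda>_. 0)" if "\<not> (C \<in> atlas (mfd_prod X M) \<and> p \<in> cdom C)" for C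
      using that by (auto simp: v_def)
    fix C assume C: "C \<in> atlas (mfd_prod X M)" "p \<in> cdom C"
    then obtain c where c: "c \<in> (\<Pi>\<^sub>E x\<in>X. atlas (M x))" "C = prod_chart X c" by auto
    have pc: "p \<in> (\<Pi>\<^sub>E x\<in>X. cdom (c x))" using C c by simp
    have wc: "snd (w x) (c x) \<in> coords (cix (c x))" if "x \<in> X" for x
      using c pc that by (intro tangent_space_coords[OF w[OF that]]) auto
    then show "snd v C \<in> coords (cix C)"
      using v_snd[OF c(1) pc] by (auto simp: in_coords_iff c(2))
    fix C' and k :: "'i \<times> 'c" assume C': "C' \<in> atlas (mfd_prod X M)" "p \<in> cdom C'"
    then obtain c' where c': "c' \<in> (\<Pi>\<^sub>E x\<in>X. atlas (M x))" "C' = prod_chart X c'" by auto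
    have pc': "p \<in> (\<Pi>\<^sub>E x\<in>X. cdom (c' x))" using C' c' by simp
    obtain x j where k: "k = (x, j)" by force
    show "snd v C' k = chart_deriv C (\<lambda>m. cmap C' m k) v"
    proof (cases "x \<in> X")
      case True
      have "chart_deriv C (\<lambda>m. cmap C' m k) v = (\<Sum>(y, i)\<in>(SIGMA y:X. cix (c y)).
          (if y = x then right_partial i (\<lambda>z. cmap (c' x) (cinv (c x) z) j) (cmap (c x) (p x)) else 0) *
            snd (w y) (c y) i)"
        unfolding chart_deriv_def v_fst c(2) c'(2) k prod_chart_simps(1)
        by (rule sum.cong[OF refl]) (use right_partial_prod_chart[OF c(1) c'(1) pc True] v_snd[OF c(1) pc] in auto)
      also have "\<dots> = (\<Sum>y\<in>X. \<Sum>i\<in>cix (c y).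
          (if y = x then right_partial i (\<lambda>z. cmap (c' x) (cinv (c x) z) j) (cmap (c x) (p x)) else 0) *
            snd (w y) (c y) i)"
        using X is_chart_finite[OF prod_chart_is_chart[OF c(1)]] by (simp add: sum.Sigma)
      also have "\<dots> = (\<Sum>y\<in>X. if y = x then chart_deriv (c x) (\<lambda>m. cmap (c' x) m j) (w x) else 0)"
        using tangent_space_fst[OF w[OF True]] by (intro sum.cong) (auto simp: chart_deriv_def)
      also have "\<dots> = chart_deriv (c x) (\<lambda>m. cmap (c' x) m j) (w x)"
        using X True by simp
      also have "\<dots> = snd (w x) (c' x) j"
        using c c' pc pc' True by (intro tangent_space_change[OF w[OF True]]) auto
      finally show ?thesis using v_snd[OF c'(1) pc', of x j] c'(2) k True by simp
    next
      case False
      then show ?thesis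
        using v_snd[OF c'(1) pc', of x j] c'(2) k chart_deriv_const[of C 0 v] by simp
    qed
  qed
  have "tangent_map (mfd_prod X M) (M x) (\<lambda>p. p x) v = w x" if x: "x \<in> X" for x
  proof (rule tangent_vector_eqI[OF _ w[OF x]])
    show "tangent_map (mfd_prod X M) (M x) (\<lambda>p. p x) v \<in> tangent_space (M x) (p x)"
      using p v by (intro tangent_map_in_tangent_space[OF smooth_atlas_mfd_prod M[OF x] smooth_projection[OF x]]) auto
    fix c' i assume c': "c' \<in> atlas (M x)" "p x \<in> cdom c'"
    obtain c where c: "c \<in> (\<Pi>\<^sub>E x\<in>X. atlas (M x))" "p \<in> (\<Pi>\<^sub>E x\<in>X. cdom (c x))" "c x = c'"
      using prod_chart_exists_extending[OF p x c'] .
    show "snd (tangent_map (mfd_prod X M) (M x) (\<lambda>p. p x) v) c' i = snd (w x) c' i"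
      using product_tangent_coordinate[OF v c(1,2) x, of i] v_snd[OF c(1,2), of x i] c(3) x by simp
  qed
  with v show thesis by (rule that)
qed

end


section \<open>Disjoint unions\<close>

text \<open>
  The charts in \<open>disjoint_union\<close>.
\<close>

definition dchart :: "'o \<Rightarrow> ('p, 'c) chart \<Rightarrow> ('o \<times> 'p, 'c) chart" where
  "dchart i c = \<lparr>cix = cix c, ccor = ccor c, cdom = {i} \<times> cdom c, cmap = cmap c \<circ> snd\<rparr>"

lemma dchart_simps [simp]:
  "cix (dchart i c) = cix c" "ccor (dchart i c) = ccor c" "cdom (dchart i c) = {i} \<times> cdom c"
  "cmap (dchart i c) w = cmap c (snd w)"
  by (simp_all add: dchart_def)

lemma disjoint_union_simps [simp]:
  "mtop (disjoint_union I M) = sum_topology (\<lambda>i. mtop (M i)) I"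
  "pts (disjoint_union I M) = (SIGMA i:I. pts (M i))"
  "atlas (disjoint_union I M) = {dchart i c | i c. i \<in> I \<and> c \<in> atlas (M i)}"
  by (auto simp: disjoint_union_def dchart_def)

lemma cimg_dchart: "cimg (dchart i c) = cimg c"
  by force

lemma openin_sum_slice:
  assumes "i \<in> I" "openin (T i) V"
  shows "openin (sum_topology T I) ({i} \<times> V)"
proof -
  have "{x. (k, x) \<in> {i} \<times> V} = (if k = i then V else {})" for k by auto
  then show ?thesis
    using assms openin_subset[OF assms(2)] by (auto simp: openin_sum_topology)
qed

lemma is_chart_dchart:
  assumes i: "i \<in> I" and c: "is_chart (T i) c"
  shows "is_chart (sum_topology T I) (dchart i c)"
proof (rule is_chartI)
  have sub: "cdom c \<subseteq> topspace (T i)" using is_chart_cdom_open[OF c] by (rule openin_subset)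
  have dop: "openin (sum_topology T I) ({i} \<times> cdom c)"
    by (rule openin_sum_slice[of i I T, OF i is_chart_cdom_open[OF c]])
  have top: "topspace (subtopology (sum_topology T I) ({i} \<times> cdom c)) = {i} \<times> cdom c"
    using sub i by auto
  have "openin (subtopology (sum_topology T I) ({i} \<times> cdom c)) {w \<in> {i} \<times> cdom c. snd w \<in> V}"
    if "openin (T i) V" for V
  proof -
    have "{w \<in> {i} \<times> cdom c. snd w \<in> V} = ({i} \<times> V) \<inter> ({i} \<times> cdom c)" by auto
    then show ?thesis
      using openin_sum_slice[of i I T, OF i that] unfolding openin_subtopology by blast
  qed
  then have "continuous_map (subtopology (sum_topology T I) ({i} \<times> cdom c)) (T i) snd"
    using sub unfolding continuous_map top by auto
  then have "continuous_map (subtopology (sum_topology T I) ({i} \<times> cdom c)) (subtopology (T i) (cdom c)) snd"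
    unfolding continuous_map_in_subtopology top by auto
  from continuous_map_compose[OF this is_chart_cmap_continuous[OF c]]
  show "continuous_map (subtopology (sum_topology T I) (cdom (dchart i c))) euclidean (cmap (dchart i c))"
    by (simp add: o_def dchart_def)
  have "continuous_map (top_of_set (cimg c)) (T i) (cinv c)"
    using is_chart_cinv_continuous[OF c] by (simp add: continuous_map_in_subtopology)
  from continuous_map_compose[OF this continuous_map_component_injection[of i I T, OF i]]
  show "continuous_map (top_of_set (cimg (dchart i c))) (subtopology (sum_topology T I) (cdom (dchart i c)))
      (\<lambda>x. (i, cinv c x))"
    unfolding cimg_dchart by (auto simp: o_def continuous_map_in_subtopology intro: cinv_in_cdom)
  show "openin (sum_topology T I) (cdom (dchart i c))" using dop by simp
  show "openin (top_of_set (sector (cix (dchart i c)) (ccor (dchart i c)))) (cimg (dchart i c))"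
    unfolding cimg_dchart using is_chart_cimg_open[OF c] by simp
qed (use c in \<open>auto simp: is_chart_def cinv_cmap[OF c]\<close>)

lemma cinv_dchart:
  assumes c: "is_chart X c" and x: "x \<in> cimg c"
  shows "cinv (dchart i c) x = (i, cinv c x)"
  unfolding cinv_def
proof (rule inv_into_f_eq)
  show "inj_on (cmap (dchart i c)) (cdom (dchart i c))"
    using is_chart_inj[OF c] by (auto simp: inj_on_def)
  show "(i, inv_into (cdom c) (cmap c) x) \<in> cdom (dchart i c)"
    using cinv_in_cdom[OF x] by (simp add: cinv_def)
  show "cmap (dchart i c) (i, inv_into (cdom c) (cmap c) x) = x"
    using cmap_cinv[OF x] by (simp add: cinv_def)
qed

context
  fixes I :: "'o set" and M :: "'o \<Rightarrow> ('p, 'c) mfd"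
  assumes M: "\<And>i. i \<in> I \<Longrightarrow> smooth_atlas (M i)"
begin

lemma smooth_atlas_disjoint_union: "smooth_atlas (disjoint_union I M)"
  unfolding smooth_atlas_def
proof (intro conjI ballI)
  show "is_chart (mtop (disjoint_union I M)) C" if "C \<in> atlas (disjoint_union I M)" for C
    using that is_chart_dchart[of _ I "\<lambda>i. mtop (M i)"] smooth_atlas_is_chart[OF M] by auto
  show "(\<Union>C\<in>atlas (disjoint_union I M). cdom C) = pts (disjoint_union I M)"
  proof (intro equalityI subsetI)
    fix q assume "q \<in> (\<Union>C\<in>atlas (disjoint_union I M). cdom C)"
    then show "q \<in> pts (disjoint_union I M)" using smooth_atlas_cdom_subset[OF M] by fastforce
  next
    fix q assume "q \<in> pts (disjoint_union I M)"
    then obtain i m where q: "q = (i, m)" "i \<in> I" "m \<in> pts (M i)" by auto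
    obtain c where "c \<in> atlas (M i)" "m \<in> cdom c" using smooth_atlas_chart_exists[OF M[OF q(2)] q(3)] .
    then show "q \<in> (\<Union>C\<in>atlas (disjoint_union I M). cdom C)"
      using q by (intro UN_I[of "dchart i c"]) auto
  qed
  fix C C' assume "C \<in> atlas (disjoint_union I M)" "C' \<in> atlas (disjoint_union I M)"
  then obtain i c i' c' where C: "C = dchart i c" "i \<in> I" "c \<in> atlas (M i)"
    and C': "C' = dchart i' c'" "i' \<in> I" "c' \<in> atlas (M i')" by auto
  show "smooth_ext (cix C) (cmap C ` (cdom C \<inter> cdom C')) (cix C') (cmap C' \<circ> cinv C)"
  proof (cases "i = i'")
    case True
    have S: "cmap C ` (cdom C \<inter> cdom C') = cmap c ` (cdom c \<inter> cdom c')"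
      using True C C' by force
    have eq: "(cmap C' \<circ> cinv C) y = (cmap c' \<circ> cinv c) y" if "y \<in> cmap c ` (cdom c \<inter> cdom c')" for y
      using cinv_dchart[OF smooth_atlas_is_chart[OF M[OF C(2)] C(3)], of y i] that C C' by auto
    have "smooth_ext (cix c) (cmap c ` (cdom c \<inter> cdom c')) (cix c') (cmap c' \<circ> cinv c)"
      using M[OF C(2)] C C' True unfolding smooth_atlas_def by blast
    then show ?thesis
      unfolding S using eq C C' by (simp add: smooth_ext_def)
  next
    case False
    then have "cdom C \<inter> cdom C' = {}" using C C' by auto
    then show ?thesis by (simp add: smooth_ext_def)
  qed
qed

lemma smooth_fun_at_disjoint_union:
  assumes i: "i \<in> I" and m: "m \<in> pts (M i)" and g: "smooth_fun_at (M i) (\<lambda>m. g (i, m)) m"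
  shows "smooth_fun_at (disjoint_union I M) g (i, m)"
proof -
  obtain c where c: "c \<in> atlas (M i)" "m \<in> cdom c" using smooth_atlas_chart_exists[OF M[OF i] m] .
  note ch = smooth_atlas_is_chart[OF M[OF i] c(1)]
  show ?thesis
  proof (rule smooth_fun_atI_chart[OF smooth_atlas_disjoint_union, of "dchart i c"])
    have "smooth_real_at (cix c) (cimg c) (\<lambda>x. g (cinv (dchart i c) x)) (cmap c m)"
      by (rule smooth_real_at_local[OF openin_subtopology_self _ smooth_fun_atD[OF g c]])
        (use c in \<open>auto simp: cinv_dchart[OF ch]\<close>)
    then show "smooth_real_at (cix (dchart i c)) (cimg (dchart i c)) (\<lambda>x. g (cinv (dchart i c) x))
        (cmap (dchart i c) (i, m))"
      unfolding cimg_dchart by simp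
  qed (use i c in auto)
qed

lemma smooth_component_injection:
  assumes i: "i \<in> I"
  shows "smooth (M i) (disjoint_union I M) (\<lambda>m. (i, m))"
proof (rule smoothI[OF M[OF i] smooth_atlas_chart_like[OF smooth_atlas_disjoint_union]])
  show "continuous_map (mtop (M i)) (mtop (disjoint_union I M)) (\<lambda>m. (i, m))"
    using continuous_map_component_injection[OF i, of "\<lambda>i. mtop (M i)"] by simp
  show "smooth_fun_at (M i) (\<lambda>m. cmap C (i, m) k) q"
    if "C \<in> atlas (disjoint_union I M)" "(i, q) \<in> cdom C" for q C k
    using that by (auto intro: smooth_fun_at_coordinate[OF M[OF i]])
qed

lemma smooth_from_disjoint_union:
  assumes N: "\<And>c. c \<in> atlas N \<Longrightarrow> chart_like (mtop N) c"
    and f: "\<And>i. i \<in> I \<Longrightarrow> smooth (M i) N (\<lambda>m. f (i, m))"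
  shows "smooth (disjoint_union I M) N f"
proof (rule smoothI[OF smooth_atlas_disjoint_union N])
  have "openin (sum_topology (\<lambda>i. mtop (M i)) I) {q \<in> (SIGMA i:I. pts (M i)). f q \<in> V}"
    if V: "openin (mtop N) V" for V
  proof -
    have "{m. (i, m) \<in> {q \<in> (SIGMA i:I. pts (M i)). f q \<in> V}} = {m \<in> pts (M i). f (i, m) \<in> V}"
      if "i \<in> I" for i
      using that by auto
    then show ?thesis
      using smooth_preimage_open[OF f V] by (auto simp: openin_sum_topology)
  qed
  then show "continuous_map (mtop (disjoint_union I M)) (mtop N) f"
    using smooth_maps_to[OF f] by (auto simp: continuous_map o_def)
  show "smooth_fun_at (disjoint_union I M) (\<lambda>m. cmap c' (f m) k) q"
    if "q \<in> pts (disjoint_union I M)" "c' \<in> atlas N" "f q \<in> cdom c'" for q c' k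
    using that smooth_fun_at_chart_of_map[OF M N f]
    by (auto intro!: smooth_fun_at_disjoint_union)
qed

end

section \<open>From hybrid to ordinary surjective submersions\<close>

text \<open>
  Makes \<open>U_obj a\<close> a \<open>smooth_atlas\<close> and passes to finite products of phase spaces.
\<close>

definition smooth_phase_space :: "('o, 'm, 'p, 'c) hyph \<Rightarrow> bool" where
  "smooth_phase_space a \<longleftrightarrow> (\<forall>x\<in>obj (hcat a). smooth_atlas (hmfd a x))"

lemma smooth_phase_spaceI: "hybrid_phase_space a \<Longrightarrow> smooth_phase_space a"
  by (simp add: hybrid_phase_space_def smooth_phase_space_def manifold_smooth_atlas)

lemma pts_U_obj: "(x, p) \<in> pts (U_obj a) \<longleftrightarrow> x \<in> obj (hcat a) \<and> p \<in> pts (hmfd a x)"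
  by (simp add: U_obj_def)

lemma smooth_atlas_U_obj: "smooth_phase_space a \<Longrightarrow> smooth_atlas (U_obj a)"
  unfolding U_obj_def smooth_phase_space_def by (rule smooth_atlas_disjoint_union) auto

lemma smooth_U_map:
  assumes a: "smooth_phase_space a" and b: "smooth_phase_space b" and f: "hyph_map a b f"
  shows "smooth (U_obj a) (U_obj b) (U_map f)"
  unfolding U_obj_def[of a]
proof (rule smooth_from_disjoint_union)
  show "smooth_atlas (hmfd a x)" if "x \<in> obj (hcat a)" for x
    using a that by (simp add: smooth_phase_space_def)
  show "chart_like (mtop (U_obj b)) c" if "c \<in> atlas (U_obj b)" for c
    using smooth_atlas_chart_like[OF smooth_atlas_U_obj[OF b] that] .
  fix x assume x: "x \<in> obj (hcat a)"
  have fx: "fobj f x \<in> obj (hcat b)" "smooth (hmfd a x) (hmfd b (fobj f x)) (fcomp f x)"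
    using f x by (auto simp: hyph_map_def cat_functor_def)
  have "smooth (hmfd b (fobj f x)) (U_obj b) (\<lambda>p. (fobj f x, p))"
    unfolding U_obj_def using b fx(1) by (intro smooth_component_injection) (auto simp: smooth_phase_space_def)
  moreover have "smooth_atlas (hmfd a x)" "smooth_atlas (hmfd b (fobj f x))"
    using a b x fx(1) by (auto simp: smooth_phase_space_def)
  ultimately have "smooth (hmfd a x) (U_obj b) (\<lambda>p. (fobj f x, fcomp f x p))"
    using smooth_compose[OF _ _ smooth_atlas_chart_like[OF smooth_atlas_U_obj[OF b]] fx(2)] by blast
  then show "smooth (hmfd a x) (U_obj b) (\<lambda>p. U_map f (x, p))"
    by (simp add: U_map_def)
qed

lemma hyph_prod_simps [simp]:
  "obj (hcat (hyph_prod X a)) = (\<Pi>\<^sub>E x\<in>X. obj (hcat (a x)))"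
  "hmfd (hyph_prod X a) z = mfd_prod X (\<lambda>x. hmfd (a x) (z x))"
  by (simp_all add: hyph_prod_def cat_prod_def)

text \<open>
  The inverse of \<open>U_prod\<close>.
\<close>

definition U_unprod :: "'i set \<Rightarrow> ('i \<Rightarrow> 'o \<times> 'p) \<Rightarrow> ('i \<Rightarrow> 'o) \<times> ('i \<Rightarrow> 'p)" where
  "U_unprod X P = (\<lambda>x\<in>X. fst (P x), \<lambda>x\<in>X. snd (P x))"

context
  fixes X :: "'i set" and a :: "'i \<Rightarrow> ('o, 'm, 'p, 'c) hyph"
  assumes X: "finite X" and a: "\<And>x. x \<in> X \<Longrightarrow> smooth_phase_space (a x)"
begin

lemma smooth_phase_space_hyph_prod: "smooth_phase_space (hyph_prod X a)"
  unfolding smooth_phase_space_def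
proof
  fix z assume "z \<in> obj (hcat (hyph_prod X a))"
  then show "smooth_atlas (hmfd (hyph_prod X a) z)"
    using a by (auto simp: smooth_phase_space_def PiE_iff intro!: smooth_atlas_mfd_prod[OF X])
qed

lemma smooth_atlas_prod_U_obj: "smooth_atlas (mfd_prod X (\<lambda>x. U_obj (a x)))"
  by (intro smooth_atlas_mfd_prod[OF X] smooth_atlas_U_obj a)

lemma smooth_U_prod: "smooth (U_obj (hyph_prod X a)) (mfd_prod X (\<lambda>x. U_obj (a x))) (U_prod X)"
  unfolding U_obj_def[of "hyph_prod X a"]
proof (rule smooth_from_disjoint_union)
  show sa: "smooth_atlas (hmfd (hyph_prod X a) z)" if "z \<in> obj (hcat (hyph_prod X a))" for z
    using smooth_phase_space_hyph_prod that by (simp only: smooth_phase_space_def)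
  show "chart_like (mtop (mfd_prod X (\<lambda>x. U_obj (a x)))) c" if "c \<in> atlas (mfd_prod X (\<lambda>x. U_obj (a x)))" for c
    using smooth_atlas_chart_like[OF smooth_atlas_prod_U_obj that] .
  fix z assume z: "z \<in> obj (hcat (hyph_prod X a))"
  have zx: "smooth_atlas (hmfd (a x) (z x))" if "x \<in> X" for x
    using a[OF that] z that by (auto simp: smooth_phase_space_def PiE_iff)
  show "smooth (hmfd (hyph_prod X a) z) (mfd_prod X (\<lambda>x. U_obj (a x))) (\<lambda>p. U_prod X (z, p))"
  proof (rule smooth_tuple[OF X smooth_atlas_U_obj[OF a] sa[OF z]])
    fix x assume x: "x \<in> X"
    have "smooth (hmfd (a x) (z x)) (U_obj (a x)) (\<lambda>p. (z x, p))"
      unfolding U_obj_def using a[OF x] z x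
      by (intro smooth_component_injection) (auto simp: smooth_phase_space_def PiE_iff)
    moreover have "smooth (hmfd (hyph_prod X a) z) (hmfd (a x) (z x)) (\<lambda>p. p x)"
      unfolding hyph_prod_simps by (rule smooth_projection[of X "\<lambda>x. hmfd (a x) (z x)", OF X zx x])
    ultimately have "smooth (hmfd (hyph_prod X a) z) (U_obj (a x)) (\<lambda>p. (z x, p x))"
      by (intro smooth_compose[OF sa[OF z] zx[OF x], where g = "\<lambda>p. (z x, p)"]
          smooth_atlas_chart_like[OF smooth_atlas_U_obj[OF a[OF x]]])
    then show "smooth (hmfd (hyph_prod X a) z) (U_obj (a x)) (\<lambda>p. U_prod X (z, p) x)"
      using x by (simp add: U_prod_def)
  qed (auto simp: U_prod_def)
qed

text \<open>
  On the open set of families whose points lie in prescribed components \<open>z x\<close>, charts of the two sides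
  correspond and have the same coordinate functions.
\<close>

lemma smooth_U_unprod: "smooth (mfd_prod X (\<lambda>x. U_obj (a x))) (U_obj (hyph_prod X a)) (U_unprod X)"
proof (rule smooth_localI[OF smooth_atlas_prod_U_obj smooth_atlas_U_obj[OF smooth_phase_space_hyph_prod]])
  fix P assume P: "P \<in> pts (mfd_prod X (\<lambda>x. U_obj (a x)))"
  define z where "z = (\<lambda>x\<in>X. fst (P x))"
  have PX: "fst (P x) \<in> obj (hcat (a x))" "snd (P x) \<in> pts (hmfd (a x) (z x))" if "x \<in> X" for x
    using P that by (auto simp: U_obj_def z_def PiE_iff)
  then have z: "z \<in> (\<Pi>\<^sub>E x\<in>X. obj (hcat (a x)))" by (auto simp: z_def)
  have zx: "smooth_atlas (hmfd (a x) (z x))" if "x \<in> X" for x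
    using a[OF that] z that by (auto simp: smooth_phase_space_def PiE_iff)
  have "(\<lambda>x\<in>X. snd (P x)) \<in> (\<Pi>\<^sub>E x\<in>X. pts (hmfd (a x) (z x)))" using PX by auto
  then obtain c where c: "c \<in> (\<Pi>\<^sub>E x\<in>X. atlas (hmfd (a x) (z x)))" "(\<lambda>x\<in>X. snd (P x)) \<in> (\<Pi>\<^sub>E x\<in>X. cdom (c x))"
    using prod_chart_exists[of X "\<lambda>x. hmfd (a x) (z x)", OF X zx] by blast
  let ?C = "prod_chart X (\<lambda>x\<in>X. dchart (z x) (c x))"
  have C: "?C \<in> atlas (mfd_prod X (\<lambda>x. U_obj (a x)))"
    using c z by (auto simp: U_obj_def PiE_iff intro!: imageI) blast
  have cd: "m \<in> cdom ?C \<longleftrightarrow> m \<in> extensional X \<and> (\<forall>x\<in>X. fst (m x) = z x \<and> snd (m x) \<in> cdom (c x))" for m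
    by (auto simp: PiE_iff mem_Times_iff)
  show "\<exists>U. \<exists>c'\<in>atlas (U_obj (hyph_prod X a)). openin (mtop (mfd_prod X (\<lambda>x. U_obj (a x)))) U \<and> P \<in> U \<and>
      U_unprod X ` U \<subseteq> cdom c' \<and>
      (\<forall>m\<in>U. \<forall>i\<in>cix c'. smooth_fun_at (mfd_prod X (\<lambda>x. U_obj (a x))) (\<lambda>m. cmap c' (U_unprod X m) i) m)"
  proof (intro exI[of _ "cdom ?C"] bexI[of _ "dchart z (prod_chart X c)"] conjI ballI)
    show "dchart z (prod_chart X c) \<in> atlas (U_obj (hyph_prod X a))"
      using z c by (auto simp: U_obj_def)
    show "openin (mtop (mfd_prod X (\<lambda>x. U_obj (a x)))) (cdom ?C)"
      by (rule is_chart_cdom_open[OF smooth_atlas_is_chart[OF smooth_atlas_prod_U_obj C]])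
    show "P \<in> cdom ?C" unfolding cd using P c by (auto simp: z_def PiE_iff)
    show "U_unprod X ` cdom ?C \<subseteq> cdom (dchart z (prod_chart X c))"
    proof
      fix w assume "w \<in> U_unprod X ` cdom ?C"
      then obtain m where m: "m \<in> cdom ?C" "w = U_unprod X m" by auto
      have "(\<lambda>x\<in>X. fst (m x)) = z"
        using m(1)[unfolded cd] by (auto simp: z_def fun_eq_iff restrict_def)
      then show "w \<in> cdom (dchart z (prod_chart X c))"
        using m unfolding cd by (auto simp: U_unprod_def)
    qed
    fix m k assume m: "m \<in> cdom ?C"
    have "cmap (dchart z (prod_chart X c)) (U_unprod X m) k = cmap ?C m k" for m
      by (cases k) (simp add: U_unprod_def)
    then show "smooth_fun_at (mfd_prod X (\<lambda>x. U_obj (a x)))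
        (\<lambda>m. cmap (dchart z (prod_chart X c)) (U_unprod X m) k) m"
      using smooth_fun_at_coordinate[OF smooth_atlas_prod_U_obj C m] by simp
  qed
qed

end

lemma U_unprod_U_prod:
  assumes "w \<in> pts (U_obj (hyph_prod X a))"
  shows "U_unprod X (U_prod X w) = w"
proof -
  obtain z p where w: "w = (z, p)" by force
  have "z \<in> extensional X" "p \<in> extensional X"
    using assms unfolding w pts_U_obj by (auto simp: PiE_iff)
  then show ?thesis
    by (auto simp: w U_prod_def U_unprod_def fun_eq_iff restrict_def extensional_def)
qed

lemma U_prod_U_unprod:
  assumes "P \<in> extensional X"
  shows "U_prod X (U_unprod X P) = P"
  using assms by (auto simp: U_prod_def U_unprod_def fun_eq_iff restrict_def extensional_def)


section \<open>Vector spaces of open systems\<close>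

lemma real_field_simps [simp]:
  "carrier real_field = UNIV" "r \<otimes>\<^bsub>real_field\<^esub> s = r * s" "\<one>\<^bsub>real_field\<^esub> = 1"
  "\<zero>\<^bsub>real_field\<^esub> = 0" "r \<oplus>\<^bsub>real_field\<^esub> s = r + s"
  by (simp_all add: real_field_def)

text \<open>
  Additive inverses are \<open>(-1) \<odot> v\<close>.
\<close>

lemma real_vectorspaceI:
  fixes V :: "(real, 'v) module"
  assumes add_closed: "\<And>u v. u \<in> carrier V \<Longrightarrow> v \<in> carrier V \<Longrightarrow> u \<oplus>\<^bsub>V\<^esub> v \<in> carrier V"
    and zero_closed: "\<zero>\<^bsub>V\<^esub> \<in> carrier V"
    and assoc: "\<And>u v w. u \<in> carrier V \<Longrightarrow> v \<in> carrier V \<Longrightarrow> w \<in> carrier V \<Longrightarrow>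
      (u \<oplus>\<^bsub>V\<^esub> v) \<oplus>\<^bsub>V\<^esub> w = u \<oplus>\<^bsub>V\<^esub> (v \<oplus>\<^bsub>V\<^esub> w)"
    and comm: "\<And>u v. u \<in> carrier V \<Longrightarrow> v \<in> carrier V \<Longrightarrow> u \<oplus>\<^bsub>V\<^esub> v = v \<oplus>\<^bsub>V\<^esub> u"
    and l_zero: "\<And>v. v \<in> carrier V \<Longrightarrow> \<zero>\<^bsub>V\<^esub> \<oplus>\<^bsub>V\<^esub> v = v"
    and smult_closed: "\<And>r v. v \<in> carrier V \<Longrightarrow> r \<odot>\<^bsub>V\<^esub> v \<in> carrier V"
    and l_distr: "\<And>r s v. v \<in> carrier V \<Longrightarrow> (r + s) \<odot>\<^bsub>V\<^esub> v = r \<odot>\<^bsub>V\<^esub> v \<oplus>\<^bsub>V\<^esub> s \<odot>\<^bsub>V\<^esub> v"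
    and r_distr: "\<And>r u v. u \<in> carrier V \<Longrightarrow> v \<in> carrier V \<Longrightarrow>
      r \<odot>\<^bsub>V\<^esub> (u \<oplus>\<^bsub>V\<^esub> v) = r \<odot>\<^bsub>V\<^esub> u \<oplus>\<^bsub>V\<^esub> r \<odot>\<^bsub>V\<^esub> v"
    and smult_assoc: "\<And>r s v. v \<in> carrier V \<Longrightarrow> (r * s) \<odot>\<^bsub>V\<^esub> v = r \<odot>\<^bsub>V\<^esub> (s \<odot>\<^bsub>V\<^esub> v)"
    and smult_one: "\<And>v. v \<in> carrier V \<Longrightarrow> 1 \<odot>\<^bsub>V\<^esub> v = v"
    and smult_zero: "\<And>v. v \<in> carrier V \<Longrightarrow> 0 \<odot>\<^bsub>V\<^esub> v = \<zero>\<^bsub>V\<^esub>"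
  shows "vectorspace real_field V"
proof -
  interpret F: field real_field by (rule field_real_field)
  have "abelian_group V"
  proof (rule abelian_groupI)
    fix v assume v: "v \<in> carrier V"
    have "(-1) \<odot>\<^bsub>V\<^esub> v \<oplus>\<^bsub>V\<^esub> v = \<zero>\<^bsub>V\<^esub>"
      using l_distr[OF v, of "-1" 1] smult_one[OF v] smult_zero[OF v] by simp
    then show "\<exists>w\<in>carrier V. w \<oplus>\<^bsub>V\<^esub> v = \<zero>\<^bsub>V\<^esub>" using smult_closed[OF v] by blast
  qed (use add_closed zero_closed assoc comm l_zero in auto)
  then have "Module.module real_field V"
    by (intro moduleI F.is_cring) (use smult_closed l_distr r_distr smult_assoc smult_one in auto)
  then show ?thesis using F.field_axioms by (intro vectorspace.intro)
qed

lemma real_subspaceI: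
  assumes "vectorspace real_field V" "W \<subseteq> carrier V" "\<zero>\<^bsub>V\<^esub> \<in> W"
    and "\<And>u v. u \<in> W \<Longrightarrow> v \<in> W \<Longrightarrow> u \<oplus>\<^bsub>V\<^esub> v \<in> W"
    and "\<And>r v. v \<in> W \<Longrightarrow> r \<odot>\<^bsub>V\<^esub> v \<in> W"
  shows "VectorSpace.subspace real_field W V"
proof -
  interpret V: vectorspace real_field V by fact
  show ?thesis
    by (intro subspace.intro submodule.intro assms V.module_axioms)
qed

lemma real_linear_mapI:
  assumes "vectorspace real_field V" "vectorspace real_field W"
    and "\<And>v. v \<in> carrier V \<Longrightarrow> f v \<in> carrier W"
    and "\<And>u v. u \<in> carrier V \<Longrightarrow> v \<in> carrier V \<Longrightarrow> f (u \<oplus>\<^bsub>V\<^esub> v) = f u \<oplus>\<^bsub>W\<^esub> f v"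
    and "\<And>r v. v \<in> carrier V \<Longrightarrow> f (r \<odot>\<^bsub>V\<^esub> v) = r \<odot>\<^bsub>W\<^esub> f v"
  shows "linear_map real_field V W f"
proof -
  interpret V: vectorspace real_field V by fact
  interpret W: vectorspace real_field W by fact
  show ?thesis
    by (intro linear_map.intro mod_hom.intro mod_hom_axioms.intro assms(1,2) V.module_axioms W.module_axioms)
      (use assms(3-5) in \<open>auto simp: LinearCombinations.module_hom_def\<close>)
qed

lemma direct_sum_simps [simp]:
  "carrier (direct_sum V W) = carrier V \<times> carrier W" "\<zero>\<^bsub>direct_sum V W\<^esub> = (\<zero>\<^bsub>V\<^esub>, \<zero>\<^bsub>W\<^esub>)"
  "u \<oplus>\<^bsub>direct_sum V W\<^esub> v = (fst u \<oplus>\<^bsub>V\<^esub> fst v, snd u \<oplus>\<^bsub>W\<^esub> snd v)"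
  "r \<odot>\<^bsub>direct_sum V W\<^esub> v = (r \<odot>\<^bsub>V\<^esub> fst v, r \<odot>\<^bsub>W\<^esub> snd v)"
  by (simp_all add: direct_sum_def)

lemma linear_relationI:
  assumes "vectorspace real_field V" "vectorspace real_field W" "R \<subseteq> carrier V \<times> carrier W"
    and "(\<zero>\<^bsub>V\<^esub>, \<zero>\<^bsub>W\<^esub>) \<in> R"
    and "\<And>v w v' w'. (v, w) \<in> R \<Longrightarrow> (v', w') \<in> R \<Longrightarrow> (v \<oplus>\<^bsub>V\<^esub> v', w \<oplus>\<^bsub>W\<^esub> w') \<in> R"
    and "\<And>r v w. (v, w) \<in> R \<Longrightarrow> (r \<odot>\<^bsub>V\<^esub> v, r \<odot>\<^bsub>W\<^esub> w) \<in> R"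
  shows "linear_relation V W R"
  unfolding linear_relation_def
  by (intro real_subspaceI direct_sum_is_vs assms(1,2)) (use assms(3-6) in auto)

lemma family_sum_simps [simp]:
  "carrier (family_sum X V) = (\<Pi>\<^sub>E x\<in>X. carrier (V x))" "\<zero>\<^bsub>family_sum X V\<^esub> = (\<lambda>x\<in>X. \<zero>\<^bsub>V x\<^esub>)"
  "u \<oplus>\<^bsub>family_sum X V\<^esub> v = (\<lambda>x\<in>X. u x \<oplus>\<^bsub>V x\<^esub> v x)"
  "r \<odot>\<^bsub>family_sum X V\<^esub> u = (\<lambda>x\<in>X. r \<odot>\<^bsub>V x\<^esub> u x)"
  by (simp_all add: family_sum_def)

lemma vectorspace_family_sum:
  assumes V: "\<And>x. x \<in> X \<Longrightarrow> vectorspace real_field (V x)"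
  shows "vectorspace real_field (family_sum X V)"
proof -
  have M: "Module.module real_field (V x)" if "x \<in> X" for x
    using V[OF that] by (rule vectorspace.axioms(1))
  have G: "abelian_group (V x)" if "x \<in> X" for x
    using M[OF that] by (rule Module.module.axioms)
  have mon: "abelian_monoid (V x)" if "x \<in> X" for x
    using G[OF that] by (rule abelian_group.axioms)
  let ?S = "family_sum X V"
  show ?thesis
  proof (rule real_vectorspaceI)
    fix u v w r s
    assume u: "u \<in> carrier (?S)"
    have ux: "u x \<in> carrier (V x)" if "x \<in> X" for x using u that by auto
    have ue: "(\<lambda>x\<in>X. u x) = u" using u by (simp add: PiE_restrict)
    show "\<zero>\<^bsub>?S\<^esub> \<oplus>\<^bsub>?S\<^esub> u = u"
      using abelian_monoid.l_zero[OF mon ux] ue by (simp cong: restrict_cong)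
    show "r \<odot>\<^bsub>?S\<^esub> u \<in> carrier (?S)"
      using Module.module.smult_closed[OF M _ ux] by auto
    show "(r + s) \<odot>\<^bsub>?S\<^esub> u = r \<odot>\<^bsub>?S\<^esub> u \<oplus>\<^bsub>?S\<^esub> s \<odot>\<^bsub>?S\<^esub> u"
      using Module.module.smult_l_distr[OF M _ _ ux, of _ r s] by (simp cong: restrict_cong)
    show "(r * s) \<odot>\<^bsub>?S\<^esub> u = r \<odot>\<^bsub>?S\<^esub> (s \<odot>\<^bsub>?S\<^esub> u)"
      using Module.module.smult_assoc1[OF M _ _ ux, of _ r s] by (simp cong: restrict_cong)
    show "1 \<odot>\<^bsub>?S\<^esub> u = u"
      using Module.module.smult_one[OF M ux] ue by (simp cong: restrict_cong)
    show "0 \<odot>\<^bsub>?S\<^esub> u = \<zero>\<^bsub>?S\<^esub>"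
      using Module.module.smult_l_null[OF M ux] by (simp cong: restrict_cong)
    assume v: "v \<in> carrier (?S)"
    have vx: "v x \<in> carrier (V x)" if "x \<in> X" for x using v that by auto
    show "u \<oplus>\<^bsub>?S\<^esub> v \<in> carrier (?S)"
      using abelian_monoid.a_closed[OF mon ux vx] by auto
    show "u \<oplus>\<^bsub>?S\<^esub> v = v \<oplus>\<^bsub>?S\<^esub> u"
      using abelian_monoid.a_comm[OF mon ux vx] by (simp cong: restrict_cong)
    show "r \<odot>\<^bsub>?S\<^esub> (u \<oplus>\<^bsub>?S\<^esub> v) =
        r \<odot>\<^bsub>?S\<^esub> u \<oplus>\<^bsub>?S\<^esub> r \<odot>\<^bsub>?S\<^esub> v"
      using Module.module.smult_r_distr[OF M _ ux vx, of _ r] by (simp cong: restrict_cong)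
    assume w: "w \<in> carrier (?S)"
    have wx: "w x \<in> carrier (V x)" if "x \<in> X" for x using w that by auto
    show "(u \<oplus>\<^bsub>?S\<^esub> v) \<oplus>\<^bsub>?S\<^esub> w = u \<oplus>\<^bsub>?S\<^esub> (v \<oplus>\<^bsub>?S\<^esub> w)"
      using abelian_monoid.a_assoc[OF mon ux vx wx] by (simp cong: restrict_cong)
  next
    show "\<zero>\<^bsub>?S\<^esub> \<in> carrier (?S)"
      using abelian_monoid.zero_closed[OF mon] by auto
  qed
qed

subsection \<open>Open systems on a surjective submersion\<close>

lemma tvec_eqI: "fst w = fst w' \<Longrightarrow> (\<And>c j. snd w c j = snd w' c j) \<Longrightarrow> w = w'"
  by (rule prod_eqI) auto

definition smooth_ssub :: "('p, 'c, 'q, 'd) ssub \<Rightarrow> bool" where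
  "smooth_ssub a \<longleftrightarrow> smooth_atlas (tot a) \<and> smooth_atlas (st a) \<and> smooth (tot a) (st a) (prj a)"

definition smooth_square :: "('p, 'c, 'q, 'd) ssub \<Rightarrow> ('p2, 'c2, 'q2, 'd2) ssub \<Rightarrow>
    ('p \<Rightarrow> 'p2, 'q \<Rightarrow> 'q2) square \<Rightarrow> bool" where
  "smooth_square a b f \<longleftrightarrow> smooth (tot a) (tot b) (sq_tot f) \<and> smooth (st a) (st b) (sq_st f) \<and>
     (\<forall>q\<in>pts (tot a). prj b (sq_tot f q) = sq_st f (prj a q))"

lemma Crl_simps [simp]:
  "\<zero>\<^bsub>Crl a\<^esub> = (\<lambda>q\<in>pts (tot a). tzero (prj a q))"
  "F \<oplus>\<^bsub>Crl a\<^esub> G = (\<lambda>q\<in>pts (tot a). tadd (F q) (G q))"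
  "r \<odot>\<^bsub>Crl a\<^esub> F = (\<lambda>q\<in>pts (tot a). tscale r (F q))"
  by (simp_all add: Crl_def)

lemma Crl_extensional: "F \<in> carrier (Crl a) \<Longrightarrow> F \<in> extensional (pts (tot a))"
  by (simp add: Crl_def)

lemma Crl_tangent: "F \<in> carrier (Crl a) \<Longrightarrow> q \<in> pts (tot a) \<Longrightarrow> F q \<in> tangent_space (st a) (prj a q)"
  by (simp add: Crl_def)

lemma Crl_fst: "F \<in> carrier (Crl a) \<Longrightarrow> q \<in> pts (tot a) \<Longrightarrow> fst (F q) = prj a q"
  by (rule tangent_space_fst[OF Crl_tangent])

context
  fixes a :: "('p, 'c, 'q, 'd) ssub"
  assumes a: "smooth_ssub a"
begin

lemma smooth_ssub_tot: "smooth_atlas (tot a)" and smooth_ssub_st: "smooth_atlas (st a)"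
  and smooth_ssub_prj: "smooth (tot a) (st a) (prj a)"
  using a by (simp_all add: smooth_ssub_def)

lemma prj_in_pts: "q \<in> pts (tot a) \<Longrightarrow> prj a q \<in> pts (st a)"
  by (rule smooth_maps_to[OF smooth_ssub_prj])

lemma Crl_carrierI:
  assumes "F \<in> extensional (pts (tot a))"
    and "\<And>q. q \<in> pts (tot a) \<Longrightarrow> F q \<in> tangent_space (st a) (prj a q)"
    and "\<And>q c i. q \<in> pts (tot a) \<Longrightarrow> c \<in> atlas (st a) \<Longrightarrow> prj a q \<in> cdom c \<Longrightarrow> i \<in> cix c \<Longrightarrow>
      smooth_fun_at (tot a) (\<lambda>m. snd (F m) c i) q"
  shows "F \<in> carrier (Crl a)"
  using assms smooth_into_tangent_bundleI[OF smooth_ssub_tot smooth_ssub_st smooth_ssub_prj, of F]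
  by (simp add: Crl_def)

lemma Crl_smooth_coordinate:
  assumes "F \<in> carrier (Crl a)" "q \<in> pts (tot a)" "c \<in> atlas (st a)" "prj a q \<in> cdom c"
  shows "smooth_fun_at (tot a) (\<lambda>m. snd (F m) c i) q"
  using assms Crl_tangent[OF assms(1,2)]
  by (intro smooth_into_tangent_bundleD[OF smooth_ssub_tot smooth_ssub_st]) (auto simp: Crl_def)

lemma Crl_zero_closed: "\<zero>\<^bsub>Crl a\<^esub> \<in> carrier (Crl a)"
proof (rule Crl_carrierI)
  show "smooth_fun_at (tot a) (\<lambda>m. snd (\<zero>\<^bsub>Crl a\<^esub> m) c i) q" if "q \<in> pts (tot a)" for q c i
    by (rule smooth_fun_at_local[OF smooth_ssub_tot openin_topspace that smooth_fun_at_const[OF smooth_ssub_tot, of 0]])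
      simp
qed (auto intro: tangent_space_tzero)

lemma Crl_add_closed:
  assumes F: "F \<in> carrier (Crl a)" and G: "G \<in> carrier (Crl a)"
  shows "F \<oplus>\<^bsub>Crl a\<^esub> G \<in> carrier (Crl a)"
proof (rule Crl_carrierI)
  show "smooth_fun_at (tot a) (\<lambda>m. snd ((F \<oplus>\<^bsub>Crl a\<^esub> G) m) c i) q"
    if "q \<in> pts (tot a)" "c \<in> atlas (st a)" "prj a q \<in> cdom c" for q c i
    by (rule smooth_fun_at_local[OF smooth_ssub_tot openin_topspace that(1)
        smooth_fun_at_add[OF smooth_ssub_tot Crl_smooth_coordinate[OF F that, of i] Crl_smooth_coordinate[OF G that, of i]]])
      simp
qed (use Crl_tangent[OF F] Crl_tangent[OF G] in \<open>auto intro: tangent_space_tadd\<close>)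

lemma Crl_smult_closed:
  assumes F: "F \<in> carrier (Crl a)"
  shows "r \<odot>\<^bsub>Crl a\<^esub> F \<in> carrier (Crl a)"
proof (rule Crl_carrierI)
  show "smooth_fun_at (tot a) (\<lambda>m. snd ((r \<odot>\<^bsub>Crl a\<^esub> F) m) c i) q"
    if "q \<in> pts (tot a)" "c \<in> atlas (st a)" "prj a q \<in> cdom c" for q c i
    by (rule smooth_fun_at_local[OF smooth_ssub_tot openin_topspace that(1)
        smooth_fun_at_mult[OF smooth_ssub_tot smooth_fun_at_const[OF smooth_ssub_tot, of r] Crl_smooth_coordinate[OF F that, of i]]])
      simp
qed (use Crl_tangent[OF F] in \<open>auto intro: tangent_space_tscale\<close>)

lemma vectorspace_Crl: "vectorspace real_field (Crl a)"
proof (rule real_vectorspaceI)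
  fix F r s assume F: "F \<in> carrier (Crl a)"
  note Fe = Crl_extensional[OF F] and Ff = Crl_fst[OF F]
  show "\<zero>\<^bsub>Crl a\<^esub> \<oplus>\<^bsub>Crl a\<^esub> F = F"
    by (rule extensionalityI[of _ "pts (tot a)"]) (use Fe Ff in \<open>auto intro!: tvec_eqI\<close>)
  show "(r + s) \<odot>\<^bsub>Crl a\<^esub> F = r \<odot>\<^bsub>Crl a\<^esub> F \<oplus>\<^bsub>Crl a\<^esub> s \<odot>\<^bsub>Crl a\<^esub> F"
    by (rule extensionalityI[of _ "pts (tot a)"]) (auto intro!: tvec_eqI simp: algebra_simps)
  show "(r * s) \<odot>\<^bsub>Crl a\<^esub> F = r \<odot>\<^bsub>Crl a\<^esub> (s \<odot>\<^bsub>Crl a\<^esub> F)"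
    by (rule extensionalityI[of _ "pts (tot a)"]) (auto intro!: tvec_eqI)
  show "1 \<odot>\<^bsub>Crl a\<^esub> F = F"
    by (rule extensionalityI[of _ "pts (tot a)"]) (use Fe in \<open>auto intro!: tvec_eqI\<close>)
  show "0 \<odot>\<^bsub>Crl a\<^esub> F = \<zero>\<^bsub>Crl a\<^esub>"
    by (rule extensionalityI[of _ "pts (tot a)"]) (use Ff in \<open>auto intro!: tvec_eqI\<close>)
  fix G assume G: "G \<in> carrier (Crl a)"
  note Gf = Crl_fst[OF G]
  show "F \<oplus>\<^bsub>Crl a\<^esub> G = G \<oplus>\<^bsub>Crl a\<^esub> F"
    by (rule extensionalityI[of _ "pts (tot a)"]) (use Ff Gf in \<open>auto intro!: tvec_eqI\<close>)
  show "r \<odot>\<^bsub>Crl a\<^esub> (F \<oplus>\<^bsub>Crl a\<^esub> G) = r \<odot>\<^bsub>Crl a\<^esub> F \<oplus>\<^bsub>Crl a\<^esub> r \<odot>\<^bsub>Crl a\<^esub> G"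
    by (rule extensionalityI[of _ "pts (tot a)"]) (auto intro!: tvec_eqI simp: algebra_simps)
  fix H
  show "(F \<oplus>\<^bsub>Crl a\<^esub> G) \<oplus>\<^bsub>Crl a\<^esub> H = F \<oplus>\<^bsub>Crl a\<^esub> (G \<oplus>\<^bsub>Crl a\<^esub> H)"
    by (rule extensionalityI[of _ "pts (tot a)"]) (auto intro!: tvec_eqI)
qed (rule Crl_add_closed Crl_zero_closed Crl_smult_closed; assumption)+

end

lemma Crl_relD:
  assumes "(F, G) \<in> Crl_rel a b f"
  shows "F \<in> carrier (Crl a)" "G \<in> carrier (Crl b)"
    "\<And>q. q \<in> pts (tot a) \<Longrightarrow> G (sq_tot f q) = tangent_map (st a) (st b) (sq_st f) (F q)"
  using assms by (auto simp: Crl_rel_def)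

lemma linear_relation_Crl_rel:
  assumes a: "smooth_ssub a" and b: "smooth_ssub b" and f: "smooth_square a b f"
  shows "linear_relation (Crl a) (Crl b) (Crl_rel a b f)"
proof (rule linear_relationI[OF vectorspace_Crl[OF a] vectorspace_Crl[OF b]])
  have fq: "sq_tot f q \<in> pts (tot b)" "prj b (sq_tot f q) = sq_st f (prj a q)" if "q \<in> pts (tot a)" for q
    using f that smooth_maps_to by (auto simp: smooth_square_def)
  show "Crl_rel a b f \<subseteq> carrier (Crl a) \<times> carrier (Crl b)"
    by (auto simp: Crl_rel_def)
  show "(\<zero>\<^bsub>Crl a\<^esub>, \<zero>\<^bsub>Crl b\<^esub>) \<in> Crl_rel a b f"
    using Crl_zero_closed[OF a] Crl_zero_closed[OF b] fq by (auto simp: Crl_rel_def tangent_map_tzero)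
  fix F G F' G' r assume R: "(F, G) \<in> Crl_rel a b f"
  show "(r \<odot>\<^bsub>Crl a\<^esub> F, r \<odot>\<^bsub>Crl b\<^esub> G) \<in> Crl_rel a b f"
    using Crl_smult_closed[OF a, of F r] Crl_smult_closed[OF b, of G r] R fq
    by (auto simp: Crl_rel_def tangent_map_tscale)
  assume R': "(F', G') \<in> Crl_rel a b f"
  have "fst (F q) = fst (F' q)" if "q \<in> pts (tot a)" for q
    using Crl_fst[OF Crl_relD(1)[OF R] that] Crl_fst[OF Crl_relD(1)[OF R'] that] by simp
  then show "(F \<oplus>\<^bsub>Crl a\<^esub> F', G \<oplus>\<^bsub>Crl b\<^esub> G') \<in> Crl_rel a b f"
    using Crl_add_closed[OF a, of F F'] Crl_add_closed[OF b, of G G'] R R' fq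
    by (auto simp: Crl_rel_def tangent_map_tadd)
qed

lemma linear_relation_odot:
  assumes \<phi>: "\<phi> \<in> X \<rightarrow> Y" and V: "\<And>y. y \<in> Y \<Longrightarrow> vectorspace real_field (V y)"
    and W: "\<And>x. x \<in> X \<Longrightarrow> vectorspace real_field (W x)"
    and R: "\<And>x. x \<in> X \<Longrightarrow> linear_relation (V (\<phi> x)) (W x) (R x)"
  shows "linear_relation (family_sum Y V) (family_sum X W) (odot X Y \<phi> V W R)"
proof (rule linear_relationI[OF vectorspace_family_sum[OF V] vectorspace_family_sum[OF W]])
  have \<phi>Y: "\<phi> x \<in> Y" if "x \<in> X" for x using \<phi> that by auto
  interpret FY: vectorspace real_field "family_sum Y V" by (rule vectorspace_family_sum[OF V])
  interpret FX: vectorspace real_field "family_sum X W" by (rule vectorspace_family_sum[OF W])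
  have sub: "submodule real_field (R x) (direct_sum (V (\<phi> x)) (W x))" if "x \<in> X" for x
    using R[OF that] unfolding linear_relation_def by (rule subspace.submod)
  show "odot X Y \<phi> V W R \<subseteq> carrier (family_sum Y V) \<times> carrier (family_sum X W)"
    by (auto simp: odot_def)
  show "(\<zero>\<^bsub>family_sum Y V\<^esub>, \<zero>\<^bsub>family_sum X W\<^esub>) \<in> odot X Y \<phi> V W R"
    using FY.zero_closed FX.zero_closed submodule.zero_closed[OF sub] \<phi>Y
    by (auto simp: odot_def)
  fix u w u' w' r assume R: "(u, w) \<in> odot X Y \<phi> V W R"
  show "(r \<odot>\<^bsub>family_sum Y V\<^esub> u, r \<odot>\<^bsub>family_sum X W\<^esub> w) \<in> odot X Y \<phi> V W R"
    using R FY.smult_closed[of r u] FX.smult_closed[of r w] \<phi>Y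
      submodule.smult_closed[OF sub, of _ r "(u (\<phi> _), w _)"]
    by (auto simp: odot_def)
  assume R': "(u', w') \<in> odot X Y \<phi> V W R"
  show "(u \<oplus>\<^bsub>family_sum Y V\<^esub> u', w \<oplus>\<^bsub>family_sum X W\<^esub> w') \<in> odot X Y \<phi> V W R"
    using R R' FY.a_closed[of u u'] FX.a_closed[of w w'] \<phi>Y
      submodule.m_closed[OF sub, of _ "(u (\<phi> _), w _)" "(u' (\<phi> _), w' _)"]
    by (auto simp: odot_def)
qed


section \<open>Interconnection of open systems\<close>

lemma ssub_prod_simps [simp]:
  "tot (ssub_prod X \<sigma>) = mfd_prod X (\<lambda>x. tot (\<sigma> x))" "st (ssub_prod X \<sigma>) = mfd_prod X (\<lambda>x. st (\<sigma> x))"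
  "prj (ssub_prod X \<sigma>) q = (\<lambda>x\<in>X. prj (\<sigma> x) (q x))"
  by (simp_all add: ssub_prod_def)

text \<open>
  The inverse \<open>\<theta>\<close> on states is carried as a parameter, so that tangent maps can be inverted by
  functoriality.
\<close>

definition interconnected :: "'i set \<Rightarrow> ('i \<Rightarrow> ('p, 'c, 'q, 'd) ssub) \<Rightarrow> ('p2, 'c2, 'q2, 'd2) ssub \<Rightarrow>
    ('p2 \<Rightarrow> 'i \<Rightarrow> 'p, 'q2 \<Rightarrow> 'i \<Rightarrow> 'q) square \<Rightarrow> (('i \<Rightarrow> 'q) \<Rightarrow> 'q2) \<Rightarrow> bool" where
  "interconnected X \<sigma> b \<psi> \<theta> \<longleftrightarrow>
     finite X \<and> (\<forall>x\<in>X. smooth_ssub (\<sigma> x)) \<and> smooth_ssub b \<and> smooth_square b (ssub_prod X \<sigma>) \<psi> \<and>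
     smooth (mfd_prod X (\<lambda>x. st (\<sigma> x))) (st b) \<theta> \<and>
     (\<forall>m\<in>pts (st b). \<theta> (sq_st \<psi> m) = m) \<and>
     (\<forall>n\<in>pts (mfd_prod X (\<lambda>x. st (\<sigma> x))). sq_st \<psi> (\<theta> n) = n)"

definition ssub_network_Crl where
  "ssub_network_Crl X \<sigma> b \<psi> = pullback b (ssub_prod X \<sigma>) \<psi> \<circ> Crl_prod X \<sigma>"

context
  fixes X :: "'i set" and \<sigma> :: "'i \<Rightarrow> ('p, 'c, 'q, 'd) ssub" and b :: "('p2, 'c2, 'q2, 'd2) ssub"
    and \<psi> \<theta>
  assumes net: "interconnected X \<sigma> b \<psi> \<theta>"
begin

private lemma X: "finite X"
  and \<sigma>: "x \<in> X \<Longrightarrow> smooth_ssub (\<sigma> x)"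
  and b: "smooth_ssub b"
  and \<psi>_tot: "smooth (tot b) (mfd_prod X (\<lambda>x. tot (\<sigma> x))) (sq_tot \<psi>)"
  and \<psi>_st: "smooth (st b) (mfd_prod X (\<lambda>x. st (\<sigma> x))) (sq_st \<psi>)"
  and \<psi>_prj: "q \<in> pts (tot b) \<Longrightarrow> (\<lambda>x\<in>X. prj (\<sigma> x) (sq_tot \<psi> q x)) = sq_st \<psi> (prj b q)"
  and \<theta>: "smooth (mfd_prod X (\<lambda>x. st (\<sigma> x))) (st b) \<theta>"
  and \<theta>_\<psi>: "m \<in> pts (st b) \<Longrightarrow> \<theta> (sq_st \<psi> m) = m"
  and \<psi>_\<theta>: "n \<in> pts (mfd_prod X (\<lambda>x. st (\<sigma> x))) \<Longrightarrow> sq_st \<psi> (\<theta> n) = n"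
  using net by (auto simp: interconnected_def smooth_square_def)

private lemma st_x: "x \<in> X \<Longrightarrow> smooth_atlas (st (\<sigma> x))"
  and tot_x: "x \<in> X \<Longrightarrow> smooth_atlas (tot (\<sigma> x))"
  using \<sigma> by (auto simp: smooth_ssub_def)

private lemma st_prod: "smooth_atlas (mfd_prod X (\<lambda>x. st (\<sigma> x)))"
  by (rule smooth_atlas_mfd_prod[OF X st_x])

private lemma tot_prod: "smooth_atlas (mfd_prod X (\<lambda>x. tot (\<sigma> x)))"
  by (rule smooth_atlas_mfd_prod[OF X tot_x])

private lemma st_b: "smooth_atlas (st b)" and tot_b: "smooth_atlas (tot b)"
  using b by (auto simp: smooth_ssub_def)

lemma tangent_map_component:
  assumes p: "p \<in> pts (st b)" and v: "v \<in> tangent_space (st b) p" and x: "x \<in> X"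
  shows "tangent_map (st b) (st (\<sigma> x)) (\<lambda>m. sq_st \<psi> m x) v =
    tangent_map (mfd_prod X (\<lambda>x. st (\<sigma> x))) (st (\<sigma> x)) (\<lambda>n. n x)
      (tangent_map (st b) (mfd_prod X (\<lambda>x. st (\<sigma> x))) (sq_st \<psi>) v)"
  by (rule tangent_map_compose[OF st_b st_prod st_x[OF x] \<psi>_st smooth_projection[OF X st_x x] p v])

lemma smooth_component_st:
  assumes x: "x \<in> X"
  shows "smooth (st b) (st (\<sigma> x)) (\<lambda>m. sq_st \<psi> m x)"
  by (rule smooth_compose[OF st_b st_prod smooth_atlas_chart_like[OF st_x[OF x]] \<psi>_st
      smooth_projection[OF X st_x x]])

lemma smooth_component_tot:
  assumes x: "x \<in> X"
  shows "smooth (tot b) (tot (\<sigma> x)) (\<lambda>m. sq_tot \<psi> m x)"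
  by (rule smooth_compose[OF tot_b tot_prod smooth_atlas_chart_like[OF tot_x[OF x]] \<psi>_tot
      smooth_projection[OF X tot_x x]])

lemma tangent_map_back:
  assumes p: "p \<in> pts (st b)" and v: "v \<in> tangent_space (st b) p"
  shows "tangent_map (mfd_prod X (\<lambda>x. st (\<sigma> x))) (st b) \<theta>
      (tangent_map (st b) (mfd_prod X (\<lambda>x. st (\<sigma> x))) (sq_st \<psi>) v) = v"
proof -
  have "v = tangent_map (st b) (st b) (\<lambda>m. m) v"
    using tangent_map_id[OF st_b p v] by simp
  also have "\<dots> = tangent_map (st b) (st b) (\<lambda>m. \<theta> (sq_st \<psi> m)) v"
    by (rule tangent_map_cong[OF st_b p tangent_space_fst[OF v]]) (simp add: \<theta>_\<psi>)
  also have "\<dots> = tangent_map (mfd_prod X (\<lambda>x. st (\<sigma> x))) (st b) \<theta>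
      (tangent_map (st b) (mfd_prod X (\<lambda>x. st (\<sigma> x))) (sq_st \<psi>) v)"
    by (rule tangent_map_compose[OF st_b st_prod st_b \<psi>_st \<theta> p v])
  finally show ?thesis by simp
qed

text \<open>
  The tangent map of \<open>\<psi>\<close> on states has the left inverse \<open>T \<theta>\<close>, and a tangent vector of a product is
  determined by its projections.
\<close>

lemma interconnected_tangent_eqI:
  assumes p: "p \<in> pts (st b)" and v: "v \<in> tangent_space (st b) p" and v': "v' \<in> tangent_space (st b) p"
    and eq: "\<And>x. x \<in> X \<Longrightarrow> tangent_map (st b) (st (\<sigma> x)) (\<lambda>m. sq_st \<psi> m x) v =
      tangent_map (st b) (st (\<sigma> x)) (\<lambda>m. sq_st \<psi> m x) v'"
  shows "v = v'"
proof -
  have "tangent_map (st b) (mfd_prod X (\<lambda>x. st (\<sigma> x))) (sq_st \<psi>) v =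
      tangent_map (st b) (mfd_prod X (\<lambda>x. st (\<sigma> x))) (sq_st \<psi>) v'"
    using eq tangent_map_component[OF p v] tangent_map_component[OF p v']
    by (intro product_tangent_eqI[OF X st_x tangent_map_in_tangent_space[OF st_b st_prod \<psi>_st p v]
        tangent_map_in_tangent_space[OF st_b st_prod \<psi>_st p v']]) auto
  then show ?thesis
    using tangent_map_back[OF p v] tangent_map_back[OF p v'] by metis
qed

text \<open>
  The characterization by which the inverse functions in \<open>pullback\<close> and \<open>Crl_prod\<close> are eliminated.  Both are
  applied to points in the image: \<open>product_tangent_exists\<close> provides a preimage under the splitting, and
  \<open>T \<theta>\<close> one under \<open>T \<psi>\<close>.
\<close>

lemma ssub_network_Crl_at:
  assumes u: "u \<in> carrier (family_sum X (\<lambda>x. Crl (\<sigma> x)))" and q: "q \<in> pts (tot b)"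
  shows "ssub_network_Crl X \<sigma> b \<psi> u q \<in> tangent_space (st b) (prj b q) \<and>
    (\<forall>x\<in>X. tangent_map (st b) (st (\<sigma> x)) (\<lambda>m. sq_st \<psi> m x) (ssub_network_Crl X \<sigma> b \<psi> u q) =
      u x (sq_tot \<psi> q x))"
proof -
  let ?P = "mfd_prod X (\<lambda>x. st (\<sigma> x))"
  let ?Q = "sq_tot \<psi> q" and ?n = "sq_st \<psi> (prj b q)"
  let ?w = "\<lambda>x\<in>X. u x (?Q x)"
  have Q: "?Q \<in> (\<Pi>\<^sub>E x\<in>X. pts (tot (\<sigma> x)))"
    using smooth_maps_to[OF \<psi>_tot q] by simp
  have pb: "prj b q \<in> pts (st b)" by (rule prj_in_pts[OF b q])
  have n: "?n \<in> (\<Pi>\<^sub>E x\<in>X. pts (st (\<sigma> x)))"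
    using smooth_maps_to[OF \<psi>_st pb] by simp
  have nx: "?n x = prj (\<sigma> x) (?Q x)" if "x \<in> X" for x
    using fun_cong[OF \<psi>_prj[OF q], of x] that by simp
  have w: "u x (?Q x) \<in> tangent_space (st (\<sigma> x)) (?n x)" if x: "x \<in> X" for x
    using Crl_tangent[of "u x" "\<sigma> x" "?Q x"] u Q x nx[OF x] by auto
  obtain v where v: "v \<in> tangent_space ?P ?n"
    "\<And>x. x \<in> X \<Longrightarrow> tangent_map ?P (st (\<sigma> x)) (\<lambda>p. p x) v = u x (?Q x)"
    using product_tangent_exists[where M = "\<lambda>x. st (\<sigma> x)" and w = "\<lambda>x. u x (?Q x)", OF X st_x n w] by blast
  have "?n \<in> pts ?P" using n by simp
  then have v_pts: "v \<in> pts (tangent_bundle ?P)" by (rule in_pts_tangent_bundle[OF st_prod _ v(1)])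
  have v_split: "tangent_split X (\<lambda>x. st (\<sigma> x)) v = ?w"
    unfolding tangent_split_def by (rule restrict_ext) (rule v(2))
  have in_img: "?w \<in> tangent_split X (\<lambda>x. st (\<sigma> x)) ` pts (tangent_bundle ?P)"
    using imageI[OF v_pts] unfolding v_split[symmetric] .
  define v0 where "v0 = Crl_prod X \<sigma> u ?Q"
  have v0_eq: "v0 = inv_into (pts (tangent_bundle ?P)) (tangent_split X (\<lambda>x. st (\<sigma> x))) ?w"
    using Q by (simp add: v0_def Crl_prod_def)
  have v0_pts: "v0 \<in> pts (tangent_bundle ?P)"
    unfolding v0_eq by (rule inv_into_into[OF in_img])
  have v0_split: "tangent_split X (\<lambda>x. st (\<sigma> x)) v0 = ?w"
    unfolding v0_eq by (rule f_inv_into_f[OF in_img])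
  have v0_x: "tangent_map ?P (st (\<sigma> x)) (\<lambda>p. p x) v0 = u x (?Q x)" if "x \<in> X" for x
    using fun_cong[OF v0_split, of x] that by (simp add: tangent_split_def)
  have v0_fst: "fst v0 = ?n"
  proof (rule extensionalityI[of _ X])
    show "fst v0 \<in> extensional X"
      using v0_pts unfolding pts_tangent_bundle_iff[OF st_prod] by (auto simp: PiE_iff)
    show "?n \<in> extensional X" using n by (auto simp: PiE_iff)
    show "fst v0 x = ?n x" if "x \<in> X" for x
      using v0_x[OF that] tangent_space_fst[OF w[OF that]] by (metis tangent_map_fst)
  qed
  have v0: "v0 \<in> tangent_space ?P ?n"
    using v0_pts v0_fst unfolding pts_tangent_bundle_iff[OF st_prod] by simp
  \<comment> \<open>\<open>?t\<close> is a preimage of \<open>v0\<close>, so the inverse function in \<open>pullback\<close> is applied inside the image.\<close>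
  let ?t = "tangent_map ?P (st b) \<theta> v0"
  have nP: "?n \<in> pts ?P" using n by simp
  have t: "?t \<in> tangent_space (st b) (prj b q)"
    using tangent_map_in_tangent_space[OF st_prod st_b \<theta> nP v0] \<theta>_\<psi>[OF pb] by simp
  have "tangent_map (st b) ?P (sq_st \<psi>) ?t = tangent_map ?P ?P (\<lambda>n. sq_st \<psi> (\<theta> n)) v0"
    by (rule tangent_map_compose[OF st_prod st_b st_prod \<theta> \<psi>_st nP v0, symmetric])
  also have "\<dots> = tangent_map ?P ?P (\<lambda>n. n) v0"
    by (rule tangent_map_cong[OF st_prod nP v0_fst]) (rule \<psi>_\<theta>)
  also have "\<dots> = v0" by (rule tangent_map_id[OF st_prod nP v0])
  finally have t_v0: "tangent_map (st b) ?P (sq_st \<psi>) ?t = v0" .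
  have t_img: "v0 \<in> tangent_map (st b) ?P (sq_st \<psi>) ` pts (tangent_bundle (st b))"
    using imageI[OF in_pts_tangent_bundle[OF st_b pb t], of "tangent_map (st b) ?P (sq_st \<psi>)"]
    unfolding t_v0 .
  define v1 where "v1 = ssub_network_Crl X \<sigma> b \<psi> u q"
  have v1_eq: "v1 = inv_into (pts (tangent_bundle (st b))) (tangent_map (st b) ?P (sq_st \<psi>)) v0"
    using q by (simp add: v1_def ssub_network_Crl_def pullback_def v0_def)
  have v1_pts: "v1 \<in> pts (tangent_bundle (st b))"
    unfolding v1_eq by (rule inv_into_into[OF t_img])
  have v1_map: "tangent_map (st b) ?P (sq_st \<psi>) v1 = v0"
    unfolding v1_eq by (rule f_inv_into_f[OF t_img])
  \<comment> \<open>The inverse function may a priori return a vector at another base point; \<open>\<psi>\<close> is injective on states.\<close>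
  have "sq_st \<psi> (fst v1) = sq_st \<psi> (prj b q)"
    using v1_map v0_fst by (metis tangent_map_fst)
  then have "fst v1 = prj b q"
    using \<theta>_\<psi>[OF pb] \<theta>_\<psi>[of "fst v1"] v1_pts unfolding pts_tangent_bundle_iff[OF st_b] by simp
  then have v1: "v1 \<in> tangent_space (st b) (prj b q)"
    using v1_pts unfolding pts_tangent_bundle_iff[OF st_b] by simp
  have "tangent_map (st b) (st (\<sigma> x)) (\<lambda>m. sq_st \<psi> m x) v1 = u x (?Q x)" if x: "x \<in> X" for x
    unfolding tangent_map_component[OF pb v1 x] v1_map by (rule v0_x[OF x])
  with v1 show ?thesis by (simp add: v1_def)
qed

lemmas ssub_network_Crl_tangent = ssub_network_Crl_at[THEN conjunct1]
  and ssub_network_Crl_component = ssub_network_Crl_at[THEN conjunct2, THEN bspec]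

lemma ssub_network_Crl_extensional: "ssub_network_Crl X \<sigma> b \<psi> u \<in> extensional (pts (tot b))"
  by (simp add: ssub_network_Crl_def pullback_def)

text \<open>
  Near \<open>q\<close>, in a chart \<open>c'\<close> of the base, the coordinate \<open>i\<close> of the value at \<open>m\<close> is the derivative of
  \<open>cmap c' i \<circ> \<theta>\<close> along its image in the product.  In a product chart this is a sum of partial
  derivatives, which depend smoothly on the base point, times coordinates of the \<open>u x\<close>.
\<close>

lemma ssub_network_Crl_closed:
  assumes u: "u \<in> carrier (family_sum X (\<lambda>x. Crl (\<sigma> x)))"
  shows "ssub_network_Crl X \<sigma> b \<psi> u \<in> carrier (Crl b)"
proof (rule Crl_carrierI[OF b ssub_network_Crl_extensional ssub_network_Crl_tangent[OF u]])
  let ?P = "mfd_prod X (\<lambda>x. st (\<sigma> x))" and ?N = "ssub_network_Crl X \<sigma> b \<psi> u"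
  fix q c' i assume q: "q \<in> pts (tot b)" and c': "c' \<in> atlas (st b)" "prj b q \<in> cdom c'"
  have pb: "prj b m \<in> pts (st b)" if "m \<in> pts (tot b)" for m by (rule prj_in_pts[OF b that])
  let ?\<Psi> = "\<lambda>m. sq_st \<psi> (prj b m)"
  have nP: "?\<Psi> m \<in> pts ?P" if "m \<in> pts (tot b)" for m by (rule smooth_maps_to[OF \<psi>_st pb[OF that]])
  have sm\<Psi>: "smooth (tot b) ?P ?\<Psi>"
    by (rule smooth_compose[OF tot_b st_b smooth_atlas_chart_like[OF st_prod] smooth_ssub_prj[OF b] \<psi>_st])
  obtain c where c: "c \<in> (\<Pi>\<^sub>E x\<in>X. atlas (st (\<sigma> x)))" "?\<Psi> q \<in> (\<Pi>\<^sub>E x\<in>X. cdom (c x))"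
    using prod_chart_exists[where M = "\<lambda>x. st (\<sigma> x)" and p = "?\<Psi> q", OF X st_x] nP[OF q] by auto
  let ?C = "prod_chart X c"
  have C: "?C \<in> atlas ?P" using c by simp
  let ?g = "\<lambda>n. cmap c' (\<theta> n) i"
  have g: "smooth_fun_at ?P ?g (?\<Psi> m)" if m: "m \<in> pts (tot b)" "prj b m \<in> cdom c'" for m
    using m c' \<theta>_\<psi>[OF pb[OF m(1)]]
    by (intro smooth_fun_at_chart_of_map[OF st_prod smooth_atlas_chart_like[OF st_b c'(1)] \<theta> nP[OF m(1)]]) auto
  let ?U = "{m \<in> pts (tot b). prj b m \<in> cdom c'} \<inter> {m \<in> pts (tot b). ?\<Psi> m \<in> cdom ?C}"
  have U: "openin (mtop (tot b)) ?U"
    by (intro openin_Int smooth_preimage_open[OF smooth_ssub_prj[OF b]] smooth_preimage_open[OF sm\<Psi>]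
        is_chart_cdom_open[OF smooth_atlas_is_chart[OF st_b c'(1)]]
        is_chart_cdom_open[OF smooth_atlas_is_chart[OF st_prod C]])
  have qU: "q \<in> ?U" using q c' c by simp
  show "smooth_fun_at (tot b) (\<lambda>m. snd (?N m) c' i) q"
  proof (rule smooth_fun_at_local[OF tot_b U qU])
    show "smooth_fun_at (tot b) (\<lambda>m. \<Sum>k\<in>cix ?C. right_partial k (\<lambda>z. ?g (cinv ?C z)) (cmap ?C (?\<Psi> m)) *
        snd (u (fst k) (sq_tot \<psi> m (fst k))) (c (fst k)) (snd k)) q"
    proof (rule smooth_fun_at_sum[OF tot_b], rule smooth_fun_at_mult[OF tot_b])
      fix k assume k: "k \<in> cix ?C"
      show "smooth_fun_at (tot b) (\<lambda>m. right_partial k (\<lambda>z. ?g (cinv ?C z)) (cmap ?C (?\<Psi> m))) q"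
        using smooth_fun_at_right_partial[OF st_prod C _ g[OF q c'(2)] k] c(2)
        by (intro smooth_fun_at_compose[OF tot_b st_prod sm\<Psi> q,
              where g = "\<lambda>n. right_partial k (\<lambda>z. ?g (cinv ?C z)) (cmap ?C n)"]) simp
      obtain x j where kx: "k = (x, j)" "x \<in> X" using k by auto
      have Qx: "sq_tot \<psi> q x \<in> pts (tot (\<sigma> x))"
        by (rule smooth_maps_to[OF smooth_component_tot[OF kx(2)] q])
      have "prj (\<sigma> x) (sq_tot \<psi> q x) = ?\<Psi> q x"
        using fun_cong[OF \<psi>_prj[OF q], of x] kx(2) by simp
      then have cx: "c x \<in> atlas (st (\<sigma> x))" "prj (\<sigma> x) (sq_tot \<psi> q x) \<in> cdom (c x)"
        using c kx(2) by auto
      have "u x \<in> carrier (Crl (\<sigma> x))" using u kx(2) by auto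
      from Crl_smooth_coordinate[OF \<sigma>[OF kx(2)] this Qx cx]
      have "smooth_fun_at (tot b) (\<lambda>m. snd (u x (sq_tot \<psi> m x)) (c x) j) q"
        by (intro smooth_fun_at_compose[OF tot_b tot_x[OF kx(2)] smooth_component_tot[OF kx(2)] q,
              where g = "\<lambda>n. snd (u x n) (c x) j"])
      then show "smooth_fun_at (tot b) (\<lambda>m. snd (u (fst k) (sq_tot \<psi> m (fst k))) (c (fst k)) (snd k)) q"
        using kx by simp
    qed
    fix m assume "m \<in> ?U"
    then have m: "m \<in> pts (tot b)" "prj b m \<in> cdom c'" "?\<Psi> m \<in> cdom ?C" by auto
    note v = ssub_network_Crl_tangent[OF u m(1)] and pm = pb[OF m(1)]
    let ?T = "tangent_map (st b) ?P (sq_st \<psi>) (?N m)"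
    have T: "?T \<in> tangent_space ?P (?\<Psi> m)"
      by (rule tangent_map_in_tangent_space[OF st_b st_prod \<psi>_st pm v])
    have "snd (?N m) c' i = tangent_deriv (st b) (\<lambda>p. cmap c' p i) (?N m)"
      by (rule tangent_deriv_coordinate[OF st_b v c'(1) m(2), symmetric])
    also have "\<dots> = tangent_deriv (st b) (\<lambda>p. ?g (sq_st \<psi> p)) (?N m)"
      by (rule tangent_deriv_local[OF st_b pm tangent_space_fst[OF v] openin_topspace pm]) (simp add: \<theta>_\<psi>)
    also have "\<dots> = tangent_deriv ?P ?g ?T"
      by (rule tangent_deriv_compose[OF st_b st_prod \<psi>_st pm v g[OF m(1,2)]])
    also have "\<dots> = chart_deriv ?C ?g ?T"
      by (rule tangent_deriv_chart[OF st_prod T C m(3) g[OF m(1,2)]])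
    also have "\<dots> = (\<Sum>k\<in>cix ?C. right_partial k (\<lambda>z. ?g (cinv ?C z)) (cmap ?C (?\<Psi> m)) *
        snd (u (fst k) (sq_tot \<psi> m (fst k))) (c (fst k)) (snd k))"
      unfolding chart_deriv_def tangent_space_fst[OF T]
    proof (rule sum.cong[OF refl])
      fix k assume "k \<in> cix ?C"
      then obtain x j where kx: "k = (x, j)" "x \<in> X" by auto
      have "snd ?T ?C (x, j) = snd (tangent_map ?P (st (\<sigma> x)) (\<lambda>p. p x) ?T) (c x) j"
        using m(3) by (intro product_tangent_coordinate[OF X st_x T c(1) _ kx(2), symmetric]) auto
      also have "\<dots> = snd (u x (sq_tot \<psi> m x)) (c x) j"
        unfolding tangent_map_component[OF pm v kx(2), symmetric]
          ssub_network_Crl_component[OF u m(1) kx(2)] ..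
      finally show "right_partial k (\<lambda>z. ?g (cinv ?C z)) (cmap ?C (?\<Psi> m)) * snd ?T ?C k =
          right_partial k (\<lambda>z. ?g (cinv ?C z)) (cmap ?C (?\<Psi> m)) *
          snd (u (fst k) (sq_tot \<psi> m (fst k))) (c (fst k)) (snd k)"
        using kx by simp
    qed
    finally show "snd (?N m) c' i = (\<Sum>k\<in>cix ?C. right_partial k (\<lambda>z. ?g (cinv ?C z)) (cmap ?C (?\<Psi> m)) *
        snd (u (fst k) (sq_tot \<psi> m (fst k))) (c (fst k)) (snd k))" .
  qed
qed

text \<open>
  Both sides of each equation have the same images under the tangent maps of the components of \<open>\<psi>\<close>.
\<close>

lemma linear_map_ssub_network_Crl:
  "linear_map real_field (family_sum X (\<lambda>x. Crl (\<sigma> x))) (Crl b) (ssub_network_Crl X \<sigma> b \<psi>)"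
proof (rule real_linear_mapI[OF _ vectorspace_Crl[OF b] ssub_network_Crl_closed])
  let ?N = "ssub_network_Crl X \<sigma> b \<psi>" and ?F = "family_sum X (\<lambda>x. Crl (\<sigma> x))"
  show F: "vectorspace real_field ?F"
    by (rule vectorspace_family_sum[OF vectorspace_Crl[OF \<sigma>]])
  interpret F: vectorspace real_field ?F by (rule F)
  have Qx: "sq_tot \<psi> q x \<in> pts (tot (\<sigma> x))" if "q \<in> pts (tot b)" "x \<in> X" for q x
    using smooth_maps_to[OF smooth_component_tot] that by blast
  fix u r assume u: "u \<in> carrier ?F"
  show "?N (r \<odot>\<^bsub>?F\<^esub> u) = r \<odot>\<^bsub>Crl b\<^esub> ?N u"
  proof (rule extensionalityI[OF ssub_network_Crl_extensional])
    fix q assume q: "q \<in> pts (tot b)"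
    have ru: "r \<odot>\<^bsub>?F\<^esub> u \<in> carrier ?F" using F.smult_closed[OF _ u] by simp
    have "?N (r \<odot>\<^bsub>?F\<^esub> u) q = tscale r (?N u q)"
      using ssub_network_Crl_component[OF ru q] ssub_network_Crl_component[OF u q] Qx[OF q]
      by (intro interconnected_tangent_eqI[OF prj_in_pts[OF b q] ssub_network_Crl_tangent[OF ru q]
          tangent_space_tscale[OF ssub_network_Crl_tangent[OF u q]]]) (simp add: tangent_map_tscale)
    then show "?N (r \<odot>\<^bsub>?F\<^esub> u) q = (r \<odot>\<^bsub>Crl b\<^esub> ?N u) q" using q by simp
  qed simp
  fix u' assume u': "u' \<in> carrier ?F"
  show "?N (u \<oplus>\<^bsub>?F\<^esub> u') = ?N u \<oplus>\<^bsub>Crl b\<^esub> ?N u'"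
  proof (rule extensionalityI[OF ssub_network_Crl_extensional])
    fix q assume q: "q \<in> pts (tot b)"
    have uu: "u \<oplus>\<^bsub>?F\<^esub> u' \<in> carrier ?F" by (rule F.a_closed[OF u u'])
    note t = ssub_network_Crl_tangent[OF u q] and t' = ssub_network_Crl_tangent[OF u' q]
    have fst: "fst (?N u q) = fst (?N u' q)"
      using tangent_space_fst[OF t] tangent_space_fst[OF t'] by simp
    have "?N (u \<oplus>\<^bsub>?F\<^esub> u') q = tadd (?N u q) (?N u' q)"
      using ssub_network_Crl_component[OF uu q] ssub_network_Crl_component[OF u q]
        ssub_network_Crl_component[OF u' q] Qx[OF q]
      by (intro interconnected_tangent_eqI[OF prj_in_pts[OF b q] ssub_network_Crl_tangent[OF uu q]
          tangent_space_tadd[OF t t']]) (simp add: tangent_map_tadd[OF fst])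
    then show "?N (u \<oplus>\<^bsub>?F\<^esub> u') q = (?N u \<oplus>\<^bsub>Crl b\<^esub> ?N u') q" using q by simp
  qed simp
qed

end

text \<open>
  The inclusion of relations compares two tangent vectors at the same point through their images under
  the tangent maps of the components of \<open>\<psi>\<close>.
\<close>

theorem ssub_network_cell:
  fixes X :: "'i set" and Y :: "'j set"
  assumes netX: "interconnected X \<sigma> b \<psi> \<theta>" and netY: "interconnected Y \<rho> c \<nu> \<kappa>"
    and \<phi>: "\<phi> \<in> X \<rightarrow> Y" and \<Phi>: "\<And>x. x \<in> X \<Longrightarrow> smooth_square (\<rho> (\<phi> x)) (\<sigma> x) (\<Phi> x)"
    and f: "smooth_square c b f"
    and comm_tot: "\<And>q x. q \<in> pts (tot c) \<Longrightarrow> x \<in> X \<Longrightarrow>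
      sq_tot \<psi> (sq_tot f q) x = sq_tot (\<Phi> x) (sq_tot \<nu> q (\<phi> x))"
    and comm_st: "\<And>m x. m \<in> pts (st c) \<Longrightarrow> x \<in> X \<Longrightarrow>
      sq_st \<psi> (sq_st f m) x = sq_st (\<Phi> x) (sq_st \<nu> m (\<phi> x))"
  shows "relvect_cell (family_sum Y (\<lambda>y. Crl (\<rho> y))) (family_sum X (\<lambda>x. Crl (\<sigma> x))) (Crl c) (Crl b)
    (odot X Y \<phi> (\<lambda>y. Crl (\<rho> y)) (\<lambda>x. Crl (\<sigma> x)) (\<lambda>x. Crl_rel (\<rho> (\<phi> x)) (\<sigma> x) (\<Phi> x)))
    (Crl_rel c b f) (ssub_network_Crl Y \<rho> c \<nu>) (ssub_network_Crl X \<sigma> b \<psi>)"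
proof -
  have b: "smooth_ssub b" and \<sigma>: "\<And>x. x \<in> X \<Longrightarrow> smooth_ssub (\<sigma> x)"
    using netX by (auto simp: interconnected_def)
  have c: "smooth_ssub c" and \<rho>: "\<And>y. y \<in> Y \<Longrightarrow> smooth_ssub (\<rho> y)"
    using netY by (auto simp: interconnected_def)
  have \<phi>Y: "\<phi> x \<in> Y" if "x \<in> X" for x using \<phi> that by auto
  note st_b = smooth_ssub_st[OF b] and st_c = smooth_ssub_st[OF c]
  have f_tot: "smooth (tot c) (tot b) (sq_tot f)" and f_st: "smooth (st c) (st b) (sq_st f)"
    and f_prj: "\<And>q. q \<in> pts (tot c) \<Longrightarrow> prj b (sq_tot f q) = sq_st f (prj c q)"
    using f by (auto simp: smooth_square_def)
  have incl: "(ssub_network_Crl Y \<rho> c \<nu> u, ssub_network_Crl X \<sigma> b \<psi> w) \<in> Crl_rel c b f"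
    if R: "(u, w) \<in> odot X Y \<phi> (\<lambda>y. Crl (\<rho> y)) (\<lambda>x. Crl (\<sigma> x)) (\<lambda>x. Crl_rel (\<rho> (\<phi> x)) (\<sigma> x) (\<Phi> x))"
    for u w
  proof -
    let ?F = "ssub_network_Crl Y \<rho> c \<nu> u" and ?G = "ssub_network_Crl X \<sigma> b \<psi> w"
    have u: "u \<in> carrier (family_sum Y (\<lambda>y. Crl (\<rho> y)))"
      and w: "w \<in> carrier (family_sum X (\<lambda>x. Crl (\<sigma> x)))"
      and uw: "\<And>x. x \<in> X \<Longrightarrow> (u (\<phi> x), w x) \<in> Crl_rel (\<rho> (\<phi> x)) (\<sigma> x) (\<Phi> x)"
      using R by (auto simp: odot_def)
    have "?G (sq_tot f q) = tangent_map (st c) (st b) (sq_st f) (?F q)" if q: "q \<in> pts (tot c)" for q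
    proof -
      let ?p = "prj c q"
      have p: "?p \<in> pts (st c)" by (rule prj_in_pts[OF c q])
      have fq: "sq_tot f q \<in> pts (tot b)" by (rule smooth_maps_to[OF f_tot q])
      note v = ssub_network_Crl_tangent[OF netY u q]
      show ?thesis
      proof (rule interconnected_tangent_eqI[OF netX])
        show "sq_st f ?p \<in> pts (st b)" by (rule smooth_maps_to[OF f_st p])
        show "?G (sq_tot f q) \<in> tangent_space (st b) (sq_st f ?p)"
          using ssub_network_Crl_tangent[OF netX w fq] f_prj[OF q] by simp
        show "tangent_map (st c) (st b) (sq_st f) (?F q) \<in> tangent_space (st b) (sq_st f ?p)"
          by (rule tangent_map_in_tangent_space[OF st_c st_b f_st p v])
        fix x assume x: "x \<in> X"
        note y = \<phi>Y[OF x] and st_x = smooth_ssub_st[OF \<sigma>[OF x]] and st_y = smooth_ssub_st[OF \<rho>[OF \<phi>Y[OF x]]]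
        have \<Phi>_st: "smooth (st (\<rho> (\<phi> x))) (st (\<sigma> x)) (sq_st (\<Phi> x))"
          using \<Phi>[OF x] by (simp add: smooth_square_def)
        have "tangent_map (st b) (st (\<sigma> x)) (\<lambda>m. sq_st \<psi> m x) (?G (sq_tot f q)) =
            w x (sq_tot (\<Phi> x) (sq_tot \<nu> q (\<phi> x)))"
          by (simp add: ssub_network_Crl_component[OF netX w fq x] comm_tot[OF q x])
        also have "\<dots> = tangent_map (st (\<rho> (\<phi> x))) (st (\<sigma> x)) (sq_st (\<Phi> x)) (u (\<phi> x) (sq_tot \<nu> q (\<phi> x)))"
          by (rule Crl_relD(3)[OF uw[OF x] smooth_maps_to[OF smooth_component_tot[OF netY y] q]])
        also have "\<dots> = tangent_map (st (\<rho> (\<phi> x))) (st (\<sigma> x)) (sq_st (\<Phi> x))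
            (tangent_map (st c) (st (\<rho> (\<phi> x))) (\<lambda>m. sq_st \<nu> m (\<phi> x)) (?F q))"
          by (simp add: ssub_network_Crl_component[OF netY u q y])
        also have "\<dots> = tangent_map (st c) (st (\<sigma> x)) (\<lambda>m. sq_st (\<Phi> x) (sq_st \<nu> m (\<phi> x))) (?F q)"
          by (rule tangent_map_compose[OF st_c st_y st_x smooth_component_st[OF netY y] \<Phi>_st p v, symmetric])
        also have "\<dots> = tangent_map (st c) (st (\<sigma> x)) (\<lambda>m. sq_st \<psi> (sq_st f m) x) (?F q)"
          by (rule tangent_map_cong[OF st_c p tangent_space_fst[OF v]]) (simp add: comm_st[OF _ x])
        also have "\<dots> = tangent_map (st b) (st (\<sigma> x)) (\<lambda>m. sq_st \<psi> m x) (tangent_map (st c) (st b) (sq_st f) (?F q))"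
          by (rule tangent_map_compose[OF st_c st_b st_x f_st smooth_component_st[OF netX x] p v])
        finally show "tangent_map (st b) (st (\<sigma> x)) (\<lambda>m. sq_st \<psi> m x) (?G (sq_tot f q)) =
            tangent_map (st b) (st (\<sigma> x)) (\<lambda>m. sq_st \<psi> m x) (tangent_map (st c) (st b) (sq_st f) (?F q))" .
      qed
    qed
    then show ?thesis
      using ssub_network_Crl_closed[OF netX w] ssub_network_Crl_closed[OF netY u] by (simp add: Crl_rel_def)
  qed
  show ?thesis
    unfolding relvect_cell_def
  proof (intro conjI)
    show "linear_relation (family_sum Y (\<lambda>y. Crl (\<rho> y))) (family_sum X (\<lambda>x. Crl (\<sigma> x)))
        (odot X Y \<phi> (\<lambda>y. Crl (\<rho> y)) (\<lambda>x. Crl (\<sigma> x)) (\<lambda>x. Crl_rel (\<rho> (\<phi> x)) (\<sigma> x) (\<Phi> x)))"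
      by (intro linear_relation_odot \<phi> vectorspace_Crl linear_relation_Crl_rel \<rho> \<sigma> \<Phi> \<phi>Y)
    show "linear_relation (Crl c) (Crl b) (Crl_rel c b f)"
      by (rule linear_relation_Crl_rel[OF c b f])
    show "linear_map real_field (family_sum Y (\<lambda>y. Crl (\<rho> y))) (Crl c) (ssub_network_Crl Y \<rho> c \<nu>)"
      by (rule linear_map_ssub_network_Crl[OF netY])
    show "linear_map real_field (family_sum X (\<lambda>x. Crl (\<sigma> x))) (Crl b) (ssub_network_Crl X \<sigma> b \<psi>)"
      by (rule linear_map_ssub_network_Crl[OF netX])
  qed (use incl in auto)
qed

section \<open>Networks of hybrid open systems\<close>

lemma UU_simps [simp]:
  "tot (UU a) = U_obj (tot a)" "st (UU a) = U_obj (st a)" "prj (UU a) = U_map (prj a)"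
  by (simp_all add: UU_def)

lemma UU_map_simps [simp]: "sq_tot (UU_map f) = U_map (sq_tot f)" "sq_st (UU_map f) = U_map (sq_st f)"
  by (simp_all add: UU_map_def)

lemma U_map_hcomp: "U_map (hcomp g f) w = U_map g (U_map f w)"
  by (cases w) (simp add: U_map_def hcomp_def)

lemma U_map_hyeq:
  assumes "hyeq a f g" "w \<in> pts (U_obj a)"
  shows "U_map f w = U_map g w"
  using assms by (cases w) (simp add: U_map_def hyeq_def pts_U_obj)

lemma U_prod_hytuple:
  assumes "x \<in> X"
  shows "U_prod X (U_map (hytuple X \<phi> \<Phi>) w) x = U_map (\<Phi> x) (fst w (\<phi> x), snd w (\<phi> x))"
  using assms by (cases w) (simp add: U_map_def hytuple_def U_prod_def)

lemma smooth_ssub_UU: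
  assumes "hybrid_ssub a"
  shows "smooth_phase_space (tot a)" "smooth_phase_space (st a)" "smooth_ssub (UU a)"
proof -
  show t: "smooth_phase_space (tot a)" and s: "smooth_phase_space (st a)"
    using assms smooth_phase_spaceI by (auto simp: hybrid_ssub_def)
  show "smooth_ssub (UU a)"
    using assms smooth_atlas_U_obj[OF t] smooth_atlas_U_obj[OF s]
    by (simp add: smooth_ssub_def hybrid_ssub_def surj_submersion_def)
qed

lemma smooth_square_UU_map:
  assumes a: "hybrid_ssub a" and b: "hybrid_ssub b" and f: "hyssub_mor a b f"
  shows "smooth_square (UU a) (UU b) (UU_map f)"
proof -
  have "U_map (prj b) (U_map (sq_tot f) q) = U_map (sq_st f) (U_map (prj a) q)" if "q \<in> pts (U_obj (tot a))" for q
    using f U_map_hyeq[OF _ that, of "hcomp (prj b) (sq_tot f)" "hcomp (sq_st f) (prj a)"]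
    by (simp add: hyssub_mor_def U_map_hcomp)
  then show ?thesis
    using f smooth_U_map[OF smooth_ssub_UU(1)[OF a] smooth_ssub_UU(1)[OF b]]
      smooth_U_map[OF smooth_ssub_UU(2)[OF a] smooth_ssub_UU(2)[OF b]]
    by (simp add: smooth_square_def hyssub_mor_def)
qed

lemma hyssub_prod_simps [simp]:
  "tot (hyssub_prod X \<tau>) = hyph_prod X (\<lambda>x. tot (\<tau> x))" "st (hyssub_prod X \<tau>) = hyph_prod X (\<lambda>x. st (\<tau> x))"
  "prj (hyssub_prod X \<tau>) = hytuple X (\<lambda>x. x) (\<lambda>x. prj (\<tau> x))"
  by (simp_all add: hyssub_prod_def)

text \<open>
  The comparison map from \<open>U\<close> of a product to the product of the \<open>U\<close> is a diffeomorphism, so composing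
  with it keeps the map on states invertible.
\<close>

lemma interconnected_hybrid_network:
  assumes net: "hybrid_network X \<tau> b \<psi>"
  shows "interconnected X (\<lambda>x. UU (\<tau> x)) (UU b) (ssub_comp (UU_prod X) (UU_map \<psi>))
    (inv_into (pts (U_obj (st b))) (U_map (sq_st \<psi>)) \<circ> U_unprod X)"
proof -
  have X: "finite X" and \<tau>: "\<And>x. x \<in> X \<Longrightarrow> hybrid_ssub (\<tau> x)" and b: "hybrid_ssub b"
    and mor: "hyssub_mor b (hyssub_prod X \<tau>) \<psi>"
    and dif: "diffeo (U_obj (st b)) (U_obj (hyph_prod X (\<lambda>x. st (\<tau> x)))) (U_map (sq_st \<psi>))"
    using net by (auto simp: hybrid_network_def interconnection_def)
  let ?T = "hyph_prod X (\<lambda>x. tot (\<tau> x))" and ?S = "hyph_prod X (\<lambda>x. st (\<tau> x))"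
  let ?inv = "inv_into (pts (U_obj (st b))) (U_map (sq_st \<psi>))"
  note b' = smooth_ssub_UU[OF b] and \<tau>' = smooth_ssub_UU[OF \<tau>]
  have T: "smooth_phase_space ?T" and S: "smooth_phase_space ?S"
    by (auto intro!: smooth_phase_space_hyph_prod[OF X] \<tau>')
  note aT = smooth_atlas_U_obj[OF T] and aS = smooth_atlas_U_obj[OF S]
    and abt = smooth_atlas_U_obj[OF b'(1)] and abs = smooth_atlas_U_obj[OF b'(2)]
  have pT: "smooth_atlas (mfd_prod X (\<lambda>x. U_obj (tot (\<tau> x))))"
    and pS: "smooth_atlas (mfd_prod X (\<lambda>x. U_obj (st (\<tau> x))))"
    by (auto intro!: smooth_atlas_prod_U_obj[OF X] \<tau>')
  have m_tot: "smooth (U_obj (tot b)) (U_obj ?T) (U_map (sq_tot \<psi>))"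
    using smooth_U_map[OF b'(1) T] mor by (simp add: hyssub_mor_def)
  have m_st: "smooth (U_obj (st b)) (U_obj ?S) (U_map (sq_st \<psi>))"
    using dif by (simp add: diffeo_def)
  have s_tot: "smooth (U_obj (tot b)) (mfd_prod X (\<lambda>x. U_obj (tot (\<tau> x)))) (\<lambda>q. U_prod X (U_map (sq_tot \<psi>) q))"
    by (rule smooth_compose[OF abt aT smooth_atlas_chart_like[OF pT] m_tot smooth_U_prod[OF X \<tau>'(1)]])
  have s_st: "smooth (U_obj (st b)) (mfd_prod X (\<lambda>x. U_obj (st (\<tau> x)))) (\<lambda>q. U_prod X (U_map (sq_st \<psi>) q))"
    by (rule smooth_compose[OF abs aS smooth_atlas_chart_like[OF pS] m_st smooth_U_prod[OF X \<tau>'(2)]])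
  have un: "smooth (mfd_prod X (\<lambda>x. U_obj (st (\<tau> x)))) (U_obj ?S) (U_unprod X)"
    by (rule smooth_U_unprod[OF X \<tau>'(2)])
  have "smooth (U_obj ?S) (U_obj (st b)) ?inv"
    using dif by (simp add: diffeo_def)
  from smooth_compose[OF pS aS smooth_atlas_chart_like[OF abs] un this]
  have s_inv: "smooth (mfd_prod X (\<lambda>x. U_obj (st (\<tau> x)))) (U_obj (st b)) (\<lambda>n. ?inv (U_unprod X n))" .
  have bij: "bij_betw (U_map (sq_st \<psi>)) (pts (U_obj (st b))) (pts (U_obj ?S))"
    using dif by (simp add: diffeo_def)
  have square: "(\<lambda>x\<in>X. U_map (prj (\<tau> x)) (U_prod X (U_map (sq_tot \<psi>) q) x)) =
      U_prod X (U_map (sq_st \<psi>) (U_map (prj b) q))" if q: "q \<in> pts (U_obj (tot b))" for q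
  proof -
    have "U_map (prj (hyssub_prod X \<tau>)) (U_map (sq_tot \<psi>) q) = U_map (sq_st \<psi>) (U_map (prj b) q)"
      using mor U_map_hyeq[OF _ q, of "hcomp (prj (hyssub_prod X \<tau>)) (sq_tot \<psi>)" "hcomp (sq_st \<psi>) (prj b)"]
      by (simp add: hyssub_mor_def U_map_hcomp)
    then have "U_prod X (U_map (sq_st \<psi>) (U_map (prj b) q)) =
        U_prod X (U_map (hytuple X (\<lambda>x. x) (\<lambda>x. prj (\<tau> x))) (U_map (sq_tot \<psi>) q))" by simp
    also have "\<dots> = (\<lambda>x\<in>X. U_map (prj (\<tau> x)) (U_prod X (U_map (sq_tot \<psi>) q) x))"
      by (auto simp: U_prod_def U_map_def hytuple_def split_beta fun_eq_iff restrict_def)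
    finally show ?thesis by simp
  qed
  have inv1: "?inv (U_unprod X (U_prod X (U_map (sq_st \<psi>) m))) = m" if m: "m \<in> pts (U_obj (st b))" for m
    using U_unprod_U_prod[OF smooth_maps_to[OF m_st m]] bij_betw_inv_into_left[OF bij m] by simp
  have inv2: "U_prod X (U_map (sq_st \<psi>) (?inv (U_unprod X n))) = n"
    if n: "n \<in> pts (mfd_prod X (\<lambda>x. U_obj (st (\<tau> x))))" for n
  proof -
    have "n \<in> extensional X" using n by (simp add: PiE_iff)
    then show ?thesis
      using bij_betw_inv_into_right[OF bij smooth_maps_to[OF un n]] U_prod_U_unprod by simp
  qed
  show ?thesis
    unfolding interconnected_def smooth_square_def
    using X \<tau>'(3) b'(3) s_tot s_st s_inv square inv1 inv2
    by (simp add: ssub_comp_def UU_prod_def o_def)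
qed

theorem theorem6p19:
  fixes X :: "'i set" and Y :: "'j set" and \<phi> :: "'i \<Rightarrow> 'j"
  assumes "hybrid_network X \<tau> b \<psi>"
    and "hybrid_network Y \<mu> c \<nu>"
    and "hybrid_network_map X \<tau> b \<psi> Y \<mu> c \<nu> \<phi> \<Phi> f"
  shows "relvect_cell
    (family_sum Y (\<lambda>y. Crl (UU (\<mu> y)))) (family_sum X (\<lambda>x. Crl (UU (\<tau> x))))
    (Crl (UU c)) (Crl (UU b))
    (odot X Y \<phi> (\<lambda>y. Crl (UU (\<mu> y))) (\<lambda>x. Crl (UU (\<tau> x)))
       (\<lambda>x. Crl_rel (UU (\<mu> (\<phi> x))) (UU (\<tau> x)) (UU_map (\<Phi> x))))
    (Crl_rel (UU c) (UU b) (UU_map f))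
    (network_Crl Y \<mu> c \<nu>) (network_Crl X \<tau> b \<psi>)"
proof -
  have \<tau>: "\<And>x. x \<in> X \<Longrightarrow> hybrid_ssub (\<tau> x)" and b: "hybrid_ssub b"
    and \<mu>: "\<And>y. y \<in> Y \<Longrightarrow> hybrid_ssub (\<mu> y)" and c: "hybrid_ssub c"
    using assms(1,2) by (auto simp: hybrid_network_def)
  have \<phi>: "\<phi> \<in> X \<rightarrow> Y" and \<Phi>: "\<And>x. x \<in> X \<Longrightarrow> hyssub_mor (\<mu> (\<phi> x)) (\<tau> x) (\<Phi> x)"
    and f: "hyssub_mor c b f"
    and comm: "hyssub_eq c (hyssub_comp (hyssub_tuple X \<phi> \<Phi>) \<nu>) (hyssub_comp \<psi> f)"
    using assms(3) by (auto simp: hybrid_network_map_def)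
  have \<phi>Y: "\<phi> x \<in> Y" if "x \<in> X" for x using \<phi> that by auto
  have ct: "hyeq (tot c) (hcomp (hytuple X \<phi> (\<lambda>x. sq_tot (\<Phi> x))) (sq_tot \<nu>)) (hcomp (sq_tot \<psi>) (sq_tot f))"
    and cs: "hyeq (st c) (hcomp (hytuple X \<phi> (\<lambda>x. sq_st (\<Phi> x))) (sq_st \<nu>)) (hcomp (sq_st \<psi>) (sq_st f))"
    using comm by (auto simp: hyssub_eq_def hyssub_comp_def hyssub_tuple_def)
  have "network_Crl Y \<mu> c \<nu> = ssub_network_Crl Y (\<lambda>y. UU (\<mu> y)) (UU c) (ssub_comp (UU_prod Y) (UU_map \<nu>))"
    "network_Crl X \<tau> b \<psi> = ssub_network_Crl X (\<lambda>x. UU (\<tau> x)) (UU b) (ssub_comp (UU_prod X) (UU_map \<psi>))"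
    by (simp_all add: network_Crl_def ssub_network_Crl_def)
  moreover have "U_prod X (U_map (sq_tot \<psi>) (U_map (sq_tot f) q)) x =
      U_map (sq_tot (\<Phi> x)) (U_prod Y (U_map (sq_tot \<nu>) q) (\<phi> x))"
    if "q \<in> pts (U_obj (tot c))" "x \<in> X" for q x
    using U_map_hyeq[OF ct that(1)] U_prod_hytuple[OF that(2), of \<phi> "\<lambda>x. sq_tot (\<Phi> x)" "U_map (sq_tot \<nu>) q"]
      \<phi>Y[OF that(2)] by (simp add: U_map_hcomp) (simp add: U_prod_def split_beta)
  moreover have "U_prod X (U_map (sq_st \<psi>) (U_map (sq_st f) m)) x =
      U_map (sq_st (\<Phi> x)) (U_prod Y (U_map (sq_st \<nu>) m) (\<phi> x))"
    if "m \<in> pts (U_obj (st c))" "x \<in> X" for m x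
    using U_map_hyeq[OF cs that(1)] U_prod_hytuple[OF that(2), of \<phi> "\<lambda>x. sq_st (\<Phi> x)" "U_map (sq_st \<nu>) m"]
      \<phi>Y[OF that(2)] by (simp add: U_map_hcomp) (simp add: U_prod_def split_beta)
  ultimately show ?thesis
    using smooth_square_UU_map[OF \<mu>[OF \<phi>Y] \<tau> \<Phi>] smooth_square_UU_map[OF c b f]
    by (simp only:) (intro ssub_network_cell[OF interconnected_hybrid_network[OF assms(1)]
        interconnected_hybrid_network[OF assms(2)] \<phi>]; simp add: ssub_comp_def UU_prod_def)
qed


end
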